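(* Let $P$ and $S$ be the weakening-and-projection monad and the substitution monad on $[\mathcal H^{\mathrm{op}},\mathbf{Set}]$, and let $\delta\colon SP\Rightarrow PS$ be the distributive law determined by the monad for GATs (all defined in the context). For each $X\in[\mathcal H^{\mathrm{op}},\mathbf{Set}]$, the action of $\delta_X$ is given on type-elements $SPX(n)\to PSX(n)$ by $$(\alpha,(\phi,h,k))\mapsto(\alpha^*\bar\phi,(\alpha^{\bar\phi},h+k)),$$ and on term-elements $\mathrm{Tm}_{SPX}(\alpha,(\phi,h,k))\to\mathrm{Tm}_{PSX}(\alpha^*\bar\phi,(\alpha^{\bar\phi},h+k))$ by $$a\mapsto\begin{cases}a&\text{if }a\in\mathrm{Tm}_X(h(\alpha(n)));\\ \pi_m&\text{if }a=\pi_j\text{ and }\min\{i:i\leq_kj\}=\alpha(m);\\ k(m)&\text{if }a=\pi_j\text{ and }m=\min\{i:i\leq_kj\}\notin\mathrm{Im}\,\alpha.\end{cases}$$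
   Context: \textbf{Expressions and judgements.} Fix a denumerable set $\mathrm{Var}$ of variables. Given an alphabet $\Xi$, the expressions over $\Xi$ are generated as follows: each $x\in\mathrm{Var}$ is an expression; if $n\geq 0$, $e_1,\dots,e_n$ are expressions and $w\in\Xi$, then $w(e_1,\dots,e_n)$ is an expression (written $w$ when $n=0$). $\mathsf{fv}$ denotes free variables and $e'[e/x]$ substitution of $e$ for $x$ in $e'$. A context is a (possibly empty) list $x_1:T_1,\dots,x_n:T_n$ of distinct variables $x_i$ and expressions $T_i$; $\mathsf{fv}(\Gamma)$ is the set of variables occurring in $\Gamma$. A judgement is a string $\Gamma\vdash T\ \mathsf{type}$ (type judgement), $\Gamma\vdash t:T$ (term judgement), $\Gamma\vdash T=T'\ \mathsf{type}$ (type equality) or $\Gamma\vdash t=t':T$ (term equality), with $\Gamma$ a context and $t,t',T,T'$ expressions; its degree is one more than the length of $\Gamma$. The boundary of a judgement is a list of judgements: $\partial(\vdash T\ \mathsf{type})=()$; $\partial(\Gamma,x:T\vdash T'\ \mathsf{type})=(\Gamma\vdash T\ \mathsf{type})$; $\partial(\Gamma\vdash t:T)=(\Gamma\vdash T\ \mathsf{type})$; $\partial(\Gamma\vdash T=T'\ \mathsf{type})=(\Gamma\vdash T\ \mathsf{type},\ \Gamma\vdash T'\ \mathsf{type})$; $\partial(\Gamma\vdash t=t':T)=(\Gamma\vdash t:T,\ \Gamma\vdash t':T)$. \textbf{Deduction rules} (premises $\Longrightarrow$ conclusion; $\mathcal J$ stands for the right-hand side of any of the four judgement forms). \emph{Equality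 and $\alpha$ rules}: $\Gamma\vdash t:T\Longrightarrow\Gamma\vdash t=t:T$; $\Gamma\vdash t_1=t_2:T\Longrightarrow\Gamma\vdash t_2=t_1:T$; $\Gamma\vdash t_1=t_2:T$ and $\Gamma\vdash t_2=t_3:T\Longrightarrow\Gamma\vdash t_1=t_3:T$; $\Gamma\vdash T\ \mathsf{type}\Longrightarrow\Gamma\vdash T=T\ \mathsf{type}$; $\Gamma\vdash T_1=T_2\ \mathsf{type}\Longrightarrow\Gamma\vdash T_2=T_1\ \mathsf{type}$; $\Gamma\vdash T_1=T_2\ \mathsf{type}$ and $\Gamma\vdash T_2=T_3\ \mathsf{type}\Longrightarrow\Gamma\vdash T_1=T_3\ \mathsf{type}$; $\Gamma\vdash T_1=T_2\ \mathsf{type}$ and $\Gamma\vdash t:T_1\Longrightarrow\Gamma\vdash t:T_2$; $\Gamma\vdash T_1=T_2\ \mathsf{type}$ and $\Gamma\vdash t_1=t_2:T_1\Longrightarrow\Gamma\vdash t_1=t_2:T_2$; $\Gamma\vdash\mathcal J\Longrightarrow\sigma\cdot\Gamma\vdash\sigma\cdot\mathcal J$ for any permutation $\sigma\in\mathrm{Sym}(\mathrm{Var})$ acting on variables. \emph{Weakening} ($w$): $\Gamma\vdash T\ \mathsf{type}$ and $\Gamma,\Delta\vdash\mathcal J\Longrightarrow\Gamma,y:T,\Delta\vdash\mathcal J$, for $y\notin\mathsf{fv}(\Gamma)\cup\mathsf{fv}(\Delta)$. \emph{Projection} ($p$): $\Gamma\vdash T\ \mathsf{type}\Longrightarrow\Gamma,y:T\vdash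 y:T$, for $y\notin\mathsf{fv}(\Gamma)$. \emph{Substitution} ($s$): $\Gamma\vdash t:T$ and $\Gamma,y:T,\Delta\vdash\mathcal J\Longrightarrow\Gamma,\Delta[t/y]\vdash\mathcal J[t/y]$; $\Gamma\vdash t_1=t_2:T$ and $\Gamma,y:T,\Delta\vdash T'\ \mathsf{type}\Longrightarrow\Gamma,\Delta[t_2/y]\vdash T'[t_1/y]=T'[t_2/y]\ \mathsf{type}$; $\Gamma\vdash t_1=t_2:T$ and $\Gamma,y:T,\Delta\vdash t':T'\Longrightarrow\Gamma,\Delta[t_2/y]\vdash t'[t_1/y]=t'[t_2/y]:T'[t_2/y]$. \textbf{$D$-GATs.} Let $D\subset\{w,p,s\}$ be such that $p\in D$ implies $w\in D$. A $D$-GAT $\mathbb T$ consists of a collection $\Omega$ of type-constants, a collection $\Sigma$ of term-constants and a collection $\Lambda$ of basic judgements over $\Omega\amalg\Sigma$ such that: for each $A\in\Omega$ there is a unique judgement in $\Lambda$ of the form $x_1:T_1,\dots,x_{n-1}:T_{n-1}\vdash A(x_1,\dots,x_{n-1})\ \mathsf{type}$; for each $f\in\Sigma$ there is a unique judgement in $\Lambda$ of the form $x_1:T_1,\dots,x_{n-1}:T_{n-1}\vdash f(x_1,\dots,x_{n-1}):T$; all other elements of $\Lambda$ are type or term equality judgements; each element of $\Lambda$ lies in $\mathbb T^*$. Here $\mathbb T^*$, the collection of derived judgements, is the smallest collection closed under the equality and $\alpha$ rules and the rules in $D$, and containing $\mathcal J\in\Lambda$ whenever it contains each judgement in $\partial(\mathcal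 J)$. An interpretation $\phi\colon\mathbb T\to\mathbb U$ of $D$-GATs is a function $\phi\colon\mathbb T^*\to\mathbb U^*$ preserving boundaries and preserving deduction: viewing each available rule with $n$ premises (for each choice of parameters such as $y$ or $\sigma$) as an $n$-ary partial function $r$ on judgements, $\phi(r(\mathcal J_1,\dots,\mathcal J_n))=r(\phi(\mathcal J_1),\dots,\phi(\mathcal J_n))$ whenever both sides are defined. On derived type judgements, $(x_1:S_1,\dots,x_{n-1}:S_{n-1}\vdash S_n\ \mathsf{type})\equiv(y_1:T_1,\dots,y_{m-1}:T_{m-1}\vdash T_m\ \mathsf{type})$ iff $n=m$ and for $1\le i\le n$ the judgement $x_1:S_1,\dots,x_{i-1}:S_{i-1}\vdash S_i=T_i[x_1/y_1,\dots,x_{i-1}/y_{i-1}]\ \mathsf{type}$ is derived. On derived term judgements, $(x_1:S_1,\dots,x_{n-1}:S_{n-1}\vdash s:S_n)\equiv(y_1:T_1,\dots,y_{m-1}:T_{m-1}\vdash t:T_m)$ iff their boundaries are $\equiv$ and $x_1:S_1,\dots,x_{n-1}:S_{n-1}\vdash s=t[x_1/y_1,\dots,x_{n-1}/y_{n-1}]:S_n$ is derived. $D\text{-}\mathbf{GAT}$ has $D$-GATs as objects and, as morphisms, interpretations modulo: $\phi\sim\phi'$ iff $\phi(\mathcal J)\equiv\phi'(\mathcal J)$ for each derived type or term judgement $\mathcal J$. \textbf{Type-and-term structures and the monads.} $[a,b]=\{a,\dots,b\}\subset\mathbb N$ and $[n]=[1,n]$. $\mathcal H$ is the category freely generated by the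 graph with objects $n$ and $n_t$ ($n\ge1$) and arrows $n\to n+1$ and $n\to n_t$. For $X\in[\mathcal H^{\mathrm{op}},\mathbf{Set}]$ the maps $X(n+1)\to X(n)$, $X(n_t)\to X(n)$ are written $\partial$; elements of $X(n)$ are type-elements, elements of $X(n_t)$ term-elements; for $A\in X(n)$, $\mathrm{Tm}_X(A)=\{a\in X(n_t):\partial a=A\}$. The forgetful functor $V_D\colon D\text{-}\mathbf{GAT}\to[\mathcal H^{\mathrm{op}},\mathbf{Set}]$ has $V_D\mathbb T(n)$ (resp. $V_D\mathbb T(n_t)$) the set of derived type (resp. term) judgements of degree $n$ modulo $\equiv$, boundaries induced by $\partial$, and $V_D\phi([\mathcal J])=[\phi(\mathcal J)]$. Its left adjoint $G_D$ sends $X$ to the free $D$-GAT $G_DX$ whose type- and term-constants are the type- and term-elements of $X$ and whose basic judgements are $\mathcal J_A=(x_1:A_1,x_2:A_2(x_1),\dots,x_{n-1}:A_{n-1}(x_1,\dots,x_{n-2})\vdash A(x_1,\dots,x_{n-1})\ \mathsf{type})$ for $A\in X(n)$, where $A_i=\partial^{n-i}A$, and, in the same context, $\mathcal J_a=(\dots\vdash a(x_1,\dots,x_{n-1}):A(x_1,\dots,x_{n-1}))$ for $a\in\mathrm{Tm}_X(A)$. The adjunction unit is $A\mapsto[\mathcal J_A]$, $a\mapsto[\mathcal J_a]$; the counit $\epsilon_{\mathbb T}\colon G_DV_D\mathbb T\to\mathbb T$ is given on basic judgements by $\mathcal J_{[\mathcal J]}\mapsto\mathcal J$. The induced monad is $V_DG_D$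 with multiplication $V_D\epsilon G_D$; $P$, $S$, $T$ are the cases $D=\{w,p\}$, $\{s\}$, $\{w,p,s\}$, with units $\eta^P,\eta^S,\eta^T$ and multiplications $\mu^P,\mu^S,\mu^T$. \textbf{The distributive law $\delta$.} Let $\rho\colon P\Rightarrow T$ and $\sigma\colon S\Rightarrow T$ send the class of a judgement derivable in the free $\{w,p\}$- (resp. $\{s\}$-)GAT on $X$ to the class of the same judgement in the free GAT on $X$. The maps $\kappa_X=\mu^T_X\circ\rho_{TX}\circ P\sigma_X\colon PSX\to TX$ are invertible, and transporting the monad structure of $T$ along them gives a monad structure on $PS$ with multiplication $\mu^{PS}$. Then $\delta$ is the composite $SP\xrightarrow{\eta^PSP\eta^S}PSPS\xrightarrow{\mu^{PS}}PS$. \textbf{Description of $P$.} A min-heap of size $n$ is a function $\phi\colon[0,n]\to[0,n]$ with $\phi(0)=0$ and $\phi(i)<i$ for $i\in[n]$; $\mathrm{Hp}(n)$ is the set of these. For $i\in[n]$, $\mathsf{dp}_\phi(i)=|\{\phi(i),\phi^2(i),\dots\}|$. Write $i\preccurlyeq_\phi j$ (on $[n]$) iff $i=\phi^k(j)$ for some $k\ge0$, and $\downarrow_\phi(j)=\{i:i\preccurlyeq_\phi j\}$, which is linearly ordered; $\phi$ is recovered from $\preccurlyeq_\phi$ by $\phi(j)=\max\{i\in[0,j-1]:i=0\text{ or }i\preccurlyeq_\phi j\}$. The presheaf $[\phi]$ has $[\phi](m)=\{i\in[n]:\mathsf{dp}_\phi(i)=m\}$, $[\phi](m_t)=\emptyset$,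 $\partial(i)=\phi(i)$. One has $PX(n)=\sum_{\phi\in\mathrm{Hp}(n)}[\mathcal H^{\mathrm{op}},\mathbf{Set}]([\phi],X)$, with boundaries given by restriction to $[0,n-1]$, and $\mathrm{Tm}_{PX}(\phi,h)=\mathrm{Tm}_X(h(n))+\{\pi_i:i\in[n-1],\phi(n)=\phi(i),h(n)=h(i)\}$. Here $(\phi,h)$ is identified with the class of $x_1:T_1,\dots,x_{n-1}:T_{n-1}\vdash T_n\ \mathsf{type}$ with $T_i=h(i)(x_{j_1},\dots,x_{j_{r-1}})$, $r=\mathsf{dp}_\phi(i)$, $j_\ell=\phi^{r-\ell}(i)$; $a\in\mathrm{Tm}_X(h(n))$ with the class of $x_1:T_1,\dots,x_{n-1}:T_{n-1}\vdash a(x_{j_1},\dots,x_{j_{r-1}}):T_n$ (indices for $i=n$); $\pi_i$ with the class of $x_1:T_1,\dots,x_{n-1}:T_{n-1}\vdash x_i:T_i$. \textbf{Description of $S$.} An inc-list of length $n$ is a strictly increasing function $\alpha\colon[0,n]\to\mathbb N$ with $\alpha(0)=0$; $\mathrm{Inc}(n)$ is the set of these. The presheaf $[\alpha]$ has $[\alpha](i)=\{i\}$ if $i\le\alpha(n)$ and $\emptyset$ otherwise, $[\alpha](i_t)=\{i_t\}$ if $i\le\alpha(n)$ and $i\notin\mathrm{Im}\,\alpha$ and $\emptyset$ otherwise, with the unique possible boundaries. One has $SX(n)=\sum_{\alpha\in\mathrm{Inc}(n)}[\mathcal H^{\mathrm{op}},\mathbf{Set}]([\alpha],X)$, with boundaries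 given by restriction to $[0,n-1]$, and $\mathrm{Tm}_{SX}(\alpha,h)=\mathrm{Tm}_X(h(\alpha(n)))$. Here, with $e_j=x_m$ if $j=\alpha(m)$ and $e_j=h(j_t)(e_1,\dots,e_{j-1})$ if $j\notin\mathrm{Im}\,\alpha$, the pair $(\alpha,h)$ is identified with the class of $x_1:T_1,\dots,x_{n-1}:T_{n-1}\vdash T_n\ \mathsf{type}$, $T_i=h(\alpha(i))(e_1,\dots,e_{\alpha(i)-1})$, and $a\in\mathrm{Tm}_X(h(\alpha(n)))$ with the class of $x_1:T_1,\dots,x_{n-1}:T_{n-1}\vdash a(e_1,\dots,e_{\alpha(n)-1}):T_n$. \textbf{Elements of $PSX$ and $SPX$.} A type-element of $PSX(n)$ is $(\phi,(\alpha,h))$ with $\phi\in\mathrm{Hp}(n)$ and $(\alpha_i,h_i)\in SX(\mathsf{dp}_\phi(i))$ for $i\in[n]$, with $\partial(\alpha_i,h_i)=(\alpha_j,h_j)$ whenever $\phi(i)=j>0$; and $\mathrm{Tm}_{PSX}(\phi,(\alpha,h))=\mathrm{Tm}_{SX}(\alpha_n,h_n)+\{\pi_i:i\in[n-1],\phi(n)=\phi(i),\alpha_n=\alpha_i,h_n=h_i\}$. A type-element of $SPX(n)$ is $(\alpha,(\phi,h,k))$ with $\alpha\in\mathrm{Inc}(n)$, where the map $[\alpha]\to PX$ is determined by its value $(\phi\in\mathrm{Hp}(\alpha(n)),h\colon[\phi]\to X)$ at $\alpha(n)$ and its values $k(i)\in\mathrm{Tm}_{PX}(\phi|_i,h|_i)=\mathrm{Tm}_X(h(i))+\{\pi_j:j\in[i-1],\phi(i)=\phi(j),h(i)=h(j)\}$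 at $i_t$ for $i\in[\alpha(n)]\setminus\mathrm{Im}\,\alpha$; here $\phi|_i$ is the restriction of $\phi$ to $[0,i]$ and $h|_i$ that of $h$ to $[\phi|_i]$. One has $\mathrm{Tm}_{SPX}(\alpha,(\phi,h,k))=\mathrm{Tm}_{PX}(\phi,h)=\mathrm{Tm}_X(h(\alpha(n)))+\{\pi_j:j\in[\alpha(n)-1],\phi(\alpha(n))=\phi(j),h(\alpha(n))=h(j)\}$. \textbf{Constructions.} An element $(\alpha,(\phi,h,k))\in SPX(n)$ is nearly projection-free if $k(i)$ is a projection $\pi_j$ only for $i\notin\mathrm{Im}\,\phi$. For such an element, $\alpha^*\phi\in\mathrm{Hp}(n)$ is the heap with $i\preccurlyeq_{\alpha^*\phi}j$ iff $\alpha(i)\preccurlyeq_\phi\alpha(j)$. For $p\in[n]$ with $\downarrow_{\alpha^*\phi}(p)=\{p_1\prec\dots\prec p_m=p\}$ and $\downarrow_\phi(\alpha(p))=\{v_1\prec\dots\prec v_\ell=\alpha(p)\}$, $\alpha^\phi_p\in\mathrm{Inc}(m)$ is $\alpha^\phi_p(i)=\mathsf{dp}_\phi(\alpha(p_i))$ and $(h+k)_p\colon[\alpha^\phi_p]\to X$ is $(h+k)_p(i)=h(v_i)$ for $i\in[\ell]$ and $(h+k)_p(i_t)=k(v_i)$ for $i\in[\ell]\setminus\mathrm{Im}\,\alpha^\phi_p$. These give a map $(\alpha^\phi,h+k)\colon[\alpha^*\phi]\to SX$ and so an element $(\alpha^*\phi,(\alpha^\phi,h+k))\in PSX(n)$.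 For a general $(\alpha,(\phi,h,k))\in SPX(n)$, $\leq_k$ is the partial order on $[0,\alpha(n)]$ generated by $i\leq_kj$ whenever $j\notin\mathrm{Im}\,\alpha$ and $k(j)=\pi_i$, and $\bar\phi\in\mathrm{Hp}(\alpha(n))$ is $\bar\phi(i)=\min\{j:j\leq_k\phi(i)\}$. Then $(\alpha,(\bar\phi,h,k))$ is a well-defined nearly projection-free element of $SPX(n)$, so $(\alpha^*\bar\phi,(\alpha^{\bar\phi},h+k))\in PSX(n)$ is defined. *)

theory Defs
  imports Main "HOL-Library.FuncSet"
begin

section \<open>Expressions and judgements\<close>

text \<open>The set of variables is \<^typ>\<open>nat\<close>.\<close>

datatype 'c expr = V nat | App 'c "'c expr list"

primrec fv :: "'c expr \<Rightarrow> nat set" where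
  "fv (V x) = {x}"
| "fv (App c es) = \<Union> (set (map fv es))"

primrec syms :: "'c expr \<Rightarrow> 'c set" where
  "syms (V x) = {}"
| "syms (App c es) = insert c (\<Union> (set (map syms es)))"

text \<open>Simultaneous substitution; single substitution and renaming of variables are instances.\<close>

primrec esubst :: "(nat \<Rightarrow> 'c expr) \<Rightarrow> 'c expr \<Rightarrow> 'c expr" where
  "esubst \<theta> (V x) = \<theta> x"
| "esubst \<theta> (App c es) = App c (map (esubst \<theta>) es)"

definition sub1 :: "'c expr \<Rightarrow> nat \<Rightarrow> 'c expr \<Rightarrow> 'c expr" where
  "sub1 e x = esubst (V(x := e))"

definition ren :: "(nat \<Rightarrow> nat) \<Rightarrow> 'c expr \<Rightarrow> 'c expr" where
  "ren \<sigma> = esubst (\<lambda>x. V (\<sigma> x))"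

type_synonym 'c ctx = "(nat \<times> 'c expr) list"

text \<open>Right-hand sides: \<open>T type\<close>, \<open>t : T\<close>, \<open>T = T' type\<close> and \<open>t = t' : T\<close>.\<close>

datatype 'c rhs =
  IsType "'c expr"
| HasType "'c expr" "'c expr"
| TypeEq "'c expr" "'c expr"
| TermEq "'c expr" "'c expr" "'c expr"

primrec map_rhs_expr :: "('c expr \<Rightarrow> 'c expr) \<Rightarrow> 'c rhs \<Rightarrow> 'c rhs" where
  "map_rhs_expr f (IsType T) = IsType (f T)"
| "map_rhs_expr f (HasType t T) = HasType (f t) (f T)"
| "map_rhs_expr f (TypeEq T T') = TypeEq (f T) (f T')"
| "map_rhs_expr f (TermEq t t' T) = TermEq (f t) (f t') (f T)"

primrec rhs_exprs :: "'c rhs \<Rightarrow> 'c expr set" where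
  "rhs_exprs (IsType T) = {T}"
| "rhs_exprs (HasType t T) = {t, T}"
| "rhs_exprs (TypeEq T T') = {T, T'}"
| "rhs_exprs (TermEq t t' T) = {t, t', T}"

datatype 'c judgement = Judg (ctx_of: "'c ctx") (rhs_of: "'c rhs")

definition judgement_over :: "'c set \<Rightarrow> 'c judgement \<Rightarrow> bool" where
  "judgement_over \<Xi> J \<longleftrightarrow> distinct (map fst (ctx_of J)) \<and>
     (\<forall>e \<in> snd ` set (ctx_of J) \<union> rhs_exprs (rhs_of J). syms e \<subseteq> \<Xi>)"

definition ctx_vars :: "'c ctx \<Rightarrow> nat set" where
  "ctx_vars \<Gamma> = (\<Union>(x, T) \<in> set \<Gamma>. insert x (fv T))"

definition map_ctx :: "('c expr \<Rightarrow> 'c expr) \<Rightarrow> 'c ctx \<Rightarrow> 'c ctx" where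
  "map_ctx f = map (\<lambda>(x, T). (x, f T))"

definition perm_judgement :: "(nat \<Rightarrow> nat) \<Rightarrow> 'c judgement \<Rightarrow> 'c judgement" where
  "perm_judgement \<sigma> J = Judg (map (\<lambda>(x, T). (\<sigma> x, ren \<sigma> T)) (ctx_of J)) (map_rhs_expr (ren \<sigma>) (rhs_of J))"

definition degree :: "'c judgement \<Rightarrow> nat" where
  "degree J = Suc (length (ctx_of J))"

definition is_type_judgement :: "'c judgement \<Rightarrow> bool" where
  "is_type_judgement J \<longleftrightarrow> (\<exists>T. rhs_of J = IsType T)"

definition is_term_judgement :: "'c judgement \<Rightarrow> bool" where
  "is_term_judgement J \<longleftrightarrow> (\<exists>t T. rhs_of J = HasType t T)"

definition is_equality_judgement :: "'c judgement \<Rightarrow> bool" where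
  "is_equality_judgement J \<longleftrightarrow> (\<exists>T T'. rhs_of J = TypeEq T T') \<or> (\<exists>t t' T. rhs_of J = TermEq t t' T)"

fun boundary :: "'c judgement \<Rightarrow> 'c judgement list" where
  "boundary (Judg \<Gamma> (IsType T)) = (if \<Gamma> = [] then [] else [Judg (butlast \<Gamma>) (IsType (snd (last \<Gamma>)))])"
| "boundary (Judg \<Gamma> (HasType t T)) = [Judg \<Gamma> (IsType T)]"
| "boundary (Judg \<Gamma> (TypeEq T T')) = [Judg \<Gamma> (IsType T), Judg \<Gamma> (IsType T')]"
| "boundary (Judg \<Gamma> (TermEq t t' T)) = [Judg \<Gamma> (HasType t T), Judg \<Gamma> (HasType t' T)]"


section \<open>Deduction rules\<close>

text \<open>A value of type \<open>rule\<close> is a rule together with its parameters (a permutation of the variables,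
  or the variable \<open>y\<close>); \<open>infers r\<close> is the graph of the partial function of the
  premises that it defines.\<close>

datatype rule =
  TmRefl | TmSym | TmTrans | TyRefl | TySym | TyTrans | TmConv | TmEqConv
| Perm "nat \<Rightarrow> nat"
| Weaken nat
| Project nat
| Subst nat | SubstTyEq nat | SubstTmEq nat

inductive infers :: "rule \<Rightarrow> 'c judgement list \<Rightarrow> 'c judgement \<Rightarrow> bool" where
  tm_refl: "infers TmRefl [Judg \<Gamma> (HasType t T)] (Judg \<Gamma> (TermEq t t T))"
| tm_sym: "infers TmSym [Judg \<Gamma> (TermEq t1 t2 T)] (Judg \<Gamma> (TermEq t2 t1 T))"
| tm_trans: "infers TmTrans [Judg \<Gamma> (TermEq t1 t2 T), Judg \<Gamma> (TermEq t2 t3 T)] (Judg \<Gamma> (TermEq t1 t3 T))"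
| ty_refl: "infers TyRefl [Judg \<Gamma> (IsType T)] (Judg \<Gamma> (TypeEq T T))"
| ty_sym: "infers TySym [Judg \<Gamma> (TypeEq T1 T2)] (Judg \<Gamma> (TypeEq T2 T1))"
| ty_trans: "infers TyTrans [Judg \<Gamma> (TypeEq T1 T2), Judg \<Gamma> (TypeEq T2 T3)] (Judg \<Gamma> (TypeEq T1 T3))"
| tm_conv: "infers TmConv [Judg \<Gamma> (TypeEq T1 T2), Judg \<Gamma> (HasType t T1)] (Judg \<Gamma> (HasType t T2))"
| tmeq_conv: "infers TmEqConv [Judg \<Gamma> (TypeEq T1 T2), Judg \<Gamma> (TermEq t1 t2 T1)] (Judg \<Gamma> (TermEq t1 t2 T2))"
| perm: "bij \<sigma> \<Longrightarrow> infers (Perm \<sigma>) [J] (perm_judgement \<sigma> J)"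
| weaken: "y \<notin> ctx_vars \<Gamma> \<union> ctx_vars \<Delta> \<Longrightarrow>
    infers (Weaken y) [Judg \<Gamma> (IsType T), Judg (\<Gamma> @ \<Delta>) R] (Judg (\<Gamma> @ (y, T) # \<Delta>) R)"
| project: "y \<notin> ctx_vars \<Gamma> \<Longrightarrow>
    infers (Project y) [Judg \<Gamma> (IsType T)] (Judg (\<Gamma> @ [(y, T)]) (HasType (V y) T))"
| subst: "infers (Subst y) [Judg \<Gamma> (HasType t T), Judg (\<Gamma> @ (y, T) # \<Delta>) R]
    (Judg (\<Gamma> @ map_ctx (sub1 t y) \<Delta>) (map_rhs_expr (sub1 t y) R))"
| subst_tyeq: "infers (SubstTyEq y) [Judg \<Gamma> (TermEq t1 t2 T), Judg (\<Gamma> @ (y, T) # \<Delta>) (IsType T')]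
    (Judg (\<Gamma> @ map_ctx (sub1 t2 y) \<Delta>) (TypeEq (sub1 t1 y T') (sub1 t2 y T')))"
| subst_tmeq: "infers (SubstTmEq y) [Judg \<Gamma> (TermEq t1 t2 T), Judg (\<Gamma> @ (y, T) # \<Delta>) (HasType t' T')]
    (Judg (\<Gamma> @ map_ctx (sub1 t2 y) \<Delta>) (TermEq (sub1 t1 y t') (sub1 t2 y t') (sub1 t2 y T')))"

text \<open>The optional structural rules \<open>w\<close>, \<open>p\<close> and \<open>s\<close>.\<close>

datatype structural = Wk | Pr | Sb

fun available :: "structural set \<Rightarrow> rule \<Rightarrow> bool" where
  "available D (Weaken y) \<longleftrightarrow> Wk \<in> D"
| "available D (Project y) \<longleftrightarrow> Pr \<in> D"
| "available D (Subst y) \<longleftrightarrow> Sb \<in> D"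
| "available D (SubstTyEq y) \<longleftrightarrow> Sb \<in> D"
| "available D (SubstTmEq y) \<longleftrightarrow> Sb \<in> D"
| "available D r \<longleftrightarrow> True"


section \<open>D-GATs and interpretations\<close>

text \<open>The alphabet is the disjoint union of type- and term-constants, as a sum type.\<close>

record ('o, 's) gat =
  type_consts :: "'o set"
  term_consts :: "'s set"
  basic :: "('o + 's) judgement set"

inductive derived :: "structural set \<Rightarrow> ('o, 's) gat \<Rightarrow> ('o + 's) judgement \<Rightarrow> bool"
  for D :: "structural set" and \<T> :: "('o, 's) gat" where
  by_rule: "\<lbrakk>available D r; infers r Js J; \<forall>J' \<in> set Js. derived D \<T> J'\<rbrakk> \<Longrightarrow> derived D \<T> J"
| by_basic: "\<lbrakk>J \<in> basic \<T>; \<forall>J' \<in> set (boundary J). derived D \<T> J'\<rbrakk> \<Longrightarrow> derived D \<T> J"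

definition introduces_type :: "'o \<Rightarrow> ('o + 's) judgement \<Rightarrow> bool" where
  "introduces_type A J \<longleftrightarrow> rhs_of J = IsType (App (Inl A) (map (V \<circ> fst) (ctx_of J)))"

definition introduces_term :: "'s \<Rightarrow> ('o + 's) judgement \<Rightarrow> bool" where
  "introduces_term f J \<longleftrightarrow> (\<exists>T. rhs_of J = HasType (App (Inr f) (map (V \<circ> fst) (ctx_of J))) T)"

definition is_gat :: "structural set \<Rightarrow> ('o, 's) gat \<Rightarrow> bool" where
  "is_gat D \<T> \<longleftrightarrow>
     (Pr \<in> D \<longrightarrow> Wk \<in> D) \<and>
     (\<forall>J \<in> basic \<T>. judgement_over (type_consts \<T> <+> term_consts \<T>) J) \<and>
     (\<forall>A \<in> type_consts \<T>. \<exists>!J. J \<in> basic \<T> \<and> introduces_type A J) \<and>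
     (\<forall>f \<in> term_consts \<T>. \<exists>!J. J \<in> basic \<T> \<and> introduces_term f J) \<and>
     (\<forall>J \<in> basic \<T>. (\<exists>A \<in> type_consts \<T>. introduces_type A J)
        \<or> (\<exists>f \<in> term_consts \<T>. introduces_term f J) \<or> is_equality_judgement J) \<and>
     (\<forall>J \<in> basic \<T>. derived D \<T> J)"

text \<open>Preservation of deduction is only demanded when both sides are defined.\<close>

definition interpretation_of ::
  "structural set \<Rightarrow> ('o, 's) gat \<Rightarrow> ('p, 'q) gat \<Rightarrow> (('o + 's) judgement \<Rightarrow> ('p + 'q) judgement) \<Rightarrow> bool" where
  "interpretation_of D \<T> \<U> \<phi> \<longleftrightarrow> is_gat D \<T> \<and> is_gat D \<U> \<and>
     (\<forall>J. derived D \<T> J \<longrightarrow> derived D \<U> (\<phi> J)) \<and>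
     (\<forall>J. derived D \<T> J \<longrightarrow> boundary (\<phi> J) = map \<phi> (boundary J)) \<and>
     (\<forall>r Js J J'. available D r \<longrightarrow> (\<forall>I \<in> set Js. derived D \<T> I) \<longrightarrow>
        infers r Js J \<longrightarrow> infers r (map \<phi> Js) J' \<longrightarrow> \<phi> J = J')"

text \<open>\<open>rename_to xs ys\<close> is the substitution of each variable in the list \<open>xs\<close> for the corresponding one in \<open>ys\<close>.\<close>

definition rename_to :: "nat list \<Rightarrow> nat list \<Rightarrow> 'c expr \<Rightarrow> 'c expr" where
  "rename_to xs ys = ren (\<lambda>v. case map_of (zip ys xs) v of None \<Rightarrow> v | Some x \<Rightarrow> x)"

text \<open>For a type judgement, \<open>types_of\<close> lists \<open>S\<^sub>1, \<dots>, S\<^sub>n\<close>.\<close>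

definition types_of :: "'c ctx \<Rightarrow> 'c expr \<Rightarrow> 'c expr list" where
  "types_of \<Gamma> S = map snd \<Gamma> @ [S]"

definition type_equiv :: "structural set \<Rightarrow> ('o, 's) gat \<Rightarrow> ('o + 's) ctx \<Rightarrow> ('o + 's) expr
    \<Rightarrow> ('o + 's) ctx \<Rightarrow> ('o + 's) expr \<Rightarrow> bool" where
  "type_equiv D \<T> \<Gamma> S \<Delta> T \<longleftrightarrow> length \<Gamma> = length \<Delta> \<and>
     (\<forall>i \<le> length \<Gamma>. derived D \<T> (Judg (take i \<Gamma>) (TypeEq (types_of \<Gamma> S ! i)
        (rename_to (take i (map fst \<Gamma>)) (take i (map fst \<Delta>)) (types_of \<Delta> T ! i)))))"

definition term_equiv :: "structural set \<Rightarrow> ('o, 's) gat \<Rightarrow> ('o + 's) ctx \<Rightarrow> ('o + 's) expr \<Rightarrow> ('o + 's) expr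
    \<Rightarrow> ('o + 's) ctx \<Rightarrow> ('o + 's) expr \<Rightarrow> ('o + 's) expr \<Rightarrow> bool" where
  "term_equiv D \<T> \<Gamma> s S \<Delta> t T \<longleftrightarrow> type_equiv D \<T> \<Gamma> S \<Delta> T \<and>
     derived D \<T> (Judg \<Gamma> (TermEq s (rename_to (map fst \<Gamma>) (map fst \<Delta>) t) S))"

definition jequiv :: "structural set \<Rightarrow> ('o, 's) gat \<Rightarrow> ('o + 's) judgement rel" where
  "jequiv D \<T> = {(J, J'). derived D \<T> J \<and> derived D \<T> J' \<and>
     (case (J, J') of
        (Judg \<Gamma> (IsType S), Judg \<Delta> (IsType T)) \<Rightarrow> type_equiv D \<T> \<Gamma> S \<Delta> T
      | (Judg \<Gamma> (HasType s S), Judg \<Delta> (HasType t T)) \<Rightarrow> term_equiv D \<T> \<Gamma> s S \<Delta> t T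
      | _ \<Rightarrow> False)}"

definition cls :: "structural set \<Rightarrow> ('o, 's) gat \<Rightarrow> ('o + 's) judgement \<Rightarrow> ('o + 's) judgement set" where
  "cls D \<T> J = jequiv D \<T> `` {J}"

definition rep :: "'c judgement set \<Rightarrow> 'c judgement" where
  "rep c = (SOME J. J \<in> c)"


section \<open>Type-and-term structures\<close>

text \<open>\<open>Ob n\<close> and \<open>ObT n\<close> are the objects \<open>n\<close> and \<open>n\<^sub>t\<close> of the category \<open>\<H>\<close>; only those with \<open>n \<ge> 1\<close> count.
  Every object apart from \<open>Ob 1\<close> is the target of exactly one generating arrow, with source \<open>below\<close>. As \<open>\<H>\<close> is
  free on these, a presheaf is given by its sets and one boundary map \<open>X(ob) \<rightarrow> X(below ob)\<close> per
  object \<open>ob\<close>, and a natural transformation is a family of functions commuting with these.\<close>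

datatype hobj = Ob nat | ObT nat

fun below :: "hobj \<Rightarrow> hobj" where
  "below (Ob n) = Ob (n - 1)"
| "below (ObT n) = Ob n"

record 'a presheaf =
  el :: "hobj \<Rightarrow> 'a set"
  bd :: "hobj \<Rightarrow> 'a \<Rightarrow> 'a"

definition is_presheaf :: "'a presheaf \<Rightarrow> bool" where
  "is_presheaf X \<longleftrightarrow> (\<forall>n \<ge> 1.
     bd X (Ob (Suc n)) \<in> el X (Ob (Suc n)) \<rightarrow> el X (Ob n) \<and>
     bd X (ObT n) \<in> el X (ObT n) \<rightarrow> el X (Ob n))"

text \<open>\<open>bd_iter X i k A = \<partial>\<^sup>k A\<close> for \<open>A \<in> X(i + k)\<close>.\<close>

primrec bd_iter :: "'a presheaf \<Rightarrow> nat \<Rightarrow> nat \<Rightarrow> 'a \<Rightarrow> 'a" where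
  "bd_iter X i 0 A = A"
| "bd_iter X i (Suc k) A = bd_iter X i k (bd X (Ob (i + Suc k)) A)"

definition Tm :: "'a presheaf \<Rightarrow> nat \<Rightarrow> 'a \<Rightarrow> 'a set" where
  "Tm X n A = {a \<in> el X (ObT n). bd X (ObT n) a = A}"


section \<open>The adjunction and its monads\<close>

definition V_obj :: "structural set \<Rightarrow> ('o, 's) gat \<Rightarrow> ('o + 's) judgement set presheaf" where
  "V_obj D \<T> = \<lparr>
     el = (\<lambda>ob. case ob of
        Ob n \<Rightarrow> {J. derived D \<T> J \<and> is_type_judgement J \<and> degree J = n} // jequiv D \<T>
      | ObT n \<Rightarrow> {J. derived D \<T> J \<and> is_term_judgement J \<and> degree J = n} // jequiv D \<T>),
     bd = (\<lambda>ob c. cls D \<T> (hd (boundary (rep c))))\<rparr>"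

definition V_map :: "structural set \<Rightarrow> ('p, 'q) gat \<Rightarrow> (('o + 's) judgement \<Rightarrow> ('p + 'q) judgement)
    \<Rightarrow> hobj \<Rightarrow> ('o + 's) judgement set \<Rightarrow> ('p + 'q) judgement set" where
  "V_map D \<U> \<phi> ob c = cls D \<U> (\<phi> (rep c))"

text \<open>The constants of the free GAT are elements of \<open>X\<close> tagged with their degree, as the sets \<open>X(n)\<close> may overlap.
  The context variable \<open>x\<^sub>i\<close> is \<open>V i\<close>.\<close>

type_synonym 'a fsym = "(nat \<times> 'a) + (nat \<times> 'a)"

definition gen_vars :: "nat \<Rightarrow> 'c expr list" where
  "gen_vars n = map V [1..<n]"

definition gen_type :: "nat \<Rightarrow> 'a \<Rightarrow> 'a fsym expr" where
  "gen_type n A = App (Inl (n, A)) (gen_vars n)"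

definition gen_ctx :: "'a presheaf \<Rightarrow> nat \<Rightarrow> 'a \<Rightarrow> 'a fsym ctx" where
  "gen_ctx X n A = map (\<lambda>i. (i, gen_type i (bd_iter X i (n - i) A))) [1..<n]"

fun gen_judgement :: "'a presheaf \<Rightarrow> hobj \<Rightarrow> 'a \<Rightarrow> 'a fsym judgement" where
  "gen_judgement X (Ob n) A = Judg (gen_ctx X n A) (IsType (gen_type n A))"
| "gen_judgement X (ObT n) a = Judg (gen_ctx X n (bd X (ObT n) a))
     (HasType (App (Inr (n, a)) (gen_vars n)) (gen_type n (bd X (ObT n) a)))"

definition G_obj :: "'a presheaf \<Rightarrow> (nat \<times> 'a, nat \<times> 'a) gat" where
  "G_obj X = \<lparr>
     type_consts = {(n, A). n \<ge> 1 \<and> A \<in> el X (Ob n)},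
     term_consts = {(n, a). n \<ge> 1 \<and> a \<in> el X (ObT n)},
     basic = {gen_judgement X ob A | ob A. ob \<in> Ob ` {1..} \<union> ObT ` {1..} \<and> A \<in> el X ob}\<rparr>"

text \<open>The interpretation \<open>G\<^sub>D X \<rightarrow> \<U>\<close> corresponding under the adjunction to \<open>g : X \<rightarrow> V\<^sub>D \<U>\<close>. It is determined
  up to the equivalence of interpretations, which \<^const>\<open>V_map\<close> does not see.\<close>

definition transpose_of :: "structural set \<Rightarrow> 'a presheaf \<Rightarrow> ('p, 'q) gat
    \<Rightarrow> (hobj \<Rightarrow> 'a \<Rightarrow> ('p + 'q) judgement set) \<Rightarrow> 'a fsym judgement \<Rightarrow> ('p + 'q) judgement" where
  "transpose_of D X \<U> g = (SOME \<phi>. interpretation_of D (G_obj X) \<U> \<phi> \<and>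
     (\<forall>ob \<in> Ob ` {1..} \<union> ObT ` {1..}. \<forall>A \<in> el X ob. cls D \<U> (\<phi> (gen_judgement X ob A)) = g ob A))"

type_synonym 'a M = "'a fsym judgement set"

definition M_obj :: "structural set \<Rightarrow> 'a presheaf \<Rightarrow> 'a M presheaf" where
  "M_obj D X = V_obj D (G_obj X)"

definition M_unit :: "structural set \<Rightarrow> 'a presheaf \<Rightarrow> hobj \<Rightarrow> 'a \<Rightarrow> 'a M" where
  "M_unit D X ob A = cls D (G_obj X) (gen_judgement X ob A)"

text \<open>The functorial action on \<open>f : X \<rightarrow> Y\<close>: \<open>G\<^sub>D f\<close> is the transpose of \<open>\<eta>\<^sub>Y \<circ> f\<close>.\<close>

definition M_map :: "structural set \<Rightarrow> 'a presheaf \<Rightarrow> 'b presheaf \<Rightarrow> (hobj \<Rightarrow> 'a \<Rightarrow> 'b)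
    \<Rightarrow> hobj \<Rightarrow> 'a M \<Rightarrow> 'b M" where
  "M_map D X Y f = V_map D (G_obj Y) (transpose_of D X (G_obj Y) (\<lambda>ob A. M_unit D Y ob (f ob A)))"

definition counit :: "structural set \<Rightarrow> ('o, 's) gat
    \<Rightarrow> ('o + 's) judgement set fsym judgement \<Rightarrow> ('o + 's) judgement" where
  "counit D \<T> = transpose_of D (V_obj D \<T>) \<T> (\<lambda>ob c. c)"

definition M_mult :: "structural set \<Rightarrow> 'a presheaf \<Rightarrow> hobj \<Rightarrow> 'a M M \<Rightarrow> 'a M" where
  "M_mult D X = V_map D (G_obj X) (counit D (G_obj X))"

abbreviation DP :: "structural set" where "DP \<equiv> {Wk, Pr}"
abbreviation DS :: "structural set" where "DS \<equiv> {Sb}"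
abbreviation DT :: "structural set" where "DT \<equiv> {Wk, Pr, Sb}"

abbreviation P_obj :: "'a presheaf \<Rightarrow> 'a M presheaf" where "P_obj \<equiv> M_obj DP"
abbreviation S_obj :: "'a presheaf \<Rightarrow> 'a M presheaf" where "S_obj \<equiv> M_obj DS"
abbreviation T_obj :: "'a presheaf \<Rightarrow> 'a M presheaf" where "T_obj \<equiv> M_obj DT"


section \<open>The distributive law\<close>

text \<open>The common form of \<open>\<rho>\<close> and \<open>\<sigma>\<close>: send the class of a judgement to the class in \<open>TX\<close> of that same judgement.\<close>

definition to_T :: "'a presheaf \<Rightarrow> hobj \<Rightarrow> 'a M \<Rightarrow> 'a M" where
  "to_T X ob c = cls DT (G_obj X) (rep c)"

definition kappa :: "'a presheaf \<Rightarrow> hobj \<Rightarrow> 'a M M \<Rightarrow> 'a M" where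
  "kappa X ob = M_mult DT X ob \<circ> to_T (T_obj X) ob \<circ> M_map DP (S_obj X) (T_obj X) (to_T X) ob"

text \<open>The transported multiplication is \<open>\<kappa>\<inverse> \<circ> \<mu>\<^sup>T \<circ> (\<kappa> * \<kappa>)\<close>, with horizontal composite
  \<open>\<kappa> * \<kappa> = \<kappa>T \<circ> PS\<kappa>\<close>.\<close>

definition PS_mult :: "'a presheaf \<Rightarrow> hobj \<Rightarrow> 'a M M M M \<Rightarrow> 'a M M" where
  "PS_mult X ob =
     the_inv_into (el (P_obj (S_obj X)) ob) (kappa X ob) \<circ> M_mult DT X ob \<circ> kappa (T_obj X) ob \<circ>
     M_map DP (S_obj (P_obj (S_obj X))) (S_obj (T_obj X))
       (M_map DS (P_obj (S_obj X)) (T_obj X) (kappa X)) ob"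

definition dist_law :: "'a presheaf \<Rightarrow> hobj \<Rightarrow> 'a M M \<Rightarrow> 'a M M" where
  "dist_law X ob =
     PS_mult X ob \<circ> M_unit DP (S_obj (P_obj (S_obj X))) ob \<circ>
     M_map DS (P_obj X) (P_obj (S_obj X)) (M_map DP X (S_obj X) (M_unit DS X)) ob"


section \<open>Explicit description of P\<close>

text \<open>Functions with a bounded domain are extensional, so that the sets below consist of genuine
  functions on that domain and equality is equality on it.\<close>

definition Hp :: "nat \<Rightarrow> (nat \<Rightarrow> nat) set" where
  "Hp n = {\<phi> \<in> {..n} \<rightarrow>\<^sub>E {..n}. \<phi> 0 = 0 \<and> (\<forall>i \<in> {1..n}. \<phi> i < i)}"

definition dp :: "(nat \<Rightarrow> nat) \<Rightarrow> nat \<Rightarrow> nat" where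
  "dp \<phi> i = card {(\<phi> ^^ k) i | k. k \<ge> 1}"

definition heap_le :: "(nat \<Rightarrow> nat) \<Rightarrow> nat \<Rightarrow> nat \<Rightarrow> bool" where
  "heap_le \<phi> i j \<longleftrightarrow> (\<exists>k. i = (\<phi> ^^ k) j)"

text \<open>\<open>chain \<phi> j l\<close> is the \<open>l\<close>-th element (\<open>1 \<le> l \<le> dp \<phi> j\<close>) of the down-set of \<open>j\<close>
  in its linear order; the last one is \<open>j\<close>.\<close>

definition chain :: "(nat \<Rightarrow> nat) \<Rightarrow> nat \<Rightarrow> nat \<Rightarrow> nat" where
  "chain \<phi> j l = (\<phi> ^^ (dp \<phi> j - l)) j"

definition P_ty :: "'a presheaf \<Rightarrow> nat \<Rightarrow> ((nat \<Rightarrow> nat) \<times> (nat \<Rightarrow> 'a)) set" where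
  "P_ty X n = {(\<phi>, h). \<phi> \<in> Hp n \<and> h \<in> (\<Pi>\<^sub>E i \<in> {1..n}. el X (Ob (dp \<phi> i))) \<and>
     (\<forall>i \<in> {1..n}. \<phi> i > 0 \<longrightarrow> bd X (Ob (dp \<phi> i)) (h i) = h (\<phi> i))}"

datatype 'a pterm = Elem (elem_of: 'a) | Proj nat

definition P_tm :: "'a presheaf \<Rightarrow> nat \<Rightarrow> (nat \<Rightarrow> nat) \<times> (nat \<Rightarrow> 'a) \<Rightarrow> 'a pterm set" where
  "P_tm X n = (\<lambda>(\<phi>, h). Elem ` Tm X (dp \<phi> n) (h n) \<union>
     Proj ` {i \<in> {1..n - 1}. \<phi> n = \<phi> i \<and> h n = h i})"

text \<open>The elements of \<open>PX\<close> with which these data are identified.\<close>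

definition P_args :: "(nat \<Rightarrow> nat) \<Rightarrow> nat \<Rightarrow> 'c expr list" where
  "P_args \<phi> i = map (\<lambda>l. V (chain \<phi> i l)) [1..<dp \<phi> i]"

definition P_type :: "(nat \<Rightarrow> nat) \<Rightarrow> (nat \<Rightarrow> 'a) \<Rightarrow> nat \<Rightarrow> 'a fsym expr" where
  "P_type \<phi> h i = App (Inl (dp \<phi> i, h i)) (P_args \<phi> i)"

definition P_ctx :: "nat \<Rightarrow> (nat \<Rightarrow> nat) \<Rightarrow> (nat \<Rightarrow> 'a) \<Rightarrow> 'a fsym ctx" where
  "P_ctx n \<phi> h = map (\<lambda>i. (i, P_type \<phi> h i)) [1..<n]"

definition P_ty_class :: "'a presheaf \<Rightarrow> nat \<Rightarrow> (nat \<Rightarrow> nat) \<times> (nat \<Rightarrow> 'a) \<Rightarrow> 'a M" where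
  "P_ty_class X n = (\<lambda>(\<phi>, h). cls DP (G_obj X) (Judg (P_ctx n \<phi> h) (IsType (P_type \<phi> h n))))"

definition P_tm_class :: "'a presheaf \<Rightarrow> nat \<Rightarrow> (nat \<Rightarrow> nat) \<times> (nat \<Rightarrow> 'a) \<Rightarrow> 'a pterm \<Rightarrow> 'a M" where
  "P_tm_class X n = (\<lambda>(\<phi>, h) a. cls DP (G_obj X) (Judg (P_ctx n \<phi> h)
     (HasType (case a of Elem b \<Rightarrow> App (Inr (dp \<phi> n, b)) (P_args \<phi> n) | Proj i \<Rightarrow> V i) (P_type \<phi> h n))))"


section \<open>Explicit description of S\<close>

definition Inc :: "nat \<Rightarrow> (nat \<Rightarrow> nat) set" where
  "Inc n = {\<alpha> \<in> extensional {..n}. strict_mono_on {..n} \<alpha> \<and> \<alpha> 0 = 0}"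

text \<open>The elements of the presheaf \<open>[\<alpha>]\<close>: it has at most one over each object, which we identify with that object.\<close>

definition cells :: "nat \<Rightarrow> (nat \<Rightarrow> nat) \<Rightarrow> hobj set" where
  "cells n \<alpha> = Ob ` {1..\<alpha> n} \<union> ObT ` ({1..\<alpha> n} - \<alpha> ` {..n})"

definition S_ty :: "'a presheaf \<Rightarrow> nat \<Rightarrow> ((nat \<Rightarrow> nat) \<times> (hobj \<Rightarrow> 'a)) set" where
  "S_ty X n = {(\<alpha>, h). \<alpha> \<in> Inc n \<and> h \<in> (\<Pi>\<^sub>E ob \<in> cells n \<alpha>. el X ob) \<and>
     (\<forall>ob \<in> cells n \<alpha>. ob \<noteq> Ob 1 \<longrightarrow> bd X ob (h ob) = h (below ob))}"

definition S_tm :: "'a presheaf \<Rightarrow> nat \<Rightarrow> (nat \<Rightarrow> nat) \<times> (hobj \<Rightarrow> 'a) \<Rightarrow> 'a set" where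
  "S_tm X n = (\<lambda>(\<alpha>, h). Tm X (\<alpha> n) (h (Ob (\<alpha> n))))"

definition S_bd :: "nat \<Rightarrow> (nat \<Rightarrow> nat) \<times> (hobj \<Rightarrow> 'a) \<Rightarrow> (nat \<Rightarrow> nat) \<times> (hobj \<Rightarrow> 'a)" where
  "S_bd n = (\<lambda>(\<alpha>, h). (restrict \<alpha> {..n - 1}, restrict h (cells (n - 1) \<alpha>)))"

text \<open>The elements of \<open>SX\<close> with which these data are identified; \<open>S_arg n \<alpha> h j\<close> is \<open>e\<^sub>j\<close>.\<close>

function S_arg :: "nat \<Rightarrow> (nat \<Rightarrow> nat) \<Rightarrow> (hobj \<Rightarrow> 'a) \<Rightarrow> nat \<Rightarrow> 'a fsym expr" where
  "S_arg n \<alpha> h j = (if j \<in> \<alpha> ` {..n} then V (inv_into {..n} \<alpha> j)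
     else App (Inr (j, h (ObT j))) (map (S_arg n \<alpha> h) [1..<j]))"
  by pat_completeness auto
termination
  by (relation "measure (\<lambda>(n, \<alpha>, h, j). j)") auto

declare S_arg.simps [simp del]

definition S_args :: "nat \<Rightarrow> (nat \<Rightarrow> nat) \<Rightarrow> (hobj \<Rightarrow> 'a) \<Rightarrow> nat \<Rightarrow> 'a fsym expr list" where
  "S_args n \<alpha> h i = map (S_arg n \<alpha> h) [1..<\<alpha> i]"

definition S_type :: "nat \<Rightarrow> (nat \<Rightarrow> nat) \<Rightarrow> (hobj \<Rightarrow> 'a) \<Rightarrow> nat \<Rightarrow> 'a fsym expr" where
  "S_type n \<alpha> h i = App (Inl (\<alpha> i, h (Ob (\<alpha> i)))) (S_args n \<alpha> h i)"

definition S_ctx :: "nat \<Rightarrow> (nat \<Rightarrow> nat) \<Rightarrow> (hobj \<Rightarrow> 'a) \<Rightarrow> 'a fsym ctx" where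
  "S_ctx n \<alpha> h = map (\<lambda>i. (i, S_type n \<alpha> h i)) [1..<n]"

definition S_ty_class :: "'a presheaf \<Rightarrow> nat \<Rightarrow> (nat \<Rightarrow> nat) \<times> (hobj \<Rightarrow> 'a) \<Rightarrow> 'a M" where
  "S_ty_class X n = (\<lambda>(\<alpha>, h). cls DS (G_obj X) (Judg (S_ctx n \<alpha> h) (IsType (S_type n \<alpha> h n))))"

definition S_tm_class :: "'a presheaf \<Rightarrow> nat \<Rightarrow> (nat \<Rightarrow> nat) \<times> (hobj \<Rightarrow> 'a) \<Rightarrow> 'a \<Rightarrow> 'a M" where
  "S_tm_class X n = (\<lambda>(\<alpha>, h) a. cls DS (G_obj X) (Judg (S_ctx n \<alpha> h)
     (HasType (App (Inr (\<alpha> n, a)) (S_args n \<alpha> h n)) (S_type n \<alpha> h n))))"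


section \<open>Elements of PSX and SPX\<close>

text \<open>In \<open>(\<phi>, s) \<in> PS_ty X n\<close>, \<open>s i\<close> is the pair \<open>(\<alpha>\<^sub>i, h\<^sub>i)\<close>.\<close>

definition PS_ty :: "'a presheaf \<Rightarrow> nat
    \<Rightarrow> ((nat \<Rightarrow> nat) \<times> (nat \<Rightarrow> (nat \<Rightarrow> nat) \<times> (hobj \<Rightarrow> 'a))) set" where
  "PS_ty X n = {(\<phi>, s). \<phi> \<in> Hp n \<and> s \<in> (\<Pi>\<^sub>E i \<in> {1..n}. S_ty X (dp \<phi> i)) \<and>
     (\<forall>i \<in> {1..n}. \<phi> i > 0 \<longrightarrow> S_bd (dp \<phi> i) (s i) = s (\<phi> i))}"

definition PS_tm :: "'a presheaf \<Rightarrow> nat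
    \<Rightarrow> (nat \<Rightarrow> nat) \<times> (nat \<Rightarrow> (nat \<Rightarrow> nat) \<times> (hobj \<Rightarrow> 'a)) \<Rightarrow> 'a pterm set" where
  "PS_tm X n = (\<lambda>(\<phi>, s). Elem ` S_tm X (dp \<phi> n) (s n) \<union>
     Proj ` {i \<in> {1..n - 1}. \<phi> n = \<phi> i \<and> s n = s i})"

definition PS_classes :: "'a presheaf \<Rightarrow> nat \<Rightarrow> (nat \<Rightarrow> nat) \<times> (nat \<Rightarrow> (nat \<Rightarrow> nat) \<times> (hobj \<Rightarrow> 'a))
    \<Rightarrow> (nat \<Rightarrow> nat) \<times> (nat \<Rightarrow> 'a M)" where
  "PS_classes X n = (\<lambda>(\<phi>, s). (\<phi>, \<lambda>i \<in> {1..n}. S_ty_class X (dp \<phi> i) (s i)))"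

definition PS_ty_class :: "'a presheaf \<Rightarrow> nat
    \<Rightarrow> (nat \<Rightarrow> nat) \<times> (nat \<Rightarrow> (nat \<Rightarrow> nat) \<times> (hobj \<Rightarrow> 'a)) \<Rightarrow> 'a M M" where
  "PS_ty_class X n z = P_ty_class (S_obj X) n (PS_classes X n z)"

definition PS_tm_class :: "'a presheaf \<Rightarrow> nat
    \<Rightarrow> (nat \<Rightarrow> nat) \<times> (nat \<Rightarrow> (nat \<Rightarrow> nat) \<times> (hobj \<Rightarrow> 'a)) \<Rightarrow> 'a pterm \<Rightarrow> 'a M M" where
  "PS_tm_class X n z a = P_tm_class (S_obj X) n (PS_classes X n z)
     (case a of Elem b \<Rightarrow> Elem (S_tm_class X (dp (fst z) n) (snd z n) b) | Proj i \<Rightarrow> Proj i)"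

definition P_restrict :: "nat \<Rightarrow> (nat \<Rightarrow> nat) \<times> (nat \<Rightarrow> 'a) \<Rightarrow> (nat \<Rightarrow> nat) \<times> (nat \<Rightarrow> 'a)" where
  "P_restrict i = (\<lambda>(\<phi>, h). (restrict \<phi> {..i}, restrict h {1..i}))"

definition SP_ty :: "'a presheaf \<Rightarrow> nat
    \<Rightarrow> ((nat \<Rightarrow> nat) \<times> (nat \<Rightarrow> nat) \<times> (nat \<Rightarrow> 'a) \<times> (nat \<Rightarrow> 'a pterm)) set" where
  "SP_ty X n = {(\<alpha>, \<phi>, h, k). \<alpha> \<in> Inc n \<and> (\<phi>, h) \<in> P_ty X (\<alpha> n) \<and>
     k \<in> (\<Pi>\<^sub>E i \<in> {1..\<alpha> n} - \<alpha> ` {..n}. P_tm X i (P_restrict i (\<phi>, h)))}"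

definition SP_tm :: "'a presheaf \<Rightarrow> nat
    \<Rightarrow> (nat \<Rightarrow> nat) \<times> (nat \<Rightarrow> nat) \<times> (nat \<Rightarrow> 'a) \<times> (nat \<Rightarrow> 'a pterm) \<Rightarrow> 'a pterm set" where
  "SP_tm X n = (\<lambda>(\<alpha>, \<phi>, h, k). P_tm X (\<alpha> n) (\<phi>, h))"

text \<open>The map \<open>[\<alpha>] \<rightarrow> PX\<close> determined by \<open>(\<phi>, h)\<close> and \<open>k\<close>.\<close>

definition SP_classes :: "'a presheaf \<Rightarrow> nat
    \<Rightarrow> (nat \<Rightarrow> nat) \<times> (nat \<Rightarrow> nat) \<times> (nat \<Rightarrow> 'a) \<times> (nat \<Rightarrow> 'a pterm)
    \<Rightarrow> (nat \<Rightarrow> nat) \<times> (hobj \<Rightarrow> 'a M)" where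
  "SP_classes X n = (\<lambda>(\<alpha>, \<phi>, h, k). (\<alpha>, \<lambda>ob \<in> cells n \<alpha>. case ob of
     Ob i \<Rightarrow> P_ty_class X i (P_restrict i (\<phi>, h))
   | ObT i \<Rightarrow> P_tm_class X i (P_restrict i (\<phi>, h)) (k i)))"

definition SP_ty_class :: "'a presheaf \<Rightarrow> nat
    \<Rightarrow> (nat \<Rightarrow> nat) \<times> (nat \<Rightarrow> nat) \<times> (nat \<Rightarrow> 'a) \<times> (nat \<Rightarrow> 'a pterm) \<Rightarrow> 'a M M" where
  "SP_ty_class X n z = S_ty_class (P_obj X) n (SP_classes X n z)"

definition SP_tm_class :: "'a presheaf \<Rightarrow> nat
    \<Rightarrow> (nat \<Rightarrow> nat) \<times> (nat \<Rightarrow> nat) \<times> (nat \<Rightarrow> 'a) \<times> (nat \<Rightarrow> 'a pterm) \<Rightarrow> 'a pterm \<Rightarrow> 'a M M" where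
  "SP_tm_class X n = (\<lambda>(\<alpha>, \<phi>, h, k) a. S_tm_class (P_obj X) n (SP_classes X n (\<alpha>, \<phi>, h, k))
     (P_tm_class X (\<alpha> n) (\<phi>, h) a))"


section \<open>The constructions\<close>

definition pull_heap :: "nat \<Rightarrow> (nat \<Rightarrow> nat) \<Rightarrow> (nat \<Rightarrow> nat) \<Rightarrow> nat \<Rightarrow> nat" where
  "pull_heap n \<alpha> \<phi> = (THE \<psi>. \<psi> \<in> Hp n \<and>
     (\<forall>i \<in> {1..n}. \<forall>j \<in> {1..n}. heap_le \<psi> i j \<longleftrightarrow> heap_le \<phi> (\<alpha> i) (\<alpha> j)))"

definition pull_inc :: "nat \<Rightarrow> (nat \<Rightarrow> nat) \<Rightarrow> (nat \<Rightarrow> nat) \<Rightarrow> nat \<Rightarrow> nat \<Rightarrow> nat" where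
  "pull_inc n \<alpha> \<phi> p = (\<lambda>i \<in> {..dp (pull_heap n \<alpha> \<phi>) p}.
     if i = 0 then 0 else dp \<phi> (\<alpha> (chain (pull_heap n \<alpha> \<phi>) p i)))"

text \<open>For a nearly projection-free element the values of \<open>k\<close> used here are never projections,
  so \<^const>\<open>elem_of\<close> only strips the constructor \<^const>\<open>Elem\<close>.\<close>

definition pull_map :: "nat \<Rightarrow> (nat \<Rightarrow> nat) \<Rightarrow> (nat \<Rightarrow> nat) \<Rightarrow> (nat \<Rightarrow> 'a) \<Rightarrow> (nat \<Rightarrow> 'a pterm)
    \<Rightarrow> nat \<Rightarrow> hobj \<Rightarrow> 'a" where
  "pull_map n \<alpha> \<phi> h k p =
     (\<lambda>ob \<in> cells (dp (pull_heap n \<alpha> \<phi>) p) (pull_inc n \<alpha> \<phi> p). case ob of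
        Ob i \<Rightarrow> h (chain \<phi> (\<alpha> p) i)
      | ObT i \<Rightarrow> elem_of (k (chain \<phi> (\<alpha> p) i)))"

definition to_PS :: "nat \<Rightarrow> (nat \<Rightarrow> nat) \<times> (nat \<Rightarrow> nat) \<times> (nat \<Rightarrow> 'a) \<times> (nat \<Rightarrow> 'a pterm)
    \<Rightarrow> (nat \<Rightarrow> nat) \<times> (nat \<Rightarrow> (nat \<Rightarrow> nat) \<times> (hobj \<Rightarrow> 'a))" where
  "to_PS n = (\<lambda>(\<alpha>, \<phi>, h, k). (pull_heap n \<alpha> \<phi>, \<lambda>p \<in> {1..n}. (pull_inc n \<alpha> \<phi> p, pull_map n \<alpha> \<phi> h k p)))"

text \<open>The partial order generated by the projections among the values of \<open>k\<close>.\<close>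

definition k_le :: "nat \<Rightarrow> (nat \<Rightarrow> nat) \<Rightarrow> (nat \<Rightarrow> 'a pterm) \<Rightarrow> nat \<Rightarrow> nat \<Rightarrow> bool" where
  "k_le n \<alpha> k = (\<lambda>i j. j \<in> {..\<alpha> n} - \<alpha> ` {..n} \<and> k j = Proj i)\<^sup>*\<^sup>*"

definition k_min :: "nat \<Rightarrow> (nat \<Rightarrow> nat) \<Rightarrow> (nat \<Rightarrow> 'a pterm) \<Rightarrow> nat \<Rightarrow> nat" where
  "k_min n \<alpha> k i = Min {j. k_le n \<alpha> k j i}"

definition bar_heap :: "nat \<Rightarrow> (nat \<Rightarrow> nat) \<Rightarrow> (nat \<Rightarrow> 'a pterm) \<Rightarrow> (nat \<Rightarrow> nat) \<Rightarrow> nat \<Rightarrow> nat" where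
  "bar_heap n \<alpha> k \<phi> = (\<lambda>i \<in> {..\<alpha> n}. k_min n \<alpha> k (\<phi> i))"

end

theory Submission
  imports Defs "HOL-Combinatorics.Transposition"
begin

text \<open>
  In a free GAT every derivable equality is an instance of reflexivity. Hence \<open>\<equiv>\<close> is renaming of variables
  (\<open>jequiv_free\<close>), and each class contains exactly one canonical judgement, that is, one with context variables
  \<open>1, \<dots>, n - 1\<close> (\<open>canonical_ex\<close>, \<open>canonical_unique\<close>). An interpretation commutes with all permutations of
  the variables, and therefore cannot rename the variables of a context; so the interpretation
  corresponding to a map \<open>g : X \<rightarrow> V\<^sub>D (G\<^sub>D Y)\<close> is forced: it replaces each constant by the body of the
  canonical judgement in its image under \<open>g\<close>, with the arguments substituted for the variables
  (\<open>interpretation_unique\<close>, \<open>V_map_transpose\<close>). In this way the monads become syntax. Their action on maps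
  relabels constants, a unit forms a generating judgement, and a multiplication expands constants that are
  themselves classes of judgements; \<open>flatten\<close> denotes this expansion.

  On classes, \<open>\<kappa>\<close> sends \<open>[J]\<close> to \<open>[flatten J]\<close>, and all units in the definition of the distributive law cancel,
  so that \<open>\<delta>[J]\<close> is the class which \<open>\<kappa>\<close> sends to \<open>[flatten J]\<close> (\<open>kappa_cls\<close>, \<open>dist_law_cls\<close>). Moreover \<open>\<kappa>\<close>
  is injective (\<open>kappa_inj\<close>). A type derivable with weakening and projection alone is a constant applied to a
  list of variables that increases along the context, whereas a type derivable with substitution alone
  mentions every variable of its context, and a term derivable in that way is not a variable. After the expansion of a
  judgement over \<open>SX\<close> one can thus read off the list of variables, then the body of the constant, and then the
  constant. It follows that \<open>\<delta>[J] = [J']\<close> as soon as \<open>flatten J' = flatten J\<close> (\<open>dist_law_eqI\<close>).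

  What remains is to expand the two judgements of the proposition. On the side of \<open>SPX\<close>, the argument in position
  \<open>j\<close> expands to an expression \<open>E j\<close>, where \<open>E j = E i\<close> if \<open>k j = \<pi>\<^sub>i\<close>. Hence \<open>E j = E m\<close> for the least
  \<open>m \<le>\<^sub>k j\<close>; this \<open>m\<close> has the same parent and the same value of \<open>h\<close> as \<open>j\<close>, which is why the ancestors in \<open>\<phi>\<close>
  can be replaced by those in the heap \<open>\<phi>\<close> with a bar (\<open>chain_\<beta>\<close>, \<open>E_chain\<close>), and no projections are left among
  the latter. The ancestors of \<open>\<alpha> p\<close> in the image of \<open>\<alpha>\<close> give variables and the others give substituted terms; the
  inc-list \<open>\<alpha>\<close> of index \<open>p\<close> in the proposition records exactly this division. So the expansion of the
  judgement for \<open>PSX\<close> is the same expression (\<open>pulled_S_arg\<close>, \<open>flatten_contexts\<close>, \<open>image_term_props\<close>).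
\<close>

section \<open>Substitution, renaming and contexts\<close>

lemma esubst_cong: "(\<And>x. x \<in> fv e \<Longrightarrow> \<theta> x = \<theta>' x) \<Longrightarrow> esubst \<theta> e = esubst \<theta>' e"
  by (induct e) auto

lemma esubst_esubst: "esubst \<theta> (esubst \<theta>' e) = esubst (\<lambda>x. esubst \<theta> (\<theta>' x)) e"
  by (induct e) auto

lemma esubst_V [simp]: "esubst V e = e"
  by (induct e) (auto intro: map_idI)

lemma esubst_id: "(\<And>x. x \<in> fv e \<Longrightarrow> \<theta> x = V x) \<Longrightarrow> esubst \<theta> e = e"
  using esubst_cong[of e \<theta> V] by simp

lemma fv_esubst: "fv (esubst \<theta> e) = (\<Union>x\<in>fv e. fv (\<theta> x))"
  by (induct e) auto

lemma fv_ren: "fv (ren \<sigma> e) = \<sigma> ` fv e"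
  by (auto simp: ren_def fv_esubst)

lemma fv_sub1: "fv (sub1 t y e) \<subseteq> (fv e - {y}) \<union> fv t"
  by (auto simp: sub1_def fv_esubst split: if_splits)

lemma fv_sub1_occurs: "y \<in> fv e \<Longrightarrow> fv (sub1 t y e) = (fv e - {y}) \<union> fv t"
  by (auto simp: sub1_def fv_esubst split: if_splits)

lemma ren_ren: "ren \<sigma> (ren \<tau> e) = ren (\<sigma> \<circ> \<tau>) e"
  by (simp add: ren_def esubst_esubst)

lemma ren_cong: "(\<And>x. x \<in> fv e \<Longrightarrow> \<sigma> x = \<tau> x) \<Longrightarrow> ren \<sigma> e = ren \<tau> e"
  unfolding ren_def by (rule esubst_cong) simp

lemma ren_id: "(\<And>x. x \<in> fv e \<Longrightarrow> \<sigma> x = x) \<Longrightarrow> ren \<sigma> e = e"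
  by (simp add: ren_def esubst_id)

lemma ren_inj_on:
  assumes "inj_on \<sigma> (fv e \<union> fv e')" "ren \<sigma> e = ren \<sigma> e'"
  shows "e = e'"
proof -
  define \<tau> where "\<tau> = inv_into (fv e \<union> fv e') \<sigma>"
  have "ren \<tau> (ren \<sigma> f) = f" if "fv f \<subseteq> fv e \<union> fv e'" for f
    unfolding ren_ren by (rule ren_id) (use that assms(1) in \<open>auto simp: \<tau>_def intro!: inv_into_f_f\<close>)
  then show ?thesis using assms(2) by (metis Un_upper1 Un_upper2)
qed

lemma map_fst_map_ctx [simp]: "map fst (map_ctx f \<Gamma>) = map fst \<Gamma>"
  by (auto simp: map_ctx_def)

lemma map_ctx_append [simp]: "map_ctx f (\<Gamma> @ \<Delta>) = map_ctx f \<Gamma> @ map_ctx f \<Delta>"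
  by (simp add: map_ctx_def)

lemma map_ctx_Nil [simp]: "map_ctx f [] = []" "map_ctx f ((y, T) # \<Delta>) = (y, f T) # map_ctx f \<Delta>"
  by (auto simp: map_ctx_def)

lemma rhs_exprs_map [simp]: "rhs_exprs (map_rhs_expr f R) = f ` rhs_exprs R"
  by (cases R) auto

text \<open>Unlike \<open>map_rhs_expr\<close>, this may change the alphabet, as expansions of constants
  do.\<close>

primrec rmap :: "('c expr \<Rightarrow> 'd expr) \<Rightarrow> 'c rhs \<Rightarrow> 'd rhs" where
  "rmap f (IsType T) = IsType (f T)"
| "rmap f (HasType t T) = HasType (f t) (f T)"
| "rmap f (TypeEq T T') = TypeEq (f T) (f T')"
| "rmap f (TermEq t t' T) = TermEq (f t) (f t') (f T)"

definition jmap :: "('c expr \<Rightarrow> 'd expr) \<Rightarrow> 'c judgement \<Rightarrow> 'd judgement" where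
  "jmap f J = Judg (map (\<lambda>(x, T). (x, f T)) (ctx_of J)) (rmap f (rhs_of J))"

lemma jmap_Judg: "jmap f (Judg \<Gamma> R) = Judg (map (\<lambda>(x, T). (x, f T)) \<Gamma>) (rmap f R)"
  by (simp add: jmap_def)

lemma jmap_simps [simp]:
  "jmap f (Judg \<Gamma> (IsType T)) = Judg (map (\<lambda>(x, T). (x, f T)) \<Gamma>) (IsType (f T))"
  "jmap f (Judg \<Gamma> (HasType t T)) = Judg (map (\<lambda>(x, T). (x, f T)) \<Gamma>) (HasType (f t) (f T))"
  "jmap f (Judg \<Gamma> (TypeEq T T')) = Judg (map (\<lambda>(x, T). (x, f T)) \<Gamma>) (TypeEq (f T) (f T'))"
  "jmap f (Judg \<Gamma> (TermEq t t' T)) = Judg (map (\<lambda>(x, T). (x, f T)) \<Gamma>) (TermEq (f t) (f t') (f T))"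
  by (auto simp: jmap_def)

definition jvars :: "'c judgement \<Rightarrow> nat set" where
  "jvars J = ctx_vars (ctx_of J) \<union> \<Union> (fv ` rhs_exprs (rhs_of J))"

definition exprs_of :: "'c judgement \<Rightarrow> 'c expr set" where
  "exprs_of J = snd ` set (ctx_of J) \<union> rhs_exprs (rhs_of J)"

lemma ctx_vars_append [simp]: "ctx_vars (\<Gamma> @ \<Delta>) = ctx_vars \<Gamma> \<union> ctx_vars \<Delta>"
  by (auto simp: ctx_vars_def)

lemma ctx_vars_Cons [simp]: "ctx_vars ((x, T) # \<Delta>) = insert x (fv T) \<union> ctx_vars \<Delta>" "ctx_vars [] = {}"
  by (auto simp: ctx_vars_def)

lemma dom_subset_ctx_vars: "fst ` set \<Gamma> \<subseteq> ctx_vars \<Gamma>"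
  by (auto simp: ctx_vars_def)

lemma in_exprs_of:
  "(x, T) \<in> set (ctx_of J) \<Longrightarrow> T \<in> exprs_of J"
  "e \<in> rhs_exprs (rhs_of J) \<Longrightarrow> e \<in> exprs_of J"
  by (force simp: exprs_of_def)+

lemma jmap_cong: "(\<And>e. e \<in> exprs_of J \<Longrightarrow> f e = g e) \<Longrightarrow> jmap f J = jmap g J"
  using in_exprs_of(1)[of _ _ J] in_exprs_of(2)[of _ J] by (cases "rhs_of J") (auto simp: jmap_def)

lemma jmap_jmap: "jmap f (jmap g J) = jmap (f \<circ> g) J"
  by (cases J; cases "rhs_of J") auto

lemma jmap_id: "(\<And>e. e \<in> exprs_of J \<Longrightarrow> f e = e) \<Longrightarrow> jmap f J = J"
  using in_exprs_of(1)[of _ _ J] in_exprs_of(2)[of _ J] by (cases J; cases "rhs_of J") (auto intro!: map_idI)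

lemma boundary_jmap: "boundary (jmap f J) = map (jmap f) (boundary J)"
proof (cases J)
  case (Judg \<Gamma> R)
  then show ?thesis by (cases R; cases \<Gamma> rule: rev_cases) auto
qed

section \<open>Permutations of the variables\<close>

lemma perm_judgement_simps [simp]:
  "perm_judgement \<sigma> (Judg \<Gamma> R) = Judg (map (\<lambda>(x, T). (\<sigma> x, ren \<sigma> T)) \<Gamma>) (map_rhs_expr (ren \<sigma>) R)"
  by (simp add: perm_judgement_def)

lemma perm_judgement_perm: "perm_judgement \<sigma> (perm_judgement \<tau> J) = perm_judgement (\<sigma> \<circ> \<tau>) J"
  by (cases J; cases "rhs_of J") (auto simp: ren_ren)

lemma perm_judgement_cong: "(\<And>x. x \<in> jvars J \<Longrightarrow> \<sigma> x = \<tau> x) \<Longrightarrow> perm_judgement \<sigma> J = perm_judgement \<tau> J"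
  by (cases J; cases "rhs_of J") (auto simp: jvars_def ctx_vars_def intro!: ren_cong)

lemma perm_judgement_id [simp]: "perm_judgement id J = J" "perm_judgement (\<lambda>x. x) J = J"
  by (cases J; cases "rhs_of J"; auto simp: ren_id intro!: map_idI)+

lemma perm_judgement_fixed: "(\<And>x. x \<in> jvars J \<Longrightarrow> \<sigma> x = x) \<Longrightarrow> perm_judgement \<sigma> J = J"
  using perm_judgement_cong[of J \<sigma> id] by simp

lemma boundary_perm: "boundary (perm_judgement \<sigma> J) = map (perm_judgement \<sigma>) (boundary J)"
proof (cases J)
  case (Judg \<Gamma> R)
  then show ?thesis by (cases R; cases \<Gamma> rule: rev_cases) auto
qed

lemma map_fst_perm: "map fst (ctx_of (perm_judgement \<sigma> J)) = map \<sigma> (map fst (ctx_of J))"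
  by (cases J) auto

lemma degree_perm [simp]: "degree (perm_judgement \<sigma> J) = degree J"
  by (simp add: degree_def perm_judgement_def)

lemma degree_jmap [simp]: "degree (jmap f J) = degree J"
  by (simp add: degree_def jmap_def)

lemma is_type_perm [simp]: "is_type_judgement (perm_judgement \<sigma> J) = is_type_judgement J"
  by (cases J; cases "rhs_of J") (auto simp: is_type_judgement_def)

lemma is_term_perm [simp]: "is_term_judgement (perm_judgement \<sigma> J) = is_term_judgement J"
  by (cases J; cases "rhs_of J") (auto simp: is_term_judgement_def)

lemma is_type_jmap [simp]: "is_type_judgement (jmap f J) = is_type_judgement J"
  by (cases J; cases "rhs_of J") (auto simp: is_type_judgement_def)

lemma is_term_jmap [simp]: "is_term_judgement (jmap f J) = is_term_judgement J"
  by (cases J; cases "rhs_of J") (auto simp: is_term_judgement_def)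

lemma permutation_between_lists:
  fixes xs ys :: "nat list"
  assumes "length xs = length ys" "distinct xs" "distinct ys"
  shows "\<exists>\<sigma>. bij \<sigma> \<and> map \<sigma> xs = ys"
  using assms
proof (induct xs ys rule: list_induct2)
  case Nil
  show ?case
  proof (intro exI conjI)
    show "bij (id :: nat \<Rightarrow> nat)" by (rule bij_id)
  qed simp
next
  case (Cons x xs y ys)
  then have "distinct xs" "distinct ys" by simp_all
  from Cons(2)[OF this] obtain \<sigma> where \<sigma>: "bij \<sigma>" "map \<sigma> xs = ys" by blast
  define \<tau> where "\<tau> = transpose (\<sigma> x) y \<circ> \<sigma>"
  have "\<tau> z = \<sigma> z" if "z \<in> set xs" for z
  proof -
    have "\<sigma> z \<noteq> \<sigma> x" using that Cons(3) by (auto simp: inj_eq[OF bij_is_inj[OF \<sigma>(1)]])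
    moreover have "\<sigma> z \<noteq> y" 
    proof
      assume "\<sigma> z = y"
      then have "y \<in> set (map \<sigma> xs)" using that by (auto intro: rev_image_eqI)
      then show False using \<sigma>(2) Cons(4) by simp
    qed
    ultimately show ?thesis unfolding \<tau>_def comp_apply by (rule transpose_apply_other)
  qed
  then have "map \<tau> xs = ys" unfolding \<sigma>(2)[symmetric] by simp
  moreover have "\<tau> x = y" by (simp add: \<tau>_def)
  ultimately have "map \<tau> (x # xs) = y # ys" by simp
  moreover have "bij \<tau>" unfolding \<tau>_def by (intro bij_comp \<sigma>(1) bij_transpose)
  ultimately show ?case by (intro exI[of _ \<tau>] conjI)
qed

text \<open>These two facts sort out how a chosen entry of a context lies relative to the entry, or to the cut, at
  which a deduction rule splits that context.\<close>

lemma append_Cons_eq_append_Cons: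
  "A @ a # B = C @ c # D \<longleftrightarrow>
    (\<exists>E. A = C @ c # E \<and> D = E @ a # B) \<or> (A = C \<and> a = c \<and> B = D) \<or> (\<exists>E. C = A @ a # E \<and> B = E @ c # D)"
proof (induct A arbitrary: C)
  case Nil
  then show ?case by (cases C) auto
next
  case (Cons z A)
  then show ?case by (cases C) auto
qed

lemma append_eq_append_Cons:
  "A @ B = C @ c # D \<longleftrightarrow> (\<exists>E. A = C @ c # E \<and> D = E @ B) \<or> (\<exists>E. C = A @ E \<and> B = E @ c # D)"
proof (induct A arbitrary: C)
  case (Cons z A)
  then show ?case by (cases C) auto
qed simp

lemma map_ctx_eq_append_Cons:
  "map_ctx f \<Delta> = C @ (x, T) # D \<longleftrightarrow>
    (\<exists>C' T' D'. \<Delta> = C' @ (x, T') # D' \<and> map_ctx f C' = C \<and> T = f T' \<and> D = map_ctx f D')" (is "?l \<longleftrightarrow> ?r")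
proof
  assume ?l
  then obtain C' z D' where "\<Delta> = C' @ z # D'" "map_ctx f C' = C" "(x, T) = (fst z, f (snd z))" "D = map_ctx f D'"
    unfolding map_ctx_def map_eq_append_conv map_eq_Cons_conv by (auto split: prod.splits)
  then show ?r by (cases z) auto
next
  assume ?r
  then show ?l by auto
qed

section \<open>Derivability in free D-GATs\<close>

abbreviation objects :: "hobj set" where "objects \<equiv> Ob ` {1..} \<union> ObT ` {1..}"

text \<open>Derivability in the free \<open>D\<close>-GAT on \<open>X\<close>, restricted to type and term
  judgements and with the equality rules left out. Nothing is lost, because in a free GAT the equality rules
  only ever produce and consume reflexive equalities. Generating judgements have no premises here: their
  boundaries are again generating judgements.\<close>

inductive fderiv :: "structural set \<Rightarrow> 'a presheaf \<Rightarrow> 'a fsym judgement \<Rightarrow> bool" for D X where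
  gen: "\<lbrakk>ob \<in> objects; A \<in> el X ob\<rbrakk> \<Longrightarrow> fderiv D X (gen_judgement X ob A)"
| perm: "\<lbrakk>bij \<sigma>; fderiv D X J\<rbrakk> \<Longrightarrow> fderiv D X (perm_judgement \<sigma> J)"
| weaken: "\<lbrakk>Wk \<in> D; y \<notin> ctx_vars \<Gamma> \<union> ctx_vars \<Delta>; fderiv D X (Judg \<Gamma> (IsType T)); fderiv D X (Judg (\<Gamma> @ \<Delta>) R)\<rbrakk>
    \<Longrightarrow> fderiv D X (Judg (\<Gamma> @ (y, T) # \<Delta>) R)"
| project: "\<lbrakk>Pr \<in> D; y \<notin> ctx_vars \<Gamma>; fderiv D X (Judg \<Gamma> (IsType T))\<rbrakk>
    \<Longrightarrow> fderiv D X (Judg (\<Gamma> @ [(y, T)]) (HasType (V y) T))"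
| subst: "\<lbrakk>Sb \<in> D; fderiv D X (Judg \<Gamma> (HasType t T)); fderiv D X (Judg (\<Gamma> @ (y, T) # \<Delta>) R)\<rbrakk>
    \<Longrightarrow> fderiv D X (Judg (\<Gamma> @ map_ctx (sub1 t y) \<Delta>) (map_rhs_expr (sub1 t y) R))"

abbreviation structural_ok :: "structural set \<Rightarrow> bool" where
  "structural_ok D \<equiv> Pr \<in> D \<longrightarrow> Wk \<in> D"

lemma is_presheafD:
  assumes "is_presheaf X" "n \<ge> 1"
  shows "A \<in> el X (Ob (Suc n)) \<Longrightarrow> bd X (Ob (Suc n)) A \<in> el X (Ob n)"
    "a \<in> el X (ObT n) \<Longrightarrow> bd X (ObT n) a \<in> el X (Ob n)"
  using assms by (auto simp: is_presheaf_def)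

lemma bd_iter_el: "is_presheaf X \<Longrightarrow> i \<ge> 1 \<Longrightarrow> A \<in> el X (Ob (i + k)) \<Longrightarrow> bd_iter X i k A \<in> el X (Ob i)"
proof (induct k arbitrary: A)
  case (Suc k)
  then show ?case using is_presheafD(1)[of X "i + k" A] by simp
qed simp

lemma gen_ctx_Suc:
  assumes "n \<ge> 1"
  shows "gen_ctx X (Suc n) A = gen_ctx X n (bd X (Ob (Suc n)) A) @ [(n, gen_type n (bd X (Ob (Suc n)) A))]"
proof -
  have "bd_iter X i (Suc n - i) A = bd_iter X i (n - i) (bd X (Ob (Suc n)) A)" if "i < n \<or> i = n" for i
    using that by (auto simp: Suc_diff_le)
  then show ?thesis using assms by (auto simp: gen_ctx_def)
qed

lemma gen_ctx_1 [simp]: "gen_ctx X (Suc 0) A = []"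
  by (simp add: gen_ctx_def)

lemma map_fst_gen_ctx [simp]: "map fst (gen_ctx X n A) = [1..<n]"
  by (auto simp: gen_ctx_def intro!: map_idI)

lemma length_gen_ctx [simp]: "length (gen_ctx X n A) = n - 1"
  by (simp add: gen_ctx_def)

lemma gen_ctx_prefix:
  assumes "gen_ctx X n A = \<Gamma> @ (x, T) # \<Delta>"
  shows "\<exists>k. 1 \<le> x \<and> n = x + k \<and> k \<ge> 1 \<and> \<Gamma> = gen_ctx X x (bd_iter X x k A) \<and> T = gen_type x (bd_iter X x k A)"
  using assms
proof (induct n arbitrary: A \<Gamma> \<Delta> x T)
  case 0
  then show ?case by (simp add: gen_ctx_def)
next
  case (Suc n)
  show ?case
  proof (cases "n \<ge> 1")
    case True
    from Suc(2) gen_ctx_Suc[OF True, of X A]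
    have eq: "gen_ctx X n (bd X (Ob (Suc n)) A) @ [(n, gen_type n (bd X (Ob (Suc n)) A))] = \<Gamma> @ (x, T) # \<Delta>" by simp
    show ?thesis
    proof (cases \<Delta> rule: rev_cases)
      case Nil
      then show ?thesis using eq True by (intro exI[of _ 1]) auto
    next
      case (snoc \<Delta>' z)
      then have "gen_ctx X n (bd X (Ob (Suc n)) A) = \<Gamma> @ (x, T) # \<Delta>'" using eq by simp
      from Suc(1)[OF this] obtain k where "1 \<le> x" "n = x + k" "k \<ge> 1"
        "\<Gamma> = gen_ctx X x (bd_iter X x k (bd X (Ob (Suc n)) A))" "T = gen_type x (bd_iter X x k (bd X (Ob (Suc n)) A))"
        by auto
      then show ?thesis by (intro exI[of _ "Suc k"]) auto
    qed
  next
    case False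
    then show ?thesis using Suc(2) by (auto simp: gen_ctx_def)
  qed
qed

lemma fderiv_kind: "fderiv D X J \<Longrightarrow> is_type_judgement J \<or> is_term_judgement J"
proof (induct rule: fderiv.induct)
  case (gen ob A)
  then show ?case by (cases ob) (auto simp: is_type_judgement_def is_term_judgement_def)
next
  case (weaken y \<Gamma> \<Delta> T R)
  then show ?case by (auto simp: is_type_judgement_def is_term_judgement_def)
next
  case (subst \<Gamma> t T y \<Delta> R)
  then show ?case by (auto simp: is_type_judgement_def is_term_judgement_def)
qed (auto simp: is_type_judgement_def is_term_judgement_def perm_judgement_def)

lemma fderiv_no_eq: "fderiv D X (Judg \<Gamma> R) \<Longrightarrow> (\<exists>T. R = IsType T) \<or> (\<exists>t T. R = HasType t T)"
  by (drule fderiv_kind) (auto simp: is_type_judgement_def is_term_judgement_def)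

lemma fderiv_mono: "fderiv D X J \<Longrightarrow> D \<subseteq> D' \<Longrightarrow> fderiv D' X J"
  by (induct rule: fderiv.induct) (auto intro: fderiv.intros)

text \<open>Presuppositions are derivable. When a projection introduces a term, the weakening rule provides
  its type in the longer context.\<close>

lemma fderiv_presup:
  assumes "is_presheaf X" "structural_ok D" "fderiv D X J"
  shows "ctx_of J = \<Gamma> \<Longrightarrow> rhs_of J = HasType t T \<Longrightarrow> fderiv D X (Judg \<Gamma> (IsType T))"
  using assms(3)
proof (induct arbitrary: \<Gamma> t T rule: fderiv.induct)
  case (gen ob A)
  then obtain n where n: "ob = ObT n" "n \<ge> 1" by (cases ob) auto
  then show ?case
    using gen fderiv.gen[of "Ob n" "bd X (ObT n) A" X] is_presheafD(2)[OF assms(1) n(2)] by auto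
next
  case (perm \<sigma> J)
  then obtain t0 T0 where "rhs_of J = HasType t0 T0" "T = ren \<sigma> T0"
    by (cases "rhs_of J") (auto simp: perm_judgement_def)
  with perm show ?case using fderiv.perm[OF perm(1), of D X "Judg (ctx_of J) (IsType T0)"]
    by (auto simp: perm_judgement_def)
next
  case (weaken y \<Gamma>' \<Delta> T' R)
  then show ?case using fderiv.weaken[OF weaken(1-3), of "IsType T"] by auto
next
  case (project y \<Gamma>' T')
  then show ?case using fderiv.weaken[of D y \<Gamma>' "[]" X T' "IsType T"] assms(2) by auto
next
  case (subst \<Gamma>' t' T' y \<Delta> R)
  then obtain t0 T0 where "R = HasType t0 T0" "T = sub1 t' y T0" by (cases R) auto
  then show ?case using subst fderiv.subst[OF subst(1,2), of y \<Delta> "IsType T0"] by auto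
qed

lemma fderiv_typeof:
  "\<lbrakk>is_presheaf X; structural_ok D; fderiv D X (Judg \<Gamma> (HasType t T))\<rbrakk> \<Longrightarrow> fderiv D X (Judg \<Gamma> (IsType T))"
  by (rule fderiv_presup) auto

text \<open>The type of each entry of a context is derivable in the part of the context before it. Apart from
  permutations, each rule changes a context at one place; an entry to the left of that place is untouched, and
  to an entry on the right the same rule is applied.\<close>

lemma fderiv_prefix_aux:
  assumes "is_presheaf X" "structural_ok D" "fderiv D X J"
  shows "ctx_of J = \<Gamma> @ (x, T) # \<Delta> \<Longrightarrow> fderiv D X (Judg \<Gamma> (IsType T))"
  using assms(3)
proof (induct arbitrary: \<Gamma> x T \<Delta> rule: fderiv.induct)
  case (gen ob A)
  have "\<exists>n B. n \<ge> 1 \<and> ctx_of (gen_judgement X ob A) = gen_ctx X n B \<and> B \<in> el X (Ob n)"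
  proof (cases ob)
    case (Ob n)
    then show ?thesis using gen by (intro exI[of _ n] exI[of _ A]) auto
  next
    case (ObT n)
    then show ?thesis using gen is_presheafD(2)[OF assms(1)] by (intro exI[of _ n] exI[of _ "bd X (ObT n) A"]) auto
  qed
  then obtain n B where n: "n \<ge> 1" "ctx_of (gen_judgement X ob A) = gen_ctx X n B" "B \<in> el X (Ob n)"
    by blast
  with gen obtain k where "1 \<le> x" "n = x + k" "\<Gamma> = gen_ctx X x (bd_iter X x k B)" "T = gen_type x (bd_iter X x k B)"
    using gen_ctx_prefix[of X n B \<Gamma> x T \<Delta>] by auto
  then show ?case using fderiv.gen[of "Ob x" "bd_iter X x k B" X D] bd_iter_el[OF assms(1)] n by auto
next
  case (perm \<sigma> J)
  then obtain \<Gamma>0 x0 T0 \<Delta>0 where "ctx_of J = \<Gamma>0 @ (x0, T0) # \<Delta>0" "T = ren \<sigma> T0"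
    "\<Gamma> = map (\<lambda>(x, T). (\<sigma> x, ren \<sigma> T)) \<Gamma>0"
    by (auto simp: perm_judgement_def map_eq_append_conv map_eq_Cons_conv)
  with perm show ?case using fderiv.perm[OF perm(1), of D X "Judg \<Gamma>0 (IsType T0)"] by auto
next
  case (weaken y \<Gamma>' \<Delta>' T' R)
  from weaken(7) consider (a) E where "\<Gamma>' = \<Gamma> @ (x, T) # E" | (b) "\<Gamma>' = \<Gamma>" "T' = T"
    | (c) E where "\<Gamma> = \<Gamma>' @ (y, T') # E" "\<Delta>' = E @ (x, T) # \<Delta>"
    by (auto simp: append_Cons_eq_append_Cons)
  then show ?case
  proof cases
    case a
    then show ?thesis using weaken(4)[of \<Gamma> x T E] by auto
  next
    case b
    then show ?thesis using weaken by auto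
  next
    case c
    then have "fderiv D X (Judg (\<Gamma>' @ E) (IsType T))" using weaken(6)[of "\<Gamma>' @ E" x T \<Delta>] by auto
    then show ?thesis using c weaken fderiv.weaken[of D y \<Gamma>' E X T' "IsType T"] by auto
  qed
next
  case (project y \<Gamma>' T')
  from project(5) consider "\<Gamma> = \<Gamma>'" "T = T'" | E where "\<Gamma>' = \<Gamma> @ (x, T) # E"
    by (cases \<Delta> rule: rev_cases) auto
  then show ?case using project(3,4) by cases auto
next
  case (subst \<Gamma>' t T' y \<Delta>' R)
  from subst(6) consider (a) E where "\<Gamma>' = \<Gamma> @ (x, T) # E"
    | (c) E T0 \<Delta>0 where "\<Gamma> = \<Gamma>' @ map_ctx (sub1 t y) E" "\<Delta>' = E @ (x, T0) # \<Delta>0" "T = sub1 t y T0"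
    by (auto simp: append_eq_append_Cons map_ctx_eq_append_Cons)
  then show ?case
  proof cases
    case a
    then show ?thesis using subst(3)[of \<Gamma> x T E] by auto
  next
    case c
    then have "fderiv D X (Judg (\<Gamma>' @ (y, T') # E) (IsType T0))"
      using subst(5)[of "\<Gamma>' @ (y, T') # E" x T0 \<Delta>0] by auto
    then show ?thesis using c subst fderiv.subst[of D X \<Gamma>' t T' y E "IsType T0"] by auto
  qed
qed

lemma fderiv_prefix:
  "\<lbrakk>is_presheaf X; structural_ok D; fderiv D X (Judg (\<Gamma> @ (x, T) # \<Delta>) R)\<rbrakk> \<Longrightarrow> fderiv D X (Judg \<Gamma> (IsType T))"
  by (rule fderiv_prefix_aux[where J = "Judg (\<Gamma> @ (x, T) # \<Delta>) R"]) auto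

lemma fderiv_scoped_aux:
  "fderiv D X J \<Longrightarrow> distinct (map fst (ctx_of J)) \<and> (\<forall>e \<in> rhs_exprs (rhs_of J). fv e \<subseteq> fst ` set (ctx_of J))"
proof (induct rule: fderiv.induct)
  case (gen ob A)
  have "fst ` set (gen_ctx X m B) = {1..<m}" for m B
    by (metis list.set_map map_fst_gen_ctx set_upt)
  then show ?case by (cases ob) (auto simp: gen_type_def gen_vars_def)
next
  case (perm \<sigma> J)
  then show ?case
  proof (cases J)
    case (Judg \<Gamma> R)
    have "map fst (ctx_of (perm_judgement \<sigma> J)) = map \<sigma> (map fst \<Gamma>)"
      using map_fst_perm[of \<sigma> J] Judg by simp
    moreover from this have "fst ` set (ctx_of (perm_judgement \<sigma> J)) = \<sigma> ` fst ` set \<Gamma>"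
      by (metis list.set_map)
    moreover have "inj \<sigma>" using perm(1) by (rule bij_is_inj)
    moreover have "distinct (map \<sigma> (map fst \<Gamma>))"
      using perm(3) Judg \<open>inj \<sigma>\<close> by (subst distinct_map) (auto intro: inj_on_subset)
    moreover have "fv e \<subseteq> \<sigma> ` fst ` set \<Gamma>" if "e \<in> rhs_exprs (rhs_of (perm_judgement \<sigma> J))" for e
    proof -
      from that Judg obtain e0 where "e0 \<in> rhs_exprs R" "e = ren \<sigma> e0" by auto
      then show ?thesis using perm(3) Judg by (metis fv_ren image_mono judgement.sel)
    qed
    ultimately show ?thesis by metis
  qed
next
  case (weaken y \<Gamma> \<Delta> T R)
  then show ?case using dom_subset_ctx_vars[of \<Gamma>] dom_subset_ctx_vars[of \<Delta>] by auto
next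
  case (project y \<Gamma> T)
  then show ?case using dom_subset_ctx_vars[of \<Gamma>] by auto
next
  case (subst \<Gamma> t T y \<Delta> R)
  have s: "fst ` set (map_ctx (sub1 t y) \<Delta>) = fst ` set \<Delta>"
    by (metis list.set_map map_fst_map_ctx)
  have "fv (sub1 t y e) \<subseteq> fst ` set \<Gamma> \<union> fst ` set \<Delta>" if "e \<in> rhs_exprs R" for e
  proof -
    have "fv e \<subseteq> insert y (fst ` set \<Gamma> \<union> fst ` set \<Delta>)" using subst(5) that by (auto simp: image_Un)
    moreover have "fv t \<subseteq> fst ` set \<Gamma>" using subst(3) by auto
    ultimately show ?thesis using fv_sub1[of t y e] by blast
  qed
  then have "fv e \<subseteq> fst ` set (\<Gamma> @ map_ctx (sub1 t y) \<Delta>)"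
    if "e \<in> rhs_exprs (map_rhs_expr (sub1 t y) R)" for e
    using that by (auto simp: image_Un s)
  moreover have "distinct (map fst (\<Gamma> @ map_ctx (sub1 t y) \<Delta>))" using subst(5) by auto
  ultimately show ?case by (metis judgement.sel)
qed

lemma fderiv_distinct: "fderiv D X (Judg \<Gamma> R) \<Longrightarrow> distinct (map fst \<Gamma>)"
  by (drule fderiv_scoped_aux) simp

lemma fderiv_fv: "fderiv D X (Judg \<Gamma> R) \<Longrightarrow> e \<in> rhs_exprs R \<Longrightarrow> fv e \<subseteq> fst ` set \<Gamma>"
  by (drule fderiv_scoped_aux) simp

lemma fderiv_fv_ctx:
  assumes "is_presheaf X" "structural_ok D" "fderiv D X (Judg (\<Gamma> @ (x, T) # \<Delta>) R)"
  shows "fv T \<subseteq> fst ` set \<Gamma>"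
  using fderiv_fv[OF fderiv_prefix[OF assms]] by auto

text \<open>Together with distinctness of the context variables, this says that derivable judgements are well
  scoped.\<close>

lemma fderiv_jvars:
  assumes "is_presheaf X" "structural_ok D" "fderiv D X J"
  shows "jvars J = fst ` set (ctx_of J)"
proof -
  have dom: "fv T \<subseteq> fst ` set (ctx_of J)" if "(x, T) \<in> set (ctx_of J)" for x T
  proof -
    from that obtain \<Gamma> \<Delta> where "ctx_of J = \<Gamma> @ (x, T) # \<Delta>" by (meson split_list)
    moreover from this have "fv T \<subseteq> fst ` set \<Gamma>"
      using fderiv_fv_ctx[OF assms(1,2), of \<Gamma> x T \<Delta> "rhs_of J"] assms(3) by (metis judgement.collapse)
    ultimately show ?thesis by auto
  qed
  have "ctx_vars (ctx_of J) \<subseteq> fst ` set (ctx_of J)"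
  proof
    fix v assume "v \<in> ctx_vars (ctx_of J)"
    then obtain x T where xT: "(x, T) \<in> set (ctx_of J)" "v = x \<or> v \<in> fv T"
      unfolding ctx_vars_def by blast
    have "x \<in> fst ` set (ctx_of J)" by (rule image_eqI[OF _ xT(1)]) simp
    then show "v \<in> fst ` set (ctx_of J)" using xT(2) dom[OF xT(1)] by blast
  qed
  then have "ctx_vars (ctx_of J) = fst ` set (ctx_of J)"
    using dom_subset_ctx_vars[of "ctx_of J"] by blast
  moreover have "\<Union> (fv ` rhs_exprs (rhs_of J)) \<subseteq> fst ` set (ctx_of J)"
    using fderiv_scoped_aux[OF assms(3)] by blast
  ultimately show ?thesis by (simp add: jvars_def Un_absorb2)
qed

text \<open>For a reflexive equality, the judgement that the reflexivity rule derives it from.\<close>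

primrec subject :: "'c rhs \<Rightarrow> 'c rhs" where
  "subject (IsType T) = IsType T"
| "subject (HasType t T) = HasType t T"
| "subject (TypeEq T T') = IsType T"
| "subject (TermEq t t' T) = HasType t T"

primrec reflexive_rhs :: "'c rhs \<Rightarrow> bool" where
  "reflexive_rhs (IsType T) \<longleftrightarrow> True"
| "reflexive_rhs (HasType t T) \<longleftrightarrow> True"
| "reflexive_rhs (TypeEq T T') \<longleftrightarrow> T = T'"
| "reflexive_rhs (TermEq t t' T) \<longleftrightarrow> t = t'"

lemma subject_map [simp]: "subject (map_rhs_expr f R) = map_rhs_expr f (subject R)"
  by (cases R) auto

lemma reflexive_map: "reflexive_rhs R \<Longrightarrow> reflexive_rhs (map_rhs_expr f R)"
  by (cases R) auto

text \<open>Equalities enter a derivation in a free GAT only through the reflexivity rules, since no basic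
  judgement is an equality. Substituting equal terms then means substituting the same term, so each rule about
  equalities becomes one of the rules kept in \<open>fderiv\<close>, or the identity.\<close>

lemma derived_imp_fderiv:
  assumes "derived D (G_obj X) J"
  shows "reflexive_rhs (rhs_of J) \<and> fderiv D X (Judg (ctx_of J) (subject (rhs_of J)))"
  using assms
proof (induct rule: derived.induct)
  case (by_rule r Js J)
  have IH: "reflexive_rhs (rhs_of J') \<and> fderiv D X (Judg (ctx_of J') (subject (rhs_of J')))" if "J' \<in> set Js" for J'
    using by_rule(3) that by blast
  from by_rule(2) show ?case
  proof cases
    case (perm \<sigma> J')
    then show ?thesis using IH[of J'] fderiv.perm[of \<sigma> D X "Judg (ctx_of J') (subject (rhs_of J'))"]
      by (auto simp: perm_judgement_def reflexive_map)
  next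
    case (weaken y \<Gamma> \<Delta> T R)
    then show ?thesis using IH[of "Judg \<Gamma> (IsType T)"] IH[of "Judg (\<Gamma> @ \<Delta>) R"] by_rule(1)
        fderiv.weaken[of D y \<Gamma> \<Delta> X T "subject R"] by auto
  next
    case (project y \<Gamma> T)
    then show ?thesis using IH[of "Judg \<Gamma> (IsType T)"] by_rule(1) fderiv.project[of D y \<Gamma> X T] by auto
  next
    case (subst y \<Gamma> t T \<Delta> R)
    then show ?thesis using IH[of "Judg \<Gamma> (HasType t T)"] IH[of "Judg (\<Gamma> @ (y, T) # \<Delta>) R"] by_rule(1)
        fderiv.subst[of D X \<Gamma> t T y \<Delta> "subject R"] by (auto simp: reflexive_map)
  next
    case (subst_tyeq y \<Gamma> t1 t2 T \<Delta> T')
    then show ?thesis using IH[of "Judg \<Gamma> (TermEq t1 t2 T)"] IH[of "Judg (\<Gamma> @ (y, T) # \<Delta>) (IsType T')"] by_rule(1)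
        fderiv.subst[of D X \<Gamma> t1 T y \<Delta> "IsType T'"] by auto
  next
    case (subst_tmeq y \<Gamma> t1 t2 T \<Delta> t' T')
    then show ?thesis using IH[of "Judg \<Gamma> (TermEq t1 t2 T)"] IH[of "Judg (\<Gamma> @ (y, T) # \<Delta>) (HasType t' T')"] by_rule(1)
        fderiv.subst[of D X \<Gamma> t1 T y \<Delta> "HasType t' T'"] by auto
  qed (use by_rule(3) in simp_all)
next
  case (by_basic J)
  then obtain ob A where "J = gen_judgement X ob A" "ob \<in> objects" "A \<in> el X ob"
    by (auto simp: G_obj_def)
  then show ?case using fderiv.gen[of ob A X D] by (cases ob) auto
qed

lemma gen_boundary:
  assumes "n \<ge> 1"
  shows "boundary (gen_judgement X (Ob (Suc n)) A) = [gen_judgement X (Ob n) (bd X (Ob (Suc n)) A)]"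
    "boundary (gen_judgement X (ObT n) a) = [gen_judgement X (Ob n) (bd X (ObT n) a)]"
  using assms by (auto simp: gen_ctx_Suc)

lemma gen_derived:
  assumes "is_presheaf X" "ob \<in> objects" "A \<in> el X ob"
  shows "derived D (G_obj X) (gen_judgement X ob A)"
proof -
  have basic: "gen_judgement X ob A \<in> basic (G_obj X)" if "ob \<in> objects" "A \<in> el X ob" for ob A
    using that by (auto simp: G_obj_def)
  have *: "derived D (G_obj X) (gen_judgement X (Ob (Suc n)) A)" if "A \<in> el X (Ob (Suc n))" for n A
    using that
  proof (induct n arbitrary: A)
    case 0
    then show ?case using derived.by_basic[OF basic[of "Ob 1" A]] by simp
  next
    case (Suc n)
    have "derived D (G_obj X) (gen_judgement X (Ob (Suc n)) (bd X (Ob (Suc (Suc n))) A))"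
      using Suc is_presheafD(1)[OF assms(1), of "Suc n" A] by simp
    then show ?case using derived.by_basic[OF basic[of "Ob (Suc (Suc n))" A]] Suc(2)
      by (simp add: gen_boundary del: gen_judgement.simps boundary.simps)
  qed
  show ?thesis
  proof (cases ob)
    case (Ob n)
    then show ?thesis using assms *[of A "n - 1"] by (cases n) auto
  next
    case (ObT n)
    then obtain m where m: "n = Suc m" using assms(2) by (cases n) auto
    have "derived D (G_obj X) (gen_judgement X (Ob n) (bd X (ObT n) A))"
      using assms ObT m *[of "bd X (ObT n) A" m] is_presheafD(2)[OF assms(1), of n A] by simp
    then show ?thesis using derived.by_basic[OF basic[OF assms(2,3)]] ObT m
      by (simp add: gen_boundary del: gen_judgement.simps boundary.simps)
  qed
qed

lemma fderiv_imp_derived: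
  assumes "is_presheaf X" "fderiv D X J"
  shows "derived D (G_obj X) J"
  using assms(2)
proof (induct rule: fderiv.induct)
  case (gen ob A)
  then show ?case using gen_derived[OF assms(1)] by blast
next
  case (perm \<sigma> J)
  then show ?case by (intro derived.by_rule[OF _ infers.perm]) auto
next
  case (weaken y \<Gamma> \<Delta> T R)
  then show ?case by (intro derived.by_rule[OF _ infers.weaken]) auto
next
  case (project y \<Gamma> T)
  then show ?case by (intro derived.by_rule[OF _ infers.project]) auto
next
  case (subst \<Gamma> t T y \<Delta> R)
  then show ?case by (intro derived.by_rule[OF _ infers.subst[of y \<Gamma> t T]]) auto
qed

lemma derived_free_iff:
  assumes "is_presheaf X"
  shows "derived D (G_obj X) (Judg \<Gamma> (IsType T)) \<longleftrightarrow> fderiv D X (Judg \<Gamma> (IsType T))"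
    "derived D (G_obj X) (Judg \<Gamma> (HasType t T)) \<longleftrightarrow> fderiv D X (Judg \<Gamma> (HasType t T))"
    "derived D (G_obj X) (Judg \<Gamma> (TypeEq T T')) \<longleftrightarrow> T = T' \<and> fderiv D X (Judg \<Gamma> (IsType T))"
    "derived D (G_obj X) (Judg \<Gamma> (TermEq t t' T)) \<longleftrightarrow> t = t' \<and> fderiv D X (Judg \<Gamma> (HasType t T))"
proof -
  have "derived D (G_obj X) (Judg \<Gamma> (TypeEq T T))" if "fderiv D X (Judg \<Gamma> (IsType T))"
    using fderiv_imp_derived[OF assms that] by (intro derived.by_rule[OF _ infers.ty_refl]) auto
  moreover have "derived D (G_obj X) (Judg \<Gamma> (TermEq t t T))" if "fderiv D X (Judg \<Gamma> (HasType t T))"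
    using fderiv_imp_derived[OF assms that] by (intro derived.by_rule[OF _ infers.tm_refl]) auto
  ultimately show "derived D (G_obj X) (Judg \<Gamma> (IsType T)) \<longleftrightarrow> fderiv D X (Judg \<Gamma> (IsType T))"
    "derived D (G_obj X) (Judg \<Gamma> (HasType t T)) \<longleftrightarrow> fderiv D X (Judg \<Gamma> (HasType t T))"
    "derived D (G_obj X) (Judg \<Gamma> (TypeEq T T')) \<longleftrightarrow> T = T' \<and> fderiv D X (Judg \<Gamma> (IsType T))"
    "derived D (G_obj X) (Judg \<Gamma> (TermEq t t' T)) \<longleftrightarrow> t = t' \<and> fderiv D X (Judg \<Gamma> (HasType t T))"
    using fderiv_imp_derived[OF assms] by (fastforce dest: derived_imp_fderiv)+
qed

lemma derived_kind_iff:
  assumes "is_presheaf X" "is_type_judgement J \<or> is_term_judgement J"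
  shows "derived D (G_obj X) J \<longleftrightarrow> fderiv D X J"
  using assms(2) derived_free_iff(1,2)[OF assms(1)]
  by (cases J) (auto simp: is_type_judgement_def is_term_judgement_def)

section \<open>Equivalence as renaming of variables\<close>

definition alpha_eq :: "'c judgement \<Rightarrow> 'c judgement \<Rightarrow> bool" where
  "alpha_eq J J' \<longleftrightarrow> (\<exists>\<sigma>. bij \<sigma> \<and> J' = perm_judgement \<sigma> J)"

lemma alpha_eq_refl [simp]: "alpha_eq J J"
  unfolding alpha_eq_def by (rule exI[of _ id]) (simp only: bij_id perm_judgement_id simp_thms)

lemma alpha_eq_sym: "alpha_eq J J' \<Longrightarrow> alpha_eq J' J"
  unfolding alpha_eq_def
  by (metis bij_imp_bij_inv bij_is_inj inv_o_cancel perm_judgement_id(1) perm_judgement_perm)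

lemma alpha_eq_trans: "alpha_eq J J' \<Longrightarrow> alpha_eq J' J'' \<Longrightarrow> alpha_eq J J''"
  unfolding alpha_eq_def by (metis bij_comp perm_judgement_perm)

lemma alpha_eq_fderiv: "alpha_eq J J' \<Longrightarrow> fderiv D X J \<Longrightarrow> fderiv D X J'"
  by (auto simp: alpha_eq_def intro: fderiv.perm)

lemma alpha_eq_degree: "alpha_eq J J' \<Longrightarrow> degree J' = degree J"
  by (auto simp: alpha_eq_def)

lemma alpha_eq_kind:
  "alpha_eq J J' \<Longrightarrow> is_type_judgement J' = is_type_judgement J"
  "alpha_eq J J' \<Longrightarrow> is_term_judgement J' = is_term_judgement J"
  by (auto simp: alpha_eq_def)

lemma rename_to_perm:
  assumes "bij \<sigma>" "distinct xs" "fv e \<subseteq> set xs"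
  shows "rename_to xs (map \<sigma> xs) (ren \<sigma> e) = e"
proof -
  have inj: "inj \<sigma>" using assms(1) by (rule bij_is_inj)
  have "map_of (zip (map \<sigma> xs) xs) (\<sigma> x) = Some x" if "x \<in> set xs" for x
  proof -
    have "distinct (map fst (zip (map \<sigma> xs) xs))" using assms(2) inj
      by (simp add: distinct_map inj_on_subset[OF inj])
    moreover have "(\<sigma> x, x) \<in> set (zip (map \<sigma> xs) xs)"
      using that by (auto simp: in_set_zip in_set_conv_nth)
    ultimately show ?thesis by simp
  qed
  then show ?thesis unfolding rename_to_def ren_ren using assms(3) by (intro ren_id) auto
qed

text \<open>The substitution in the definition of \<open>\<equiv>\<close> is undone by any permutation that
  matches the two contexts.\<close>

lemma rename_to_eq:
  assumes "bij \<sigma>" "map \<sigma> xs = ys" "distinct xs" "fv e \<subseteq> set ys" "rename_to xs ys e = e'"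
  shows "ren \<sigma> e' = e"
proof -
  define e0 where "e0 = ren (inv \<sigma>) e"
  have e: "e = ren \<sigma> e0" unfolding e0_def ren_ren using assms(1)
    by (simp add: ren_id surj_iff[THEN iffD1, OF bij_is_surj])
  have "fv e0 = inv \<sigma> ` fv e" by (simp add: e0_def fv_ren)
  also have "\<dots> \<subseteq> inv \<sigma> ` \<sigma> ` set xs" using assms(2,4) by (metis image_mono list.set_map)
  also have "\<dots> = set xs" using assms(1) by (simp add: image_comp bij_is_inj)
  finally have "e' = e0" using rename_to_perm[OF assms(1,3), of e0] assms(2,5) e by simp
  then show ?thesis using e by simp
qed

lemma nth_types_of:
  "i < length \<Gamma> \<Longrightarrow> types_of \<Gamma> S ! i = snd (\<Gamma> ! i)" "types_of \<Gamma> S ! length \<Gamma> = S"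
  "i = length \<Gamma> \<Longrightarrow> types_of \<Gamma> S ! i = S"
  by (auto simp: types_of_def nth_append)

lemma fderiv_types_of:
  assumes "is_presheaf X" "structural_ok D" "fderiv D X (Judg \<Gamma> (IsType S))" "i \<le> length \<Gamma>"
  shows "fderiv D X (Judg (take i \<Gamma>) (IsType (types_of \<Gamma> S ! i)))"
proof (cases "i < length \<Gamma>")
  case True
  then have "\<Gamma> = take i \<Gamma> @ (fst (\<Gamma> ! i), snd (\<Gamma> ! i)) # drop (Suc i) \<Gamma>" by (simp add: id_take_nth_drop)
  then show ?thesis using fderiv_prefix[OF assms(1,2)] assms(3) True by (metis nth_types_of(1))
next
  case False
  then show ?thesis using assms(3,4) by (simp add: nth_types_of)
qed

text \<open>Since derivable equalities are reflexive, the equalities that define \<open>\<equiv>\<close> say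
  that renaming identifies the contexts entry by entry.\<close>

lemma type_equiv_free:
  assumes X: "is_presheaf X" and D: "structural_ok D"
    and S: "fderiv D X (Judg \<Gamma> (IsType S))" and T: "fderiv D X (Judg \<Delta> (IsType T))"
    and \<sigma>: "bij \<sigma>" "map \<sigma> (map fst \<Gamma>) = map fst \<Delta>"
  shows "type_equiv D (G_obj X) \<Gamma> S \<Delta> T \<longleftrightarrow> Judg \<Delta> (IsType T) = perm_judgement \<sigma> (Judg \<Gamma> (IsType S))"
proof
  have len: "length \<Gamma> = length \<Delta>" using \<sigma>(2) by (metis length_map)
  have dis: "distinct (map fst (take i \<Gamma>))" for i using fderiv_distinct[OF S] by (simp add: take_map[symmetric])
  have tk: "map \<sigma> (map fst (take i \<Gamma>)) = map fst (take i \<Delta>)" for i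
    using \<sigma>(2) by (metis take_map)
  have fvT: "fv (types_of \<Delta> T ! i) \<subseteq> set (map fst (take i \<Delta>))" if "i \<le> length \<Delta>" for i
    using fderiv_fv[OF fderiv_types_of[OF X D T that]] by auto
  have fvS: "fv (types_of \<Gamma> S ! i) \<subseteq> set (map fst (take i \<Gamma>))" if "i \<le> length \<Gamma>" for i
    using fderiv_fv[OF fderiv_types_of[OF X D S that]] by auto
  {
    assume "type_equiv D (G_obj X) \<Gamma> S \<Delta> T"
    then have "types_of \<Gamma> S ! i = rename_to (take i (map fst \<Gamma>)) (take i (map fst \<Delta>)) (types_of \<Delta> T ! i)"
      if "i \<le> length \<Gamma>" for i
      using that by (auto simp: type_equiv_def derived_free_iff[OF X])
    then have eq: "types_of \<Delta> T ! i = ren \<sigma> (types_of \<Gamma> S ! i)" if "i \<le> length \<Gamma>" for i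
      using rename_to_eq[OF \<sigma>(1) tk dis fvT, of i] that len by (simp add: take_map)
    have "\<Delta> = map (\<lambda>(x, T). (\<sigma> x, ren \<sigma> T)) \<Gamma>"
    proof (rule nth_equalityI)
      fix i assume i: "i < length \<Delta>"
      have "fst (\<Delta> ! i) = \<sigma> (fst (\<Gamma> ! i))" using \<sigma>(2) i len by (metis length_map nth_map)
      moreover have "snd (\<Delta> ! i) = ren \<sigma> (snd (\<Gamma> ! i))" using eq[of i] i len by (simp add: nth_types_of)
      ultimately show "\<Delta> ! i = map (\<lambda>(x, T). (\<sigma> x, ren \<sigma> T)) \<Gamma> ! i"
        using i len by (simp add: prod_eq_iff split: prod.split)
    qed (simp add: len)
    moreover have "T = ren \<sigma> S" using eq[of "length \<Gamma>"] len by (simp add: nth_types_of)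
    ultimately show "Judg \<Delta> (IsType T) = perm_judgement \<sigma> (Judg \<Gamma> (IsType S))" by simp
  next
    assume "Judg \<Delta> (IsType T) = perm_judgement \<sigma> (Judg \<Gamma> (IsType S))"
    then have eq: "\<Delta> = map (\<lambda>(x, T). (\<sigma> x, ren \<sigma> T)) \<Gamma>" "T = ren \<sigma> S" by auto
    have "types_of \<Delta> T ! i = ren \<sigma> (types_of \<Gamma> S ! i)" if "i \<le> length \<Gamma>" for i
      using eq that by (cases "i = length \<Gamma>") (auto simp: nth_types_of split: prod.split)
    then have "rename_to (take i (map fst \<Gamma>)) (take i (map fst \<Delta>)) (types_of \<Delta> T ! i) = types_of \<Gamma> S ! i"
      if "i \<le> length \<Gamma>" for i
      using rename_to_perm[OF \<sigma>(1) dis fvS, of i] tk[of i] that by (simp add: take_map)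
    then show "type_equiv D (G_obj X) \<Gamma> S \<Delta> T"
      using fderiv_types_of[OF X D S] len by (simp add: type_equiv_def derived_free_iff[OF X])
  }
qed

lemma fderiv_lists_perm:
  assumes "fderiv D X (Judg \<Gamma> R)" "fderiv D X (Judg \<Delta> R')" "length \<Gamma> = length \<Delta>"
  shows "\<exists>\<sigma>. bij \<sigma> \<and> map \<sigma> (map fst \<Gamma>) = map fst \<Delta>"
  by (rule permutation_between_lists) (use assms fderiv_distinct in auto)

lemma jequiv_free:
  assumes X: "is_presheaf X" and D: "structural_ok D"
  shows "(J, J') \<in> jequiv D (G_obj X) \<longleftrightarrow> fderiv D X J \<and> fderiv D X J' \<and> alpha_eq J J'" (is "?l \<longleftrightarrow> ?r")
proof
  assume l: ?l
  obtain \<Gamma> R \<Delta> R' where J: "J = Judg \<Gamma> R" "J' = Judg \<Delta> R'" by (cases J; cases J') auto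
  from l J consider (ty) S T where "R = IsType S" "R' = IsType T" | (tm) s S t T where "R = HasType s S" "R' = HasType t T"
    by (cases R; cases R') (auto simp: jequiv_def)
  then show ?r
  proof cases
    case ty
    then have der: "fderiv D X (Judg \<Gamma> (IsType S))" "fderiv D X (Judg \<Delta> (IsType T))"
      and eq: "type_equiv D (G_obj X) \<Gamma> S \<Delta> T"
      using l J by (auto simp: jequiv_def derived_free_iff[OF X])
    then obtain \<sigma> where "bij \<sigma>" "map \<sigma> (map fst \<Gamma>) = map fst \<Delta>"
      using fderiv_lists_perm[OF der] by (auto simp: type_equiv_def)
    with type_equiv_free[OF X D der this] eq have "alpha_eq J J'"
      unfolding alpha_eq_def J ty by (intro exI[of _ \<sigma>]) simp
    then show ?thesis using der J ty by simp
  next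
    case tm
    then have der: "fderiv D X (Judg \<Gamma> (HasType s S))" "fderiv D X (Judg \<Delta> (HasType t T))"
      and eq: "type_equiv D (G_obj X) \<Gamma> S \<Delta> T" and e: "s = rename_to (map fst \<Gamma>) (map fst \<Delta>) t"
      using l J by (auto simp: jequiv_def derived_free_iff[OF X] term_equiv_def)
    then obtain \<sigma> where \<sigma>: "bij \<sigma>" "map \<sigma> (map fst \<Gamma>) = map fst \<Delta>"
      using fderiv_lists_perm[OF der] by (auto simp: type_equiv_def)
    have "Judg \<Delta> (IsType T) = perm_judgement \<sigma> (Judg \<Gamma> (IsType S))"
      using type_equiv_free[OF X D _ _ \<sigma>] der[THEN fderiv_typeof[OF X D]] eq by blast
    moreover have "ren \<sigma> s = t"
      using rename_to_eq[OF \<sigma> fderiv_distinct[OF der(1)], of t s] e fderiv_fv[OF der(2), of t] by auto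
    ultimately have "J' = perm_judgement \<sigma> J" using J tm by auto
    then show ?thesis using der J tm \<sigma>(1) by (auto simp: alpha_eq_def)
  qed
next
  assume r: ?r
  then obtain \<sigma> where \<sigma>: "bij \<sigma>" "J' = perm_judgement \<sigma> J" by (auto simp: alpha_eq_def)
  obtain \<Gamma> R where J: "J = Judg \<Gamma> R" by (cases J) auto
  define \<Delta> where "\<Delta> = map (\<lambda>(x, T). (\<sigma> x, ren \<sigma> T)) \<Gamma>"
  have vars: "map \<sigma> (map fst \<Gamma>) = map fst \<Delta>" by (auto simp: \<Delta>_def)
  have ders: "derived D (G_obj X) J" "derived D (G_obj X) J'" using r fderiv_imp_derived[OF X] by auto
  from fderiv_no_eq[of D X \<Gamma> R] r J consider (ty) S where "R = IsType S" | (tm) s S where "R = HasType s S" by auto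
  then show ?l
  proof cases
    case ty
    then have J': "J' = Judg \<Delta> (IsType (ren \<sigma> S))" using J \<sigma>(2) by (simp add: \<Delta>_def)
    have "type_equiv D (G_obj X) \<Gamma> S \<Delta> (ren \<sigma> S)"
      using type_equiv_free[OF X D _ _ \<sigma>(1) vars] r J J' ty \<sigma>(2) by simp
    then show ?thesis using ders J J' ty by (simp add: jequiv_def)
  next
    case tm
    then have J': "J' = Judg \<Delta> (HasType (ren \<sigma> s) (ren \<sigma> S))" using J \<sigma>(2) by (simp add: \<Delta>_def)
    have der: "fderiv D X (Judg \<Gamma> (HasType s S))" "fderiv D X (Judg \<Delta> (HasType (ren \<sigma> s) (ren \<sigma> S)))"
      using r J J' tm by auto
    have "type_equiv D (G_obj X) \<Gamma> S \<Delta> (ren \<sigma> S)"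
      using type_equiv_free[OF X D _ _ \<sigma>(1) vars] der[THEN fderiv_typeof[OF X D]] by (simp add: \<Delta>_def)
    moreover have "rename_to (map fst \<Gamma>) (map fst \<Delta>) (ren \<sigma> s) = s"
      using rename_to_perm[OF \<sigma>(1) fderiv_distinct[OF der(1)], of s] fderiv_fv[OF der(1), of s] vars by simp
    ultimately show ?thesis using ders J J' tm der(1)
      by (simp add: jequiv_def term_equiv_def derived_free_iff[OF X])
  qed
qed

section \<open>Classes of judgements and their canonical representatives\<close>

lemma in_cls_iff:
  "\<lbrakk>is_presheaf X; structural_ok D\<rbrakk> \<Longrightarrow>
    J' \<in> cls D (G_obj X) J \<longleftrightarrow> fderiv D X J \<and> fderiv D X J' \<and> alpha_eq J J'"
  by (simp add: cls_def jequiv_free)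

lemma cls_eqI:
  assumes "is_presheaf X" "structural_ok D" "fderiv D X J" "alpha_eq J J'"
  shows "cls D (G_obj X) J = cls D (G_obj X) J'"
proof -
  have "fderiv D X J'" using alpha_eq_fderiv assms by blast
  then show ?thesis using assms(3,4) alpha_eq_trans alpha_eq_sym
    unfolding set_eq_iff in_cls_iff[OF assms(1,2)] by metis
qed

lemma cls_eqD:
  assumes "is_presheaf X" "structural_ok D" "fderiv D X J" "cls D (G_obj X) J = cls D (G_obj X) J'"
  shows "alpha_eq J J' \<and> fderiv D X J'"
proof -
  have "J \<in> cls D (G_obj X) J'" using assms by (metis alpha_eq_refl in_cls_iff)
  then show ?thesis using assms(1,2) alpha_eq_sym by (auto simp: in_cls_iff)
qed

lemma fderiv_boundary:
  assumes "is_presheaf X" "structural_ok D" "fderiv D X J" "J' \<in> set (boundary J)"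
  shows "fderiv D X J'"
proof (cases J)
  case (Judg \<Gamma> R)
  from fderiv_no_eq[of D X \<Gamma> R] assms(3) Judg
  consider (ty) T where "R = IsType T" | (tm) t T where "R = HasType t T" by auto
  then show ?thesis
  proof cases
    case ty
    then have "\<Gamma> \<noteq> []" using assms(4) Judg by (auto split: if_splits)
    then obtain \<Gamma>' x S where "\<Gamma> = \<Gamma>' @ (x, S) # []" by (metis rev_exhaust surj_pair)
    then show ?thesis using fderiv_prefix[OF assms(1,2), of \<Gamma>' x S "[]" R] assms(3,4) Judg ty by auto
  next
    case tm
    then show ?thesis using fderiv_typeof[OF assms(1,2)] assms(3,4) Judg by auto
  qed
qed

definition obj_of :: "'c judgement \<Rightarrow> hobj" where
  "obj_of J = (if is_type_judgement J then Ob (degree J) else ObT (degree J))"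

lemma obj_of_simps [simp]:
  "obj_of (Judg \<Gamma> (IsType T)) = Ob (Suc (length \<Gamma>))"
  "obj_of (Judg \<Gamma> (HasType t T)) = ObT (Suc (length \<Gamma>))"
  by (auto simp: obj_of_def is_type_judgement_def degree_def)

lemma obj_of_alpha: "alpha_eq J J' \<Longrightarrow> obj_of J' = obj_of J"
  by (simp add: obj_of_def alpha_eq_kind alpha_eq_degree)

lemma obj_of_jmap [simp]: "obj_of (jmap f J) = obj_of J"
  by (simp add: obj_of_def)

lemma obj_of_gen [simp]: "ob \<in> objects \<Longrightarrow> obj_of (gen_judgement X ob A) = ob"
  by (cases ob) auto

lemma obj_of_objects: "obj_of J \<in> objects"
  by (simp add: obj_of_def degree_def)

lemma el_M_obj:
  assumes "is_presheaf X" "structural_ok D"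
  shows "el (M_obj D X) ob = {cls D (G_obj X) J | J. fderiv D X J \<and> obj_of J = ob}"
proof -
  have *: "derived D (G_obj X) J \<and> is_type_judgement J \<and> degree J = n \<longleftrightarrow> fderiv D X J \<and> obj_of J = Ob n" for J n
    using derived_kind_iff[OF assms(1)] by (auto simp: obj_of_def)
  have **: "derived D (G_obj X) J \<and> is_term_judgement J \<and> degree J = n \<longleftrightarrow> fderiv D X J \<and> obj_of J = ObT n" for J n
    using derived_kind_iff[OF assms(1)] fderiv_kind[of D X J]
    by (auto simp: obj_of_def is_term_judgement_def is_type_judgement_def)
  show ?thesis
    by (cases ob) (auto simp: M_obj_def V_obj_def quotient_def cls_def * **)
qed

lemma M_obj_cls: "\<lbrakk>is_presheaf X; structural_ok D; fderiv D X J\<rbrakk> \<Longrightarrow> cls D (G_obj X) J \<in> el (M_obj D X) (obj_of J)"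
  by (auto simp: el_M_obj)

lemma rep_alpha:
  assumes "is_presheaf X" "structural_ok D" "fderiv D X J"
  shows "alpha_eq J (rep (cls D (G_obj X) J))"
proof -
  have "J \<in> cls D (G_obj X) J" using assms by (simp add: in_cls_iff)
  then have "rep (cls D (G_obj X) J) \<in> cls D (G_obj X) J" unfolding rep_def by (rule someI)
  then show ?thesis using assms by (simp add: in_cls_iff)
qed

lemma alpha_boundary:
  assumes "alpha_eq J J'" "boundary J \<noteq> []"
  shows "alpha_eq (hd (boundary J)) (hd (boundary J'))"
  using assms by (auto simp: alpha_eq_def boundary_perm hd_map)

text \<open>The boundary of a class does not depend on the representative that is chosen in its definition, as
  boundaries commute with permutations.\<close>

lemma bd_M_obj:
  assumes "is_presheaf X" "structural_ok D" "fderiv D X J" "boundary J \<noteq> []"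
  shows "bd (M_obj D X) ob (cls D (G_obj X) J) = cls D (G_obj X) (hd (boundary J))"
  using cls_eqI[OF assms(1,2) fderiv_boundary[OF assms(1-3)] alpha_boundary[OF rep_alpha[OF assms(1-3)] assms(4)]] assms(4)
  by (simp add: M_obj_def V_obj_def)

text \<open>Fixing the names of the context variables picks one judgement from each class.\<close>

definition canonical :: "'c judgement \<Rightarrow> bool" where
  "canonical J \<longleftrightarrow> map fst (ctx_of J) = [1..<degree J]"

lemma canonical_gen [simp]: "ob \<in> objects \<Longrightarrow> canonical (gen_judgement X ob A)"
  by (cases ob) (auto simp: canonical_def degree_def simp del: upt_Suc)

lemma map_fst_jmap [simp]: "map fst (ctx_of (jmap f J)) = map fst (ctx_of J)"
  by (auto simp: jmap_def)

lemma canonical_jmap [simp]: "canonical (jmap f J) = canonical J"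
  unfolding canonical_def by (simp only: map_fst_jmap degree_jmap)

lemma canonical_ex:
  assumes "fderiv D X J"
  shows "\<exists>J'. canonical J' \<and> alpha_eq J J'"
proof -
  have "\<exists>\<sigma>. bij \<sigma> \<and> map \<sigma> (map fst (ctx_of J)) = [1..<degree J]"
    using fderiv_scoped_aux[OF assms]
    by (intro permutation_between_lists) (auto simp: degree_def simp del: upt_Suc)
  then obtain \<sigma> where "bij \<sigma>" "map \<sigma> (map fst (ctx_of J)) = [1..<degree J]" by blast
  then have "canonical (perm_judgement \<sigma> J)" "alpha_eq J (perm_judgement \<sigma> J)"
    by (auto simp only: canonical_def map_fst_perm degree_perm alpha_eq_def)
  then show ?thesis by blast
qed

text \<open>A permutation between canonical judgements fixes the context variables, and no other variables
  occur.\<close>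

lemma canonical_unique:
  assumes "is_presheaf X" "structural_ok D" "fderiv D X J" "alpha_eq J J'" "canonical J" "canonical J'"
  shows "J' = J"
proof -
  obtain \<sigma> where \<sigma>: "J' = perm_judgement \<sigma> J" using assms(4) by (auto simp: alpha_eq_def)
  have "map \<sigma> [1..<degree J] = [1..<degree J]"
    using assms(5,6) by (simp add: canonical_def \<sigma> map_fst_perm)
  then have "\<sigma> x = x" if "x \<in> jvars J" for x
    using that assms(5) fderiv_jvars[OF assms(1-3)] unfolding canonical_def
    by (metis list.set_map map_idI map_eq_conv list.map_ident)
  then show ?thesis using \<sigma> by (simp add: perm_judgement_fixed)
qed

definition can :: "'c judgement set \<Rightarrow> 'c judgement" where
  "can c = (SOME J. J \<in> c \<and> canonical J)"

lemma can_cls: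
  assumes "is_presheaf X" "structural_ok D" "fderiv D X J" "canonical J"
  shows "can (cls D (G_obj X) J) = J"
proof -
  have "can (cls D (G_obj X) J) \<in> cls D (G_obj X) J \<and> canonical (can (cls D (G_obj X) J))"
    unfolding can_def by (rule someI[of _ J]) (use assms in \<open>simp add: in_cls_iff\<close>)
  then show ?thesis using canonical_unique[OF assms(1-3)] assms by (auto simp: in_cls_iff)
qed

lemma el_canE:
  assumes "is_presheaf X" "structural_ok D" "c \<in> el (M_obj D X) ob"
  shows "fderiv D X (can c)" "canonical (can c)" "obj_of (can c) = ob" "cls D (G_obj X) (can c) = c"
proof -
  obtain J where J: "c = cls D (G_obj X) J" "fderiv D X J" "obj_of J = ob"
    using assms by (auto simp: el_M_obj)
  obtain J' where J': "canonical J'" "alpha_eq J J'" using canonical_ex[OF J(2)] by blast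
  have "fderiv D X J'" using alpha_eq_fderiv J J' by blast
  moreover have "c = cls D (G_obj X) J'" using cls_eqI[OF assms(1,2) J(2) J'(2)] J(1) by simp
  ultimately show "fderiv D X (can c)" "canonical (can c)" "obj_of (can c) = ob" "cls D (G_obj X) (can c) = c"
    using can_cls[OF assms(1,2) _ J'(1)] J' J(3) obj_of_alpha by auto
qed

lemma obj_of_TypeE:
  assumes "fderiv D X J" "obj_of J = Ob n"
  obtains \<Gamma> T where "J = Judg \<Gamma> (IsType T)" "n = Suc (length \<Gamma>)"
  using assms fderiv_kind[OF assms(1)] by (cases J) (auto simp: is_type_judgement_def is_term_judgement_def)

lemma obj_of_TermE:
  assumes "fderiv D X J" "obj_of J = ObT n"
  obtains \<Gamma> t T where "J = Judg \<Gamma> (HasType t T)" "n = Suc (length \<Gamma>)"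
  using assms fderiv_kind[OF assms(1)] by (cases J) (auto simp: is_type_judgement_def is_term_judgement_def)

lemma canonical_boundary: "canonical J \<Longrightarrow> fderiv D X J \<Longrightarrow> J' \<in> set (boundary J) \<Longrightarrow> canonical J'"
proof (cases J)
  case (Judg \<Gamma> R)
  assume c: "canonical J" "fderiv D X J" "J' \<in> set (boundary J)"
  from fderiv_no_eq[of D X \<Gamma> R] c(2) Judg
  consider (ty) T where "R = IsType T" | (tm) t T where "R = HasType t T" by auto
  then show ?thesis
  proof cases
    case ty
    then have "\<Gamma> \<noteq> []" using c Judg by (auto split: if_splits)
    then show ?thesis using c Judg ty
      by (cases \<Gamma> rule: rev_cases) (auto simp: canonical_def degree_def)
  next
    case tm
    then show ?thesis using c Judg by (auto simp: canonical_def degree_def)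
  qed
qed

lemma boundary_Ob:
  assumes "fderiv D X J" "obj_of J = Ob (Suc n)" "n \<ge> 1"
  shows "\<exists>J'. boundary J = [J'] \<and> obj_of J' = Ob n"
  using assms(1,2)
proof (rule obj_of_TypeE)
  fix \<Gamma> T assume "J = Judg \<Gamma> (IsType T)" "Suc n = Suc (length \<Gamma>)"
  then show ?thesis using assms(3) by (cases \<Gamma> rule: rev_cases) auto
qed

lemma boundary_ObT:
  assumes "fderiv D X J" "obj_of J = ObT n"
  shows "\<exists>J'. boundary J = [J'] \<and> obj_of J' = Ob n"
  using assms(1,2)
proof (rule obj_of_TermE)
  fix \<Gamma> t T assume "J = Judg \<Gamma> (HasType t T)" "n = Suc (length \<Gamma>)"
  then show ?thesis by auto
qed

lemma boundary_can:
  assumes "is_presheaf X" "structural_ok D"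
  shows "c \<in> el (M_obj D X) (Ob (Suc n)) \<Longrightarrow> n \<ge> 1 \<Longrightarrow> boundary (can c) = [can (bd (M_obj D X) (Ob (Suc n)) c)]"
    and "c \<in> el (M_obj D X) (ObT n) \<Longrightarrow> boundary (can c) = [can (bd (M_obj D X) (ObT n) c)]"
proof -
  have *: "boundary (can c) = [can (bd (M_obj D X) ob c)]"
    if "c \<in> el (M_obj D X) ob" "boundary (can c) = [J']" for ob J'
  proof -
    note c = el_canE[OF assms that(1)]
    have "fderiv D X J'" "canonical J'"
      using fderiv_boundary[OF assms c(1)] canonical_boundary[OF c(2,1)] that(2) by auto
    moreover have "bd (M_obj D X) ob c = cls D (G_obj X) J'"
      using bd_M_obj[OF assms c(1), of ob] c(4) that(2) by simp
    ultimately show ?thesis using can_cls[OF assms] that(2) by simp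
  qed
  show "boundary (can c) = [can (bd (M_obj D X) (Ob (Suc n)) c)]" if "c \<in> el (M_obj D X) (Ob (Suc n))" "n \<ge> 1"
    using * that boundary_Ob[OF el_canE(1,3)[OF assms that(1)] that(2)] by blast
  show "boundary (can c) = [can (bd (M_obj D X) (ObT n) c)]" if "c \<in> el (M_obj D X) (ObT n)"
    using * that boundary_ObT[OF el_canE(1,3)[OF assms that(1)]] by blast
qed

lemma M_obj_presheaf:
  assumes "is_presheaf X" "structural_ok D"
  shows "is_presheaf (M_obj D X)"
proof -
  have *: "bd (M_obj D X) ob c \<in> el (M_obj D X) (Ob n)"
    if "c \<in> el (M_obj D X) ob" and ex: "\<exists>J'. boundary (can c) = [J'] \<and> obj_of J' = Ob n" for c ob n
  proof -
    note c = el_canE[OF assms that(1)]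
    obtain J' where J': "boundary (can c) = [J']" "obj_of J' = Ob n" using ex by blast
    have "fderiv D X J'" using fderiv_boundary[OF assms c(1)] J' by auto
    moreover have "bd (M_obj D X) ob c = cls D (G_obj X) J'"
      using bd_M_obj[OF assms c(1), of ob] c(4) J'(1) by simp
    ultimately show ?thesis using M_obj_cls[OF assms, of J'] J'(2) by simp
  qed
  show ?thesis unfolding is_presheaf_def
  proof (intro allI impI conjI funcsetI)
    fix n :: nat and c assume n: "1 \<le> n"
    show "bd (M_obj D X) (Ob (Suc n)) c \<in> el (M_obj D X) (Ob n)" if "c \<in> el (M_obj D X) (Ob (Suc n))"
      using * that boundary_Ob[OF el_canE(1,3)[OF assms that] n] by blast
    show "bd (M_obj D X) (ObT n) c \<in> el (M_obj D X) (Ob n)" if "c \<in> el (M_obj D X) (ObT n)"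
      using * that boundary_ObT[OF el_canE(1,3)[OF assms that]] by blast
  qed
qed

definition presheaf_map :: "'a presheaf \<Rightarrow> 'b presheaf \<Rightarrow> (hobj \<Rightarrow> 'a \<Rightarrow> 'b) \<Rightarrow> bool" where
  "presheaf_map X Y f \<longleftrightarrow> (\<forall>ob \<in> objects. f ob \<in> el X ob \<rightarrow> el Y ob) \<and>
     (\<forall>n \<ge> 1. (\<forall>A \<in> el X (Ob (Suc n)). f (Ob n) (bd X (Ob (Suc n)) A) = bd Y (Ob (Suc n)) (f (Ob (Suc n)) A)) \<and>
       (\<forall>a \<in> el X (ObT n). f (Ob n) (bd X (ObT n) a) = bd Y (ObT n) (f (ObT n) a)))"

lemma presheaf_mapD:
  assumes "presheaf_map X Y f"
  shows "ob \<in> objects \<Longrightarrow> A \<in> el X ob \<Longrightarrow> f ob A \<in> el Y ob"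
    "n \<ge> 1 \<Longrightarrow> A \<in> el X (Ob (Suc n)) \<Longrightarrow> f (Ob n) (bd X (Ob (Suc n)) A) = bd Y (Ob (Suc n)) (f (Ob (Suc n)) A)"
    "n \<ge> 1 \<Longrightarrow> a \<in> el X (ObT n) \<Longrightarrow> f (Ob n) (bd X (ObT n) a) = bd Y (ObT n) (f (ObT n) a)"
  using assms by (auto simp: presheaf_map_def)

section \<open>Expansion of constants\<close>

text \<open>Indices out of range are sent to a closed expression. Therefore \<open>args\<close> commutes with
  substitution whatever the length of the list, and the expansion of constants can be studied before arities
  are.\<close>

definition args :: "'c expr list \<Rightarrow> nat \<Rightarrow> 'c expr" where
  "args ts i = (if i \<in> {1..length ts} then ts ! (i - 1) else App undefined [])"

text \<open>Each constant \<open>c\<close> is replaced by the expression \<open>E c\<close>, in which the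
  variable \<open>i\<close> stands for the \<open>i\<close>-th argument.\<close>

primrec expand :: "('c \<Rightarrow> 'd expr) \<Rightarrow> 'c expr \<Rightarrow> 'd expr" where
  "expand E (V x) = V x"
| "expand E (App c es) = esubst (args (map (expand E) es)) (E c)"

lemma esubst_args: "esubst \<theta> (args ts i) = args (map (esubst \<theta>) ts) i"
  by (auto simp: args_def)

lemma args_gen_vars: "i \<in> {1..<n} \<Longrightarrow> args (gen_vars n) i = V i"
  by (auto simp: args_def gen_vars_def)

lemma fv_args: "fv (args ts i) \<subseteq> \<Union> (fv ` set ts)"
  by (auto simp: args_def) (metis One_nat_def Suc_le_lessD diff_Suc_less nth_mem order_less_le_trans)

text \<open>Expansion commutes with substitution for variables; this is why it preserves all deduction
  rules.\<close>

lemma expand_esubst: "expand E (esubst \<theta> e) = esubst (\<lambda>x. expand E (\<theta> x)) (expand E e)"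
proof (induct e)
  case (App c es)
  then have "map (expand E) (map (esubst \<theta>) es) = map (esubst (\<lambda>x. expand E (\<theta> x))) (map (expand E) es)"
    by simp
  then show ?case by (simp add: esubst_esubst esubst_args del: map_map)
qed simp

lemma expand_ren: "expand E (ren \<sigma> e) = ren \<sigma> (expand E e)"
  by (simp add: ren_def expand_esubst)

lemma expand_sub1: "expand E (sub1 t y e) = sub1 (expand E t) y (expand E e)"
proof -
  have "(\<lambda>x. expand E ((V(y := t)) x)) = V(y := expand E t)" by auto
  then show ?thesis by (simp add: sub1_def expand_esubst)
qed

lemma fv_expand: "fv (expand E e) \<subseteq> fv e"
proof (induct e)
  case (App c es)
  then show ?case using fv_args[of "map (expand E) es"] by (auto simp: fv_esubst) blast
qed simp

lemma expand_cong: "(\<And>c. c \<in> syms e \<Longrightarrow> E c = F c) \<Longrightarrow> expand E e = expand F e"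
proof (induct e)
  case (App c es)
  have "map (expand E) es = map (expand F) es" using App by (intro map_cong) auto
  then show ?case using App(2)[of c] by (simp del: map_eq_conv)
qed simp

text \<open>Besides commuting with substitution, expansion creates no new free variables, so the freshness
  conditions of weakening and projection are preserved.\<close>

lemma infers_jmap:
  assumes "infers r Js J"
  shows "infers r (map (jmap (expand E)) Js) (jmap (expand E) J)"
proof -
  have p: "jmap (expand E) (perm_judgement \<sigma> J) = perm_judgement \<sigma> (jmap (expand E) J)" for \<sigma> J
    by (cases J; cases "rhs_of J") (auto simp: expand_ren)
  have v: "ctx_vars (map (\<lambda>(x, T). (x, expand E T)) \<Gamma>) \<subseteq> ctx_vars \<Gamma>" for \<Gamma>
    using fv_expand[of E] by (fastforce simp: ctx_vars_def)
  have s: "map (\<lambda>(x, T). (x, expand E T)) (map_ctx (sub1 t y) \<Delta>)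
      = map_ctx (sub1 (expand E t) y) (map (\<lambda>(x, T). (x, expand E T)) \<Delta>)" for t y \<Delta>
    by (auto simp: map_ctx_def expand_sub1)
  have r: "rmap (expand E) (map_rhs_expr (sub1 t y) R)
      = map_rhs_expr (sub1 (expand E t) y) (rmap (expand E) R)" for t y R
    by (cases R) (auto simp: expand_sub1)
  from assms show ?thesis
  proof cases
    case (perm \<sigma> J')
    then show ?thesis by (auto simp: p intro: infers.perm)
  next
    case (weaken y \<Gamma> \<Delta> T R)
    have "y \<notin> ctx_vars (map (\<lambda>(x, T). (x, expand E T)) \<Gamma>) \<union> ctx_vars (map (\<lambda>(x, T). (x, expand E T)) \<Delta>)"
      using weaken(4) v[of \<Gamma>] v[of \<Delta>] by blast
    from infers.weaken[OF this] show ?thesis by (simp add: weaken jmap_Judg)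
  next
    case (project y \<Gamma> T)
    have "y \<notin> ctx_vars (map (\<lambda>(x, T). (x, expand E T)) \<Gamma>)" using project(4) v[of \<Gamma>] by blast
    from infers.project[OF this] show ?thesis by (simp add: project)
  next
    case (subst y \<Gamma> t T \<Delta> R)
    show ?thesis using infers.subst[of y "map (\<lambda>(x, T). (x, expand E T)) \<Gamma>" "expand E t" "expand E T"
        "map (\<lambda>(x, T). (x, expand E T)) \<Delta>" "rmap (expand E) R"]
      by (simp add: subst jmap_Judg s r)
  next
    case (subst_tyeq y \<Gamma> t1 t2 T \<Delta> T')
    show ?thesis using infers.subst_tyeq[of y "map (\<lambda>(x, T). (x, expand E T)) \<Gamma>" "expand E t1" "expand E t2" "expand E T"
        "map (\<lambda>(x, T). (x, expand E T)) \<Delta>" "expand E T'"]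
      by (simp add: subst_tyeq s expand_sub1)
  next
    case (subst_tmeq y \<Gamma> t1 t2 T \<Delta> t' T')
    show ?thesis using infers.subst_tmeq[of y "map (\<lambda>(x, T). (x, expand E T)) \<Gamma>" "expand E t1" "expand E t2" "expand E T"
        "map (\<lambda>(x, T). (x, expand E T)) \<Delta>" "expand E t'" "expand E T'"]
      by (simp add: subst_tmeq s expand_sub1)
  qed (auto intro: infers.intros)
qed

lemma jmap_expand_perm: "jmap (expand E) (perm_judgement \<sigma> J) = perm_judgement \<sigma> (jmap (expand E) J)"
  by (cases J; cases "rhs_of J") (auto simp: expand_ren)

lemma alpha_eq_jmap: "alpha_eq J J' \<Longrightarrow> alpha_eq (jmap (expand E) J) (jmap (expand E) J')"
  by (auto simp: alpha_eq_def jmap_expand_perm)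

lemma infers_functional: "infers r Js J \<Longrightarrow> infers r Js J' \<Longrightarrow> J = J'"
  by (induct rule: infers.induct) (auto elim: infers.cases)

primrec rhs_body :: "'c rhs \<Rightarrow> 'c expr" where
  "rhs_body (IsType T) = T"
| "rhs_body (HasType t T) = t"
| "rhs_body (TypeEq T T') = T"
| "rhs_body (TermEq t t' T) = t"

text \<open>The expansion of constants which the interpretation corresponding to \<open>g\<close>
  performs.\<close>

definition bodies :: "(hobj \<Rightarrow> 'a \<Rightarrow> 'c judgement set) \<Rightarrow> 'a fsym \<Rightarrow> 'c expr" where
  "bodies g c = (case c of Inl (n, A) \<Rightarrow> rhs_body (rhs_of (can (g (Ob n) A)))
     | Inr (n, a) \<Rightarrow> rhs_body (rhs_of (can (g (ObT n) a))))"

lemma bodies_simps [simp]: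
  "bodies g (Inl (n, A)) = rhs_body (rhs_of (can (g (Ob n) A)))"
  "bodies g (Inr (n, a)) = rhs_body (rhs_of (can (g (ObT n) a)))"
  by (auto simp: bodies_def)

lemma esubst_args_gen_vars: "fv e \<subseteq> {1..<n} \<Longrightarrow> esubst (args (gen_vars n)) e = e"
  by (rule esubst_id) (use args_gen_vars in blast)

lemma canonical_fv:
  assumes "fderiv D X J" "canonical J"
  shows "e \<in> rhs_exprs (rhs_of J) \<Longrightarrow> fv e \<subseteq> {1..<degree J}"
  using fderiv_scoped_aux[OF assms(1)] assms(2) unfolding canonical_def
  by (metis list.set_map set_upt)

lemma rhs_body_in: "rhs_body R \<in> rhs_exprs R"
  by (cases R) auto

lemma expand_gen_type:
  assumes "fv (E (Inl (n, A))) \<subseteq> {1..<n}"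
  shows "expand E (gen_type n A) = E (Inl (n, A))"
proof -
  have "map (expand E) (gen_vars n) = gen_vars n" by (simp add: gen_vars_def)
  then show ?thesis using esubst_args_gen_vars[OF assms] by (simp add: gen_type_def)
qed

lemma expand_gen_term:
  assumes "fv (E (Inr (n, A))) \<subseteq> {1..<n}"
  shows "expand E (App (Inr (n, A)) (gen_vars n)) = E (Inr (n, A))"
proof -
  have "map (expand E) (gen_vars n) = gen_vars n" by (simp add: gen_vars_def)
  then show ?thesis using esubst_args_gen_vars[OF assms] by simp
qed

text \<open>The context of a canonical judgement has prescribed variables, so the boundary determines it entirely; this
  is what inductions on the degree use.\<close>

lemma type_judgement_eqI:
  assumes "canonical J" "canonical J'" "obj_of J = Ob n" "obj_of J' = Ob n" "boundary J = boundary J'"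
    "rhs_body (rhs_of J) = rhs_body (rhs_of J')" "is_type_judgement J" "is_type_judgement J'"
  shows "J = J'"
proof -
  obtain \<Gamma> T \<Delta> T' where J: "J = Judg \<Gamma> (IsType T)" "J' = Judg \<Delta> (IsType T')"
    using assms by (metis is_type_judgement_def judgement.collapse)
  then have "length \<Gamma> = length \<Delta>" using assms by simp
  then show ?thesis using assms J
    by (cases \<Gamma> rule: rev_cases; cases \<Delta> rule: rev_cases) (auto simp: canonical_def degree_def)
qed

text \<open>By naturality of \<open>g\<close>, the expressions that replace the types in the context of a
  generating judgement are the types in the context of the canonical judgement in its image.\<close>

lemma expand_bodies_gen:
  assumes X: "is_presheaf X" and Y: "is_presheaf Y" and D: "structural_ok D"
    and g: "presheaf_map X (M_obj D Y) g" and ob: "ob \<in> objects" and A: "A \<in> el X ob"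
  shows "jmap (expand (bodies g)) (gen_judgement X ob A) = can (g ob A)"
proof -
  have o: "Ob (Suc n) \<in> objects" for n by simp
  have fvb: "fv (rhs_body (rhs_of (can (g ob A)))) \<subseteq> {1..<m}"
    if "ob \<in> objects" "A \<in> el X ob" "ob = Ob m \<or> ob = ObT m" for ob A m
  proof -
    note c = el_canE[OF Y D presheaf_mapD(1)[OF g that(1,2)]]
    have "degree (can (g ob A)) = m" using c(3) that(3) by (auto simp: obj_of_def split: if_splits)
    then show ?thesis using canonical_fv[OF c(1,2) rhs_body_in] by simp
  qed
  have ty: "jmap (expand (bodies g)) (gen_judgement X (Ob (Suc n)) A) = can (g (Ob (Suc n)) A)"
    if "A \<in> el X (Ob (Suc n))" for n A
    using that
  proof (induct n arbitrary: A)
    case (0 A)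
    note c = el_canE[OF Y D presheaf_mapD(1)[OF g o 0]]
    obtain \<Gamma> T where J: "can (g (Ob (Suc 0)) A) = Judg \<Gamma> (IsType T)" "Suc 0 = Suc (length \<Gamma>)"
      using obj_of_TypeE[OF c(1,3)] .
    show ?case
    proof (rule type_judgement_eqI)
      show "boundary (jmap (expand (bodies g)) (gen_judgement X (Ob (Suc 0)) A)) = boundary (can (g (Ob (Suc 0)) A))"
        using J by (simp add: boundary_jmap)
      show "rhs_body (rhs_of (jmap (expand (bodies g)) (gen_judgement X (Ob (Suc 0)) A))) = rhs_body (rhs_of (can (g (Ob (Suc 0)) A)))"
        using expand_gen_type[of "bodies g" "Suc 0" A] fvb[OF _ 0, of "Suc 0"] by simp
    qed (use c J in \<open>simp_all add: is_type_judgement_def del: gen_judgement.simps\<close>, simp)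
  next
    case (Suc n A)
    let ?m = "Suc (Suc n)"
    note c = el_canE[OF Y D presheaf_mapD(1)[OF g o Suc(2)]]
    obtain \<Gamma> T where J: "can (g (Ob ?m) A) = Judg \<Gamma> (IsType T)" "?m = Suc (length \<Gamma>)"
      using obj_of_TypeE[OF c(1,3)] .
    show ?case
    proof (rule type_judgement_eqI)
      have "boundary (jmap (expand (bodies g)) (gen_judgement X (Ob ?m) A)) = [can (g (Ob (Suc n)) (bd X (Ob ?m) A))]"
        using Suc(1)[of "bd X (Ob ?m) A"] is_presheafD(1)[OF X _ Suc(2)]
        by (simp add: boundary_jmap gen_boundary del: gen_judgement.simps boundary.simps)
      also have "\<dots> = boundary (can (g (Ob ?m) A))"
        using boundary_can(1)[OF Y D, of "g (Ob ?m) A" "Suc n"] presheaf_mapD(1)[OF g o Suc(2)]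
          presheaf_mapD(2)[OF g _ Suc(2)] by simp
      finally show "boundary (jmap (expand (bodies g)) (gen_judgement X (Ob ?m) A)) = boundary (can (g (Ob ?m) A))" .
      show "rhs_body (rhs_of (jmap (expand (bodies g)) (gen_judgement X (Ob ?m) A))) = rhs_body (rhs_of (can (g (Ob ?m) A)))"
        using expand_gen_type[of "bodies g" ?m A] fvb[OF _ Suc(2), of ?m] by simp
    qed (use c J in \<open>simp_all add: is_type_judgement_def del: gen_judgement.simps\<close>, simp)
  qed
  show ?thesis
  proof (cases ob)
    case (Ob n)
    then obtain m where "n = Suc m" using ob by (cases n) auto
    then show ?thesis using ty[of A m] A Ob by simp
  next
    case (ObT n)
    then obtain m where n: "n = Suc m" using ob by (cases n) auto
    note gA = presheaf_mapD(1)[OF g ob A]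
    note c = el_canE[OF Y D gA]
    obtain \<Gamma> t T where J: "can (g ob A) = Judg \<Gamma> (HasType t T)"
      using obj_of_TermE[OF c(1), of n] c(3) ObT by metis
    have "bd X (ObT n) A \<in> el X (Ob n)" using is_presheafD(2)[OF X, of n A] A ObT n by simp
    then have "jmap (expand (bodies g)) (gen_judgement X (Ob n) (bd X (ObT n) A)) = can (g (Ob n) (bd X (ObT n) A))"
      using ty n by simp
    also have "\<dots> = Judg \<Gamma> (IsType T)"
      using boundary_can(2)[OF Y D, of "g ob A" n] gA J presheaf_mapD(3)[OF g, of n A] A ObT n by simp
    finally have *: "jmap (expand (bodies g)) (gen_judgement X (Ob n) (bd X (ObT n) A)) = Judg \<Gamma> (IsType T)" .
    have "expand (bodies g) (App (Inr (n, A)) (gen_vars n)) = t"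
      using expand_gen_term[of "bodies g" n A] fvb[OF ob A, of n] J ObT by simp
    then show ?thesis using * ObT J by simp
  qed
qed

section \<open>Interpretations of free D-GATs\<close>



lemma gen_types_over:
  assumes X: "is_presheaf X" and n: "n \<ge> 1" and A: "A \<in> el X (Ob n)"
    and T: "(x, T) \<in> set (gen_ctx X n A) \<or> T = gen_type n A"
  shows "\<exists>i B. i \<ge> 1 \<and> B \<in> el X (Ob i) \<and> T = gen_type i B"
proof (cases "T = gen_type n A")
  case False
  then obtain i where i: "i \<in> {1..<n}" "T = gen_type i (bd_iter X i (n - i) A)"
    using T by (auto simp: gen_ctx_def)
  then have "bd_iter X i (n - i) A \<in> el X (Ob i)" using bd_iter_el[OF X, of i A "n - i"] A by simp
  then show ?thesis using i by auto
qed (use n A in blast)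

lemma syms_gen_vars: "e \<in> set (gen_vars n) \<Longrightarrow> syms e = {}"
  by (auto simp: gen_vars_def)

lemma syms_gen_type: "syms (gen_type n A) = {Inl (n, A)}"
  by (auto simp: gen_type_def syms_gen_vars)

lemma gen_judgement_over:
  assumes X: "is_presheaf X" and ob: "ob \<in> objects" and A: "A \<in> el X ob"
  shows "judgement_over (type_consts (G_obj X) <+> term_consts (G_obj X)) (gen_judgement X ob A)"
proof -
  obtain n B where n: "n \<ge> 1" "B \<in> el X (Ob n)" "ob = Ob n \<and> B = A \<or> ob = ObT n \<and> B = bd X (ObT n) A"
    using ob A is_presheafD(2)[OF X] by (cases ob) auto
  define \<Xi> where "\<Xi> = type_consts (G_obj X) <+> term_consts (G_obj X)"
  have S: "syms T \<subseteq> \<Xi>"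
    if T: "(x, T) \<in> set (gen_ctx X n B) \<or> T = gen_type n B" for x T
  proof -
    obtain i C where "i \<ge> 1" "C \<in> el X (Ob i)" "T = gen_type i C"
      using gen_types_over[OF X n(1,2) T] by blast
    then show ?thesis by (auto simp: syms_gen_type G_obj_def \<Xi>_def)
  qed
  have ctx: "syms T \<subseteq> \<Xi>" if "T \<in> snd ` set (gen_ctx X n B)" for T
  proof -
    from that obtain x where "(x, T) \<in> set (gen_ctx X n B)" by auto
    then show ?thesis by (intro S disjI1)
  qed
  have ty: "syms (gen_type n B) \<subseteq> \<Xi>" using S by blast
  show ?thesis
  proof (cases ob)
    case (Ob m)
    then show ?thesis using n ctx ty unfolding \<Xi>_def[symmetric] judgement_over_def by auto
  next
    case (ObT m)
    then have "syms (App (Inr (n, A)) (gen_vars n)) \<subseteq> \<Xi>"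
      using n A by (auto simp: syms_gen_vars \<Xi>_def G_obj_def)
    then show ?thesis using ObT n ctx ty unfolding \<Xi>_def[symmetric] judgement_over_def by auto
  qed
qed

lemma free_is_gat:
  assumes X: "is_presheaf X" and D: "structural_ok D"
  shows "is_gat D (G_obj X)"
proof -
  have vars: "map (V \<circ> fst) (gen_ctx X n B) = gen_vars n" for n B
    using map_fst_gen_ctx[of X n B] unfolding gen_vars_def by (metis map_map)
  have ty: "introduces_type (n, A) J \<longleftrightarrow> J = gen_judgement X (Ob n) A" if "J \<in> basic (G_obj X)" for n A J
  proof -
    from that obtain ob B where "J = gen_judgement X ob B" by (auto simp: G_obj_def)
    then show ?thesis
      by (cases ob) (auto simp: introduces_type_def vars gen_type_def)
  qed
  have tm: "introduces_term (n, a) J \<longleftrightarrow> J = gen_judgement X (ObT n) a" if "J \<in> basic (G_obj X)" for n a J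
  proof -
    from that obtain ob B where "J = gen_judgement X ob B" by (auto simp: G_obj_def)
    then show ?thesis
      by (cases ob) (auto simp: introduces_term_def vars gen_type_def)
  qed
  have basic: "J \<in> basic (G_obj X) \<longleftrightarrow> (\<exists>ob A. J = gen_judgement X ob A \<and> ob \<in> objects \<and> A \<in> el X ob)" for J
    by (auto simp: G_obj_def)
  have obj: "(n, A) \<in> type_consts (G_obj X) \<longleftrightarrow> Ob n \<in> objects \<and> A \<in> el X (Ob n)"
    "(n, A) \<in> term_consts (G_obj X) \<longleftrightarrow> ObT n \<in> objects \<and> A \<in> el X (ObT n)" for n A
    by (auto simp: G_obj_def)
  show ?thesis unfolding is_gat_def
  proof (intro conjI ballI)
    fix J assume J: "J \<in> basic (G_obj X)"
    then obtain ob A where obA: "J = gen_judgement X ob A" "ob \<in> objects" "A \<in> el X ob" using basic by blast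
    show "judgement_over (type_consts (G_obj X) <+> term_consts (G_obj X)) J"
      using gen_judgement_over[OF X] obA by blast
    show "derived D (G_obj X) J" using gen_derived[OF X] obA by blast
    show "(\<exists>A\<in>type_consts (G_obj X). introduces_type A J) \<or>
        (\<exists>f\<in>term_consts (G_obj X). introduces_term f J) \<or> is_equality_judgement J"
    proof (cases ob)
      case (Ob n)
      then show ?thesis using ty[OF J, of n A] obA obj(1)[of n A] by blast
    next
      case (ObT n)
      then show ?thesis using tm[OF J, of n A] obA obj(2)[of n A] by blast
    qed
  next
    fix c assume "c \<in> type_consts (G_obj X)"
    moreover obtain n A where "c = (n, A)" by (cases c) auto
    ultimately show "\<exists>!J. J \<in> basic (G_obj X) \<and> introduces_type c J" using ty[of _ n A] basic obj(1)[of n A] by metis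
  next
    fix c assume "c \<in> term_consts (G_obj X)"
    moreover obtain n A where "c = (n, A)" by (cases c) auto
    ultimately show "\<exists>!J. J \<in> basic (G_obj X) \<and> introduces_term c J" using tm[of _ n A] basic obj(2)[of n A] by metis
  qed (use D in blast)
qed

lemma expand_interpretation:
  assumes X: "is_presheaf X" and Y: "is_presheaf Y" and D: "structural_ok D"
    and g: "presheaf_map X (M_obj D Y) g"
  shows "interpretation_of D (G_obj X) (G_obj Y) (jmap (expand (bodies g)))"
  unfolding interpretation_of_def
proof (intro conjI allI impI)
  show "is_gat D (G_obj X)" "is_gat D (G_obj Y)" using free_is_gat X Y D by auto
  show "derived D (G_obj Y) (jmap (expand (bodies g)) J)" if "derived D (G_obj X) J" for J
    using that
  proof (induct rule: derived.induct)
    case (by_rule r Js J)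
    then have "\<forall>J' \<in> set (map (jmap (expand (bodies g))) Js). derived D (G_obj Y) J'" by simp
    then show ?case using derived.by_rule[OF by_rule(1) infers_jmap[OF by_rule(2)]] by blast
  next
    case (by_basic J)
    then obtain ob A where *: "J = gen_judgement X ob A" "ob \<in> objects" "A \<in> el X ob" by (auto simp: G_obj_def)
    then show ?case
      using fderiv_imp_derived[OF Y el_canE(1)[OF Y D presheaf_mapD(1)[OF g]]] expand_bodies_gen[OF X Y D g] by simp
  qed
  show "boundary (jmap (expand (bodies g)) J) = map (jmap (expand (bodies g))) (boundary J)" for J
    by (rule boundary_jmap)
  show "jmap (expand (bodies g)) J = J'" if "infers r Js J" "infers r (map (jmap (expand (bodies g))) Js) J'" for r Js J J'
    using infers_functional[OF infers_jmap[OF that(1)] that(2)] .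
qed

lemma interpretation_perm:
  assumes "interpretation_of D \<T> \<U> \<psi>" "derived D \<T> J" "bij \<sigma>"
  shows "\<psi> (perm_judgement \<sigma> J) = perm_judgement \<sigma> (\<psi> J)"
proof -
  have *: "\<psi> J = J'" if "available D r" "\<forall>I \<in> set Js. derived D \<T> I" "infers r Js J" "infers r (map \<psi> Js) J'"
    for r Js J J' using assms(1) that unfolding interpretation_of_def by blast
  show ?thesis
    by (rule *[of "Perm \<sigma>" "[J]"]) (use assms(2) infers.perm[OF assms(3)] in simp_all)
qed

text \<open>An interpretation whose classes on generating judgements are prescribed by \<open>g\<close> has
  prescribed values there. The class leaves only the names of the context variables open. By induction on the
  degree all but the last one, \<open>x'\<close>, are as expected. If \<open>x'\<close> were not the last
  variable of the generating judgement, it would, the earlier variables being taken, not occur in that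
  judgement at all, and exchanging it with a fresh variable would fix the generating judgement but move its
  image.\<close>

lemma interpretation_gen:
  assumes X: "is_presheaf X" and Y: "is_presheaf Y" and D: "structural_ok D"
    and g: "presheaf_map X (M_obj D Y) g" and \<psi>: "interpretation_of D (G_obj X) (G_obj Y) \<psi>"
    and \<psi>g: "\<And>ob A. ob \<in> objects \<Longrightarrow> A \<in> el X ob \<Longrightarrow> cls D (G_obj Y) (\<psi> (gen_judgement X ob A)) = g ob A"
    and ob: "ob \<in> objects" and A: "A \<in> el X ob"
  shows "\<psi> (gen_judgement X ob A) = can (g ob A)"
proof -
  have alpha: "alpha_eq (can (g ob A)) (\<psi> (gen_judgement X ob A))" "fderiv D Y (can (g ob A))"
      "canonical (can (g ob A))" "obj_of (can (g ob A)) = ob"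
    if "ob \<in> objects" "A \<in> el X ob" for ob A
    using el_canE[OF Y D presheaf_mapD(1)[OF g that]] cls_eqD[OF Y D] \<psi>g[OF that] by auto
  have bdy: "boundary (\<psi> (gen_judgement X ob A)) = map \<psi> (boundary (gen_judgement X ob A))"
    if "ob \<in> objects" "A \<in> el X ob" for ob A
    using \<psi> gen_derived[OF X that, of D] by (simp add: interpretation_of_def)
  have ty: "\<psi> (gen_judgement X (Ob (Suc n)) A) = can (g (Ob (Suc n)) A)" if "A \<in> el X (Ob (Suc n))" for n A
    using that
  proof (induct n arbitrary: A)
    case (0 A)
    have o: "Ob (Suc 0) \<in> objects" by simp
    note al = alpha[OF o 0]
    obtain \<Gamma> T where J: "can (g (Ob (Suc 0)) A) = Judg \<Gamma> (IsType T)" "Suc 0 = Suc (length \<Gamma>)"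
      using obj_of_TypeE[OF al(2,4)] .
    then have "canonical (\<psi> (gen_judgement X (Ob (Suc 0)) A))"
      using al(1) by (auto simp: alpha_eq_def canonical_def degree_def)
    then show ?case using canonical_unique[OF Y D al(2,1,3)] by simp
  next
    case (Suc n A)
    let ?m = "Suc (Suc n)" and ?J = "gen_judgement X (Ob (Suc (Suc n))) A"
    have o: "Ob ?m \<in> objects" by simp
    note al = alpha[OF o Suc(2)]
    have bd: "bd X (Ob ?m) A \<in> el X (Ob (Suc n))" using is_presheafD(1)[OF X _ Suc(2)] by simp
    obtain \<Gamma> T where J: "can (g (Ob ?m) A) = Judg \<Gamma> (IsType T)" "?m = Suc (length \<Gamma>)"
      using obj_of_TypeE[OF al(2,4)] .
    obtain \<tau> where \<tau>: "bij \<tau>" "\<psi> ?J = perm_judgement \<tau> (can (g (Ob ?m) A))"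
      using al(1) by (auto simp: alpha_eq_def)
    obtain \<Gamma>' x' S' T' where \<psi>J: "\<psi> ?J = Judg (\<Gamma>' @ [(x', S')]) (IsType T')"
      using J \<tau> by (cases \<Gamma> rule: rev_cases) auto
    have "boundary (\<psi> ?J) = [can (g (Ob (Suc n)) (bd X (Ob ?m) A))]"
      using bdy[OF o Suc(2)] Suc(1)[OF bd] by (simp add: gen_boundary del: gen_judgement.simps boundary.simps)
    then have "can (g (Ob (Suc n)) (bd X (Ob ?m) A)) = Judg \<Gamma>' (IsType S')" using \<psi>J by simp
    then have \<Gamma>': "map fst \<Gamma>' = [1..<Suc n]"
      using alpha(3)[OF _ bd] alpha(4)[OF _ bd] by (simp add: canonical_def degree_def)
    have dist: "x' \<notin> set [1..<Suc n]"
    proof -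
      have "fderiv D Y (\<psi> ?J)" using alpha_eq_fderiv[OF al(1,2)] .
      then have "x' \<notin> set (map fst \<Gamma>')" using fderiv_distinct \<psi>J by fastforce
      then show ?thesis using \<Gamma>' by metis
    qed
    have "x' = Suc n"
    proof (rule ccontr)
      assume x': "x' \<noteq> Suc n"
      \<comment> \<open>A variable that occurs neither in the generating judgement nor as \<open>x'\<close>.\<close>
      define z where "z = Suc (Suc n) + x'"
      define \<sigma> where "\<sigma> = transpose x' z"
      have "jvars ?J = set [1..<?m]"
        using fderiv_jvars[OF X D fderiv.gen[OF o Suc(2)]] canonical_gen[OF o, of X A]
        by (metis (no_types) canonical_def degree_def gen_judgement.simps(1) judgement.sel(1) length_map length_upt list.set_map map_fst_gen_ctx)
      then have jv: "v \<noteq> x' \<and> v \<noteq> z" if "v \<in> jvars ?J" for v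
        using that x' dist by (auto simp: z_def simp del: upt_Suc)
      have "perm_judgement \<sigma> ?J = ?J"
      proof (rule perm_judgement_fixed)
        fix v assume "v \<in> jvars ?J"
        then show "\<sigma> v = v" unfolding \<sigma>_def using jv[of v] by (intro transpose_apply_other) blast+
      qed
      moreover have "\<psi> (perm_judgement \<sigma> ?J) = perm_judgement \<sigma> (\<psi> ?J)"
        by (rule interpretation_perm[OF \<psi> gen_derived[OF X o Suc(2)]]) (simp add: \<sigma>_def)
      ultimately have "perm_judgement \<sigma> (\<psi> ?J) = \<psi> ?J" by metis
      then have "\<sigma> x' = x'" unfolding \<psi>J by simp
      then show False by (simp add: \<sigma>_def z_def)
    qed
    moreover have "length \<Gamma>' = n" using arg_cong[OF \<Gamma>', of length] by simp
    ultimately have "canonical (\<psi> ?J)" unfolding \<psi>J using \<Gamma>' by (simp add: canonical_def degree_def)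
    then show ?case using canonical_unique[OF Y D al(2,1,3)] by simp
  qed
  show ?thesis
  proof (cases ob)
    case (Ob n)
    then obtain m where "n = Suc m" using ob by (cases n) auto
    then show ?thesis using ty[of A m] A Ob by simp
  next
    case (ObT n)
    then obtain m where n: "n = Suc m" using ob by (cases n) auto
    note al = alpha[OF ob A]
    have bd: "bd X (ObT n) A \<in> el X (Ob n)" using is_presheafD(2)[OF X, of n A] A ObT n by simp
    obtain \<Gamma> t T where J: "can (g ob A) = Judg \<Gamma> (HasType t T)" "n = Suc (length \<Gamma>)"
      using obj_of_TermE[OF al(2), of n] al(4) ObT by metis
    then obtain \<Gamma>' t' T' where \<psi>J: "\<psi> (gen_judgement X ob A) = Judg \<Gamma>' (HasType t' T')"
      using al(1) by (auto simp: alpha_eq_def)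
    have "[Judg \<Gamma>' (IsType T')] = [can (g (Ob n) (bd X (ObT n) A))]"
      using bdy[OF ob A] \<psi>J ty[of _ m] bd n ObT by (simp add: gen_boundary del: gen_judgement.simps)
    then have "canonical (Judg \<Gamma>' (IsType T'))" using alpha(3)[OF _ bd] n by simp
    then have "canonical (\<psi> (gen_judgement X ob A))" using \<psi>J by (simp add: canonical_def degree_def)
    then show ?thesis using canonical_unique[OF Y D al(2,1,3)] by simp
  qed
qed

text \<open>Away from the generating judgements, an interpretation is determined by the preservation of
  deduction.\<close>

lemma interpretation_unique:
  assumes X: "is_presheaf X" and Y: "is_presheaf Y" and D: "structural_ok D"
    and g: "presheaf_map X (M_obj D Y) g" and \<psi>: "interpretation_of D (G_obj X) (G_obj Y) \<psi>"
    and \<psi>g: "\<And>ob A. ob \<in> objects \<Longrightarrow> A \<in> el X ob \<Longrightarrow> cls D (G_obj Y) (\<psi> (gen_judgement X ob A)) = g ob A"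
    and J: "derived D (G_obj X) J"
  shows "\<psi> J = jmap (expand (bodies g)) J"
  using J
proof (induct rule: derived.induct)
  case (by_rule r Js J)
  then have "map \<psi> Js = map (jmap (expand (bodies g))) Js" by simp
  then have inf: "infers r (map \<psi> Js) (jmap (expand (bodies g)) J)"
    using infers_jmap[OF by_rule(2), of "bodies g"] by (simp only:)
  have "\<forall>I \<in> set Js. derived D (G_obj X) I" using by_rule(3) by blast
  with \<psi> by_rule(1,2) inf show ?case unfolding interpretation_of_def by metis
next
  case (by_basic J)
  then obtain ob A where *: "J = gen_judgement X ob A" "ob \<in> objects" "A \<in> el X ob" by (auto simp: G_obj_def)
  then show ?case using interpretation_gen[OF X Y D g \<psi> \<psi>g] expand_bodies_gen[OF X Y D g] by simp
qed

text \<open>The choices of an interpretation and of representatives in the definitions of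
  \<open>transpose_of\<close> and \<open>V_map\<close> do not affect classes: on these, the interpretation
  corresponding to \<open>g\<close> acts by expansion.\<close>

theorem V_map_transpose:
  assumes X: "is_presheaf X" and Y: "is_presheaf Y" and D: "structural_ok D"
    and g: "presheaf_map X (M_obj D Y) g" and J: "fderiv D X J"
  shows "fderiv D Y (jmap (expand (bodies g)) J)"
    and "V_map D (G_obj Y) (transpose_of D X (G_obj Y) g) ob (cls D (G_obj X) J)
      = cls D (G_obj Y) (jmap (expand (bodies g)) J)"
proof -
  note int = expand_interpretation[OF X Y D g]
  show fd: "fderiv D Y (jmap (expand (bodies g)) J)"
  proof -
    have "derived D (G_obj Y) (jmap (expand (bodies g)) J)"
      using int fderiv_imp_derived[OF X J] unfolding interpretation_of_def by blast
    then show ?thesis using derived_kind_iff[OF Y] fderiv_kind[OF J] by (metis is_term_jmap is_type_jmap)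
  qed
  let ?P = "\<lambda>\<phi>. interpretation_of D (G_obj X) (G_obj Y) \<phi> \<and>
     (\<forall>ob \<in> objects. \<forall>A \<in> el X ob. cls D (G_obj Y) (\<phi> (gen_judgement X ob A)) = g ob A)"
  have "?P (jmap (expand (bodies g)))"
    using int expand_bodies_gen[OF X Y D g] el_canE(4)[OF Y D presheaf_mapD(1)[OF g]] by auto
  then have P: "?P (transpose_of D X (G_obj Y) g)" unfolding transpose_of_def by (rule someI[of ?P])
  let ?r = "rep (cls D (G_obj X) J)"
  have al: "alpha_eq J ?r" by (rule rep_alpha[OF X D J])
  then have "derived D (G_obj X) ?r" using fderiv_imp_derived[OF X alpha_eq_fderiv[OF _ J]] by blast
  then have "transpose_of D X (G_obj Y) g ?r = jmap (expand (bodies g)) ?r"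
    using interpretation_unique[OF X Y D g] P by blast
  then show "V_map D (G_obj Y) (transpose_of D X (G_obj Y) g) ob (cls D (G_obj X) J)
      = cls D (G_obj Y) (jmap (expand (bodies g)) J)"
    using cls_eqI[OF Y D fd alpha_eq_jmap[OF al]] by (simp add: V_map_def)
qed

section \<open>Composites of expansions\<close>

definition arity :: "'a fsym \<Rightarrow> nat" where
  "arity c = (case c of Inl (n, A) \<Rightarrow> n | Inr (n, a) \<Rightarrow> n)"

definition sig :: "'a presheaf \<Rightarrow> 'a fsym \<Rightarrow> bool" where
  "sig X c \<longleftrightarrow> arity c \<ge> 1 \<and> (case c of Inl (n, A) \<Rightarrow> A \<in> el X (Ob n) | Inr (n, a) \<Rightarrow> a \<in> el X (ObT n))"

lemma arity_simps [simp]: "arity (Inl (n, A)) = n" "arity (Inr (n, a)) = n"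
  by (auto simp: arity_def)

lemma sig_simps [simp]:
  "sig X (Inl (n, A)) \<longleftrightarrow> n \<ge> 1 \<and> A \<in> el X (Ob n)" "sig X (Inr (n, a)) \<longleftrightarrow> n \<ge> 1 \<and> a \<in> el X (ObT n)"
  by (auto simp: sig_def)

lemma sig_cases:
  assumes "sig X c"
  obtains n A where "c = Inl (n, A)" "n \<ge> 1" "A \<in> el X (Ob n)"
    | n a where "c = Inr (n, a)" "n \<ge> 1" "a \<in> el X (ObT n)"
  using assms by (cases c) (auto simp: sig_def)

primrec wf_expr :: "'a presheaf \<Rightarrow> 'a fsym expr \<Rightarrow> bool" where
  "wf_expr X (V x) \<longleftrightarrow> True"
| "wf_expr X (App c es) \<longleftrightarrow> sig X c \<and> arity c = Suc (length es) \<and> (\<forall>b \<in> set (map (wf_expr X) es). b)"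

lemma wf_esubst: "wf_expr X e \<Longrightarrow> (\<And>x. x \<in> fv e \<Longrightarrow> wf_expr X (\<theta> x)) \<Longrightarrow> wf_expr X (esubst \<theta> e)"
  by (induct e) auto

lemma wf_ren: "wf_expr X e \<Longrightarrow> wf_expr X (ren \<sigma> e)"
  unfolding ren_def by (rule wf_esubst) auto

lemma wf_sub1: "wf_expr X e \<Longrightarrow> wf_expr X t \<Longrightarrow> wf_expr X (sub1 t y e)"
  unfolding sub1_def by (rule wf_esubst) auto

lemma wf_syms: "wf_expr X e \<Longrightarrow> c \<in> syms e \<Longrightarrow> sig X c"
  by (induct e) auto

lemma wf_gen_type: "n \<ge> 1 \<Longrightarrow> A \<in> el X (Ob n) \<Longrightarrow> wf_expr X (gen_type n A)"
  by (auto simp: gen_type_def gen_vars_def)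

lemma wf_gen_term: "n \<ge> 1 \<Longrightarrow> A \<in> el X (ObT n) \<Longrightarrow> wf_expr X (App (Inr (n, A)) (gen_vars n))"
  by (auto simp: gen_vars_def)

lemma exprs_of_Judg: "exprs_of (Judg \<Gamma> R) = snd ` set \<Gamma> \<union> rhs_exprs R"
  by (simp add: exprs_of_def)

lemma fderiv_wf_expr:
  assumes X: "is_presheaf X" and J: "fderiv D X J" and e: "e \<in> exprs_of J"
  shows "wf_expr X e"
  using J e
proof (induct arbitrary: e rule: fderiv.induct)
  case (gen ob A)
  obtain n B where n: "n \<ge> 1" "B \<in> el X (Ob n)" "ob = Ob n \<and> B = A \<or> ob = ObT n \<and> B = bd X (ObT n) A"
    using gen is_presheafD(2)[OF X] by (cases ob) auto
  have ty: "wf_expr X T" if T: "(x, T) \<in> set (gen_ctx X n B) \<or> T = gen_type n B" for x T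
  proof -
    obtain i C where "i \<ge> 1" "C \<in> el X (Ob i)" "T = gen_type i C"
      using gen_types_over[OF X n(1,2) T] by blast
    then show ?thesis by (simp add: wf_gen_type)
  qed
  have ctx: "wf_expr X T" if "T \<in> snd ` set (gen_ctx X n B)" for T
  proof -
    from that obtain x where "(x, T) \<in> set (gen_ctx X n B)" by auto
    then show ?thesis by (intro ty disjI1)
  qed
  have tyB: "wf_expr X (gen_type n B)" using ty by blast
  show ?case
  proof (cases ob)
    case (Ob m)
    then show ?thesis using gen(3) n ctx tyB by (auto simp: exprs_of_Judg)
  next
    case (ObT m)
    then show ?thesis using gen n ctx tyB wf_gen_term[of n A X] by (auto simp: exprs_of_Judg)
  qed
next
  case (perm \<sigma> J)
  have "exprs_of (perm_judgement \<sigma> J) = ren \<sigma> ` exprs_of J"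
  proof (cases J)
    case (Judg \<Gamma> R)
    have "snd ` set (map (\<lambda>(x, T). (\<sigma> x, ren \<sigma> T)) \<Gamma>) = ren \<sigma> ` snd ` set \<Gamma>" by force
    then show ?thesis by (simp add: Judg exprs_of_Judg image_Un)
  qed
  then obtain e0 where "e = ren \<sigma> e0" "e0 \<in> exprs_of J" using perm(4) by auto
  then show ?case using perm(3) wf_ren by metis
next
  case (weaken y \<Gamma> \<Delta> T R)
  then show ?case by (auto simp: exprs_of_Judg image_Un)
next
  case (project y \<Gamma> T)
  then show ?case by (auto simp: exprs_of_Judg)
next
  case (subst \<Gamma> t T y \<Delta> R)
  have "snd ` set (map_ctx (sub1 t y) \<Delta>) = sub1 t y ` snd ` set \<Delta>" by (force simp: map_ctx_def)
  then have e: "e \<in> snd ` set \<Gamma> \<union> sub1 t y ` (snd ` set \<Delta> \<union> rhs_exprs R)"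
    using subst(6) by (simp add: exprs_of_Judg image_Un)
  have wft: "wf_expr X t" using subst(3) by (simp add: exprs_of_Judg)
  have wfe: "wf_expr X e'" if "e' \<in> snd ` set \<Gamma> \<union> (snd ` set \<Delta> \<union> rhs_exprs R)" for e'
    using subst(5) that by (auto simp: exprs_of_Judg image_Un)
  from e show ?case
  proof
    assume "e \<in> snd ` set \<Gamma>"
    then show ?thesis by (intro wfe UnI1)
  next
    assume "e \<in> sub1 t y ` (snd ` set \<Delta> \<union> rhs_exprs R)"
    then obtain e0 where e0: "e = sub1 t y e0" "e0 \<in> snd ` set \<Delta> \<union> rhs_exprs R" by (rule imageE)
    show ?thesis unfolding e0(1) by (rule wf_sub1[OF wfe[OF UnI2[OF e0(2)]] wft])
  qed
qed

lemma jmap_expand_cong: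
  assumes "is_presheaf X" "fderiv D X J" "\<And>c. sig X c \<Longrightarrow> E c = F c"
  shows "jmap (expand E) J = jmap (expand F) J"
  by (rule jmap_cong, rule expand_cong) (use assms fderiv_wf_expr wf_syms in blast)

text \<open>Arities matter for composites: the closed expression that \<open>args\<close> uses for missing
  arguments is itself subject to expansion, so the expressions \<open>F c\<close> must mention only variables
  for which an argument exists.\<close>

lemma expand_expand:
  assumes "wf_expr X e" "\<And>c. sig X c \<Longrightarrow> fv (F c) \<subseteq> {1..<arity c}"
  shows "expand E (expand F e) = expand (\<lambda>c. expand E (F c)) e"
  using assms(1)
proof (induct e)
  case (App c es)
  have IH: "expand E (expand F e) = expand (\<lambda>c. expand E (F c)) e" if "e \<in> set es" for e
    using App that by auto
  have fvc: "fv (expand E (F c)) \<subseteq> {1..length es}"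
    using App(2) assms(2)[of c] fv_expand[of E "F c"] by auto
  have "expand E (args (map (expand F) es) x) = args (map (expand (\<lambda>c. expand E (F c))) es) x"
    if "x \<in> {1..length es}" for x
    using that IH by (auto simp: args_def)
  then show ?case using fvc by (auto simp: expand_esubst intro!: esubst_cong)
qed simp

lemma jmap_expand_expand:
  assumes "is_presheaf X" "fderiv D X J" "\<And>c. sig X c \<Longrightarrow> fv (F c) \<subseteq> {1..<arity c}"
  shows "jmap (expand E) (jmap (expand F) J) = jmap (expand (\<lambda>c. expand E (F c))) J"
  unfolding jmap_jmap
  by (rule jmap_cong) (use expand_expand[OF fderiv_wf_expr[OF assms(1,2)] assms(3)] in simp)

lemma expand_generic:
  assumes "wf_expr X e"
  shows "expand (\<lambda>c. App c (gen_vars (arity c))) e = e"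
  using assms
proof (induct e)
  case (App c es)
  have "map (args (map (expand (\<lambda>c. App c (gen_vars (arity c)))) es)) [1..<arity c] = es"
    using App by (intro nth_equalityI) (auto simp: args_def simp del: upt_Suc)
  then show ?case by (simp add: gen_vars_def comp_def del: upt_Suc)
qed simp

text \<open>The expansion performed by the action of a monad on the map \<open>f\<close> of
  presheaves.\<close>

definition relabel :: "(hobj \<Rightarrow> 'a \<Rightarrow> 'b) \<Rightarrow> 'a fsym \<Rightarrow> 'b fsym expr" where
  "relabel f c = (case c of Inl (n, A) \<Rightarrow> gen_type n (f (Ob n) A)
     | Inr (n, a) \<Rightarrow> App (Inr (n, f (ObT n) a)) (gen_vars n))"

lemma relabel_simps [simp]:
  "relabel f (Inl (n, A)) = gen_type n (f (Ob n) A)"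
  "relabel f (Inr (n, a)) = App (Inr (n, f (ObT n) a)) (gen_vars n)"
  by (auto simp: relabel_def)

lemma fv_relabel: "sig X c \<Longrightarrow> fv (relabel f c) \<subseteq> {1..<arity c}"
  by (cases c) (auto simp: relabel_def gen_type_def gen_vars_def split: prod.splits)

lemma fv_bodies:
  assumes "is_presheaf Y" "structural_ok D" "presheaf_map X (M_obj D Y) g" "sig X c"
  shows "fv (bodies g c) \<subseteq> {1..<arity c}"
proof -
  have *: "fv (rhs_body (rhs_of (can (g ob A)))) \<subseteq> {1..<n}"
    if "ob \<in> objects" "A \<in> el X ob" "ob = Ob n \<or> ob = ObT n" for ob A n
  proof -
    note c = el_canE[OF assms(1,2) presheaf_mapD(1)[OF assms(3) that(1,2)]]
    have "degree (can (g ob A)) = n" using c(3) that(3) by (auto simp: obj_of_def split: if_splits)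
    then show ?thesis using canonical_fv[OF c(1,2) rhs_body_in] by simp
  qed
  from assms(4) show ?thesis
    by (cases rule: sig_cases) (use *[of "Ob _"] *[of "ObT _"] in auto)
qed

section \<open>The monads on classes\<close>

text \<open>An operation on judgements that commutes with boundaries induces a natural transformation on
  classes.\<close>

lemma presheaf_mapI:
  assumes X: "is_presheaf X" and D: "structural_ok D" and Y: "is_presheaf Y" and D': "structural_ok D'"
    and F: "\<And>J. fderiv D X J \<Longrightarrow> F (obj_of J) (cls D (G_obj X) J) = cls D' (G_obj Y) (K J)"
    and K: "\<And>J. fderiv D X J \<Longrightarrow> fderiv D' Y (K J)" "\<And>J. obj_of (K J) = obj_of J"
      "\<And>J. boundary (K J) = map K (boundary J)"
  shows "presheaf_map (M_obj D X) (M_obj D' Y) F"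
proof -
  have bd: "F (Ob n) (bd (M_obj D X) ob c) = bd (M_obj D' Y) ob (F ob c)"
    if c: "c \<in> el (M_obj D X) ob" and ex: "\<exists>J'. boundary (can c) = [J'] \<and> obj_of J' = Ob n" for c ob n
  proof -
    note c = el_canE[OF X D c]
    obtain J' where J': "boundary (can c) = [J']" "obj_of J' = Ob n" using ex by blast
    have "fderiv D X J'" using fderiv_boundary[OF X D c(1)] J' by auto
    then have "F (Ob n) (cls D (G_obj X) J') = cls D' (G_obj Y) (K J')" using F J' by metis
    moreover have "bd (M_obj D X) ob c = cls D (G_obj X) J'"
      using bd_M_obj[OF X D c(1), of ob] c(4) J'(1) by simp
    moreover have "F ob c = cls D' (G_obj Y) (K (can c))" using F[OF c(1)] c by simp
    moreover have "bd (M_obj D' Y) ob (cls D' (G_obj Y) (K (can c))) = cls D' (G_obj Y) (K J')"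
      using bd_M_obj[OF Y D' K(1)[OF c(1)], of ob] J'(1) K(3) by simp
    ultimately show ?thesis by simp
  qed
  show ?thesis unfolding presheaf_map_def
  proof (intro conjI ballI allI impI funcsetI)
    fix ob c assume "c \<in> el (M_obj D X) ob"
    note c = el_canE[OF X D this]
    have "F ob c = cls D' (G_obj Y) (K (can c))" using F[OF c(1)] c by simp
    then show "F ob c \<in> el (M_obj D' Y) ob" using M_obj_cls[OF Y D' K(1)[OF c(1)]] K(2) c(3) by simp
  next
    fix n c assume "(1::nat) \<le> n" "c \<in> el (M_obj D X) (Ob (Suc n))"
    then show "F (Ob n) (bd (M_obj D X) (Ob (Suc n)) c) = bd (M_obj D' Y) (Ob (Suc n)) (F (Ob (Suc n)) c)"
      using bd boundary_Ob[OF el_canE(1,3)[OF X D]] by metis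
  next
    fix n c assume "(1::nat) \<le> n" "c \<in> el (M_obj D X) (ObT n)"
    then show "F (Ob n) (bd (M_obj D X) (ObT n) c) = bd (M_obj D' Y) (ObT n) (F (ObT n) c)"
      using bd boundary_ObT[OF el_canE(1,3)[OF X D]] by metis
  qed
qed

lemma presheaf_map_id: "is_presheaf X \<Longrightarrow> presheaf_map X X (\<lambda>ob c. c)"
  by (auto simp: presheaf_map_def)

lemma presheaf_map_comp:
  assumes X: "is_presheaf X" and f: "presheaf_map X Y f" and g: "presheaf_map Y Z g"
  shows "presheaf_map X Z (\<lambda>ob A. g ob (f ob A))"
  unfolding presheaf_map_def
proof (intro conjI ballI allI impI funcsetI)
  fix ob A assume "ob \<in> objects" "A \<in> el X ob"
  then show "g ob (f ob A) \<in> el Z ob" using presheaf_mapD(1)[OF f] presheaf_mapD(1)[OF g] by blast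
next
  fix n A assume n: "(1::nat) \<le> n" "A \<in> el X (Ob (Suc n))"
  then have "f (Ob (Suc n)) A \<in> el Y (Ob (Suc n))" using presheaf_mapD(1)[OF f] by simp
  then show "g (Ob n) (f (Ob n) (bd X (Ob (Suc n)) A)) = bd Z (Ob (Suc n)) (g (Ob (Suc n)) (f (Ob (Suc n)) A))"
    using presheaf_mapD(2)[OF f n] presheaf_mapD(2)[OF g n(1)] by simp
next
  fix n A assume n: "(1::nat) \<le> n" "A \<in> el X (ObT n)"
  then have "f (ObT n) A \<in> el Y (ObT n)" using presheaf_mapD(1)[OF f] by simp
  then show "g (Ob n) (f (Ob n) (bd X (ObT n) A)) = bd Z (ObT n) (g (ObT n) (f (ObT n) A))"
    using presheaf_mapD(3)[OF f n] presheaf_mapD(3)[OF g n(1)] by simp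
qed

lemma M_unit_presheaf_map:
  assumes X: "is_presheaf X" and D: "structural_ok D"
  shows "presheaf_map X (M_obj D X) (M_unit D X)"
  unfolding presheaf_map_def
proof (intro conjI ballI allI impI funcsetI)
  fix ob A assume "ob \<in> objects" "A \<in> el X ob"
  then show "M_unit D X ob A \<in> el (M_obj D X) ob"
    using M_obj_cls[OF X D fderiv.gen, of ob A] by (simp add: M_unit_def)
next
  fix n A assume n: "(1::nat) \<le> n" "A \<in> el X (Ob (Suc n))"
  then show "M_unit D X (Ob n) (bd X (Ob (Suc n)) A) = bd (M_obj D X) (Ob (Suc n)) (M_unit D X (Ob (Suc n)) A)"
    using bd_M_obj[OF X D fderiv.gen, of "Ob (Suc n)" A]
    by (simp add: M_unit_def gen_boundary del: gen_judgement.simps boundary.simps)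
next
  fix n A assume n: "(1::nat) \<le> n" "A \<in> el X (ObT n)"
  then show "M_unit D X (Ob n) (bd X (ObT n) A) = bd (M_obj D X) (ObT n) (M_unit D X (ObT n) A)"
    using bd_M_obj[OF X D fderiv.gen, of "ObT n" A]
    by (simp add: M_unit_def gen_boundary del: gen_judgement.simps boundary.simps)
qed

lemma can_M_unit:
  assumes "is_presheaf X" "structural_ok D" "ob \<in> objects" "A \<in> el X ob"
  shows "can (M_unit D X ob A) = gen_judgement X ob A"
  unfolding M_unit_def using assms by (intro can_cls fderiv.gen canonical_gen)

lemma M_map_map:
  assumes X: "is_presheaf X" and Y: "is_presheaf Y" and D: "structural_ok D" and f: "presheaf_map X Y f"
  shows "presheaf_map X (M_obj D Y) (\<lambda>ob A. M_unit D Y ob (f ob A))"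
  by (rule presheaf_map_comp[OF X f M_unit_presheaf_map[OF Y D]])

lemma M_map_cls:
  assumes X: "is_presheaf X" and Y: "is_presheaf Y" and D: "structural_ok D" and f: "presheaf_map X Y f"
    and J: "fderiv D X J"
  shows "fderiv D Y (jmap (expand (relabel f)) J)"
    and "M_map D X Y f ob (cls D (G_obj X) J) = cls D (G_obj Y) (jmap (expand (relabel f)) J)"
proof -
  have "bodies (\<lambda>ob A. M_unit D Y ob (f ob A)) c = relabel f c" if "sig X c" for c
    using that
  proof (cases rule: sig_cases)
    case (1 n A)
    then have "can (M_unit D Y (Ob n) (f (Ob n) A)) = gen_judgement Y (Ob n) (f (Ob n) A)"
      using presheaf_mapD(1)[OF f, of "Ob n" A] by (intro can_M_unit[OF Y D]) auto
    then show ?thesis using 1 by simp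
  next
    case (2 n A)
    then have "can (M_unit D Y (ObT n) (f (ObT n) A)) = gen_judgement Y (ObT n) (f (ObT n) A)"
      using presheaf_mapD(1)[OF f, of "ObT n" A] by (intro can_M_unit[OF Y D]) auto
    then show ?thesis using 2 by simp
  qed
  from jmap_expand_cong[OF X J this] V_map_transpose[OF X Y D M_map_map[OF X Y D f] J]
  show "fderiv D Y (jmap (expand (relabel f)) J)"
    and "M_map D X Y f ob (cls D (G_obj X) J) = cls D (G_obj Y) (jmap (expand (relabel f)) J)"
    by (simp_all add: M_map_def)
qed

lemma M_map_presheaf_map:
  assumes "is_presheaf X" "is_presheaf Y" "structural_ok D" "presheaf_map X Y f"
  shows "presheaf_map (M_obj D X) (M_obj D Y) (M_map D X Y f)"
  using M_map_cls[OF assms] by (intro presheaf_mapI[OF assms(1,3,2,3), where K = "jmap (expand (relabel f))"])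
    (auto simp: boundary_jmap)

lemma M_map_unit:
  assumes X: "is_presheaf X" and Y: "is_presheaf Y" and D: "structural_ok D" and f: "presheaf_map X Y f"
    and ob: "ob \<in> objects" and A: "A \<in> el X ob"
  shows "M_map D X Y f ob (M_unit D X ob A) = M_unit D Y ob (f ob A)"
proof -
  note m = M_map_map[OF X Y D f]
  have "M_map D X Y f ob (M_unit D X ob A) = cls D (G_obj Y) (can (M_unit D Y ob (f ob A)))"
    using V_map_transpose(2)[OF X Y D m fderiv.gen[OF ob A]] expand_bodies_gen[OF X Y D m ob A]
    by (simp add: M_map_def M_unit_def)
  also have "\<dots> = M_unit D Y ob (f ob A)"
    using el_canE(4)[OF Y D presheaf_mapD(1)[OF m ob A]] .
  finally show ?thesis .
qed

abbreviation flatten :: "('c judgement set) fsym judgement \<Rightarrow> 'c judgement" where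
  "flatten \<equiv> jmap (expand (bodies (\<lambda>ob c. c)))"

lemma M_mult_cls:
  assumes X: "is_presheaf X" and D: "structural_ok D" and J: "fderiv D (M_obj D X) J"
  shows "fderiv D X (flatten J)"
    and "M_mult D X ob (cls D (G_obj (M_obj D X)) J) = cls D (G_obj X) (flatten J)"
  using V_map_transpose[OF M_obj_presheaf[OF X D] X D presheaf_map_id[OF M_obj_presheaf[OF X D]] J]
  by (simp_all add: M_mult_def counit_def M_obj_def)

lemma to_T_cls:
  assumes X: "is_presheaf X" and D: "structural_ok D" "D \<subseteq> DT" and J: "fderiv D X J"
  shows "to_T X ob (cls D (G_obj X) J) = cls DT (G_obj X) J"
  unfolding to_T_def using cls_eqI[OF X _ fderiv_mono[OF J D(2)] rep_alpha[OF X D(1) J]] by simp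

lemma to_T_presheaf_map:
  assumes "is_presheaf X" "structural_ok D" "D \<subseteq> DT"
  shows "presheaf_map (M_obj D X) (T_obj X) (to_T X)"
  using to_T_cls[OF assms] fderiv_mono[OF _ assms(3)]
  by (intro presheaf_mapI[OF assms(1,2) assms(1), where K = "\<lambda>J. J"]) auto

lemma can_to_T:
  assumes X: "is_presheaf X" and D: "structural_ok D" "D \<subseteq> DT" and c: "c \<in> el (M_obj D X) ob"
  shows "can (to_T X ob c) = can c"
proof -
  note c = el_canE[OF X D(1) c]
  have "to_T X ob c = cls DT (G_obj X) (can c)" using to_T_cls[OF X D c(1)] c(4) by simp
  then show ?thesis using can_cls[OF X _ fderiv_mono[OF c(1) D(2)] c(2)] by simp
qed

lemma bodies_cong:
  assumes "sig X c" "\<And>ob A. ob \<in> objects \<Longrightarrow> A \<in> el X ob \<Longrightarrow> can (f ob A) = can (g ob A)"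
  shows "bodies f c = bodies g c"
  using assms(1) by (cases rule: sig_cases) (use assms(2)[of "Ob _"] assms(2)[of "ObT _"] in auto)

text \<open>Relabelling constants by classes of judgements and then multiplying amounts to the Kleisli
  extension of \<open>f\<close>.\<close>

lemma flatten_relabel:
  assumes X: "is_presheaf X" and Y: "is_presheaf Y" and D': "structural_ok D'"
    and f: "presheaf_map X (M_obj D' Y) f" and J: "fderiv D X J"
  shows "flatten (jmap (expand (relabel f)) J) = jmap (expand (bodies f)) J"
proof -
  have *: "expand (bodies (\<lambda>ob c. c)) (relabel f c) = bodies f c" if c: "sig X c" for c
  proof -
    have fv: "fv (bodies f c) \<subseteq> {1..<arity c}" by (rule fv_bodies[OF Y D' f c])
    from c show ?thesis
      by (cases rule: sig_cases) (use fv in \<open>auto simp: expand_gen_type expand_gen_term simp del: expand.simps\<close>)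
  qed
  have "flatten (jmap (expand (relabel f)) J) = jmap (expand (\<lambda>c. expand (bodies (\<lambda>ob c. c)) (relabel f c))) J"
    by (rule jmap_expand_expand[OF X J fv_relabel])
  also have "\<dots> = jmap (expand (bodies f)) J" by (rule jmap_expand_cong[OF X J *])
  finally show ?thesis .
qed

lemma flatten_to_T:
  assumes X: "is_presheaf X" and D: "structural_ok D" "D \<subseteq> DT" and J: "fderiv D' (M_obj D X) J"
  shows "flatten (jmap (expand (relabel (to_T X))) J) = flatten J"
proof -
  have *: "bodies (to_T X) c = bodies (\<lambda>ob c. c) c" if "sig (M_obj D X) c" for c
    by (rule bodies_cong[OF that can_to_T[OF X D]])
  then show ?thesis
    using flatten_relabel[OF M_obj_presheaf[OF X D(1)] X _ to_T_presheaf_map[OF X D] J]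
      jmap_expand_cong[OF M_obj_presheaf[OF X D(1)] J *] by simp
qed

text \<open>Passing from a class over the \<open>{s}\<close>-GAT to the class of the same judgement over the
  full GAT does not change the canonical judgement, so the relabelling by \<open>\<sigma>\<close> inside
  \<open>\<kappa>\<close> is invisible after multiplication.\<close>

lemma kappa_cls:
  assumes X: "is_presheaf X" and J: "fderiv DP (S_obj X) J"
  shows "fderiv DT X (flatten J)"
    and "kappa X ob (cls DP (G_obj (S_obj X)) J) = cls DT (G_obj X) (flatten J)"
proof -
  have S: "is_presheaf (S_obj X)" and T: "is_presheaf (T_obj X)" by (rule M_obj_presheaf[OF X], simp)+
  have t: "presheaf_map (S_obj X) (T_obj X) (to_T X)" by (rule to_T_presheaf_map[OF X]) auto
  define J1 where "J1 = jmap (expand (relabel (to_T X))) J"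
  have J1: "fderiv DP (T_obj X) J1" "M_map DP (S_obj X) (T_obj X) (to_T X) ob (cls DP (G_obj (S_obj X)) J) = cls DP (G_obj (T_obj X)) J1"
    using M_map_cls[OF S T _ t J] by (simp_all add: J1_def)
  have "fderiv DT (T_obj X) J1" by (rule fderiv_mono[OF J1(1)]) auto
  from M_mult_cls[OF X _ this] to_T_cls[OF T _ _ J1(1), of ob] J1(2)
  have "fderiv DT X (flatten J1)" "kappa X ob (cls DP (G_obj (S_obj X)) J) = cls DT (G_obj X) (flatten J1)"
    by (simp_all add: kappa_def)
  then show "fderiv DT X (flatten J)" "kappa X ob (cls DP (G_obj (S_obj X)) J) = cls DT (G_obj X) (flatten J)"
    using flatten_to_T[OF X _ _ J] by (simp_all add: J1_def)
qed

lemma kappa_presheaf_map: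
  assumes X: "is_presheaf X"
  shows "presheaf_map (P_obj (S_obj X)) (T_obj X) (kappa X)"
  using kappa_cls[OF X] by (intro presheaf_mapI[OF M_obj_presheaf[OF X] _ X, where K = flatten])
    (auto simp: boundary_jmap)

text \<open>By the unit law, \<open>\<kappa>\<close> extends \<open>\<rho>\<close> along
  \<open>P\<eta>\<^sup>S\<close>.\<close>

lemma kappa_P_unit:
  assumes X: "is_presheaf X" and c: "c \<in> el (P_obj X) ob"
  shows "kappa X ob (M_map DP X (S_obj X) (M_unit DS X) ob c) = to_T X ob c"
proof -
  have S: "is_presheaf (S_obj X)" by (rule M_obj_presheaf[OF X]) simp
  have u: "presheaf_map X (S_obj X) (M_unit DS X)" by (rule M_unit_presheaf_map[OF X]) simp
  note c = el_canE[OF X _ c, simplified]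
  have "bodies (M_unit DS X) s = App s (gen_vars (arity s))" if s: "sig X s" for s
    using s by (cases rule: sig_cases) (use can_M_unit[OF X, of DS "Ob _"] can_M_unit[OF X, of DS "ObT _"] in \<open>auto simp: gen_type_def\<close>)
  then have "jmap (expand (bodies (M_unit DS X))) (can c) = jmap (expand (\<lambda>s. App s (gen_vars (arity s)))) (can c)"
    by (rule jmap_expand_cong[OF X c(1)])
  also have "\<dots> = can c"
    by (rule jmap_id) (rule expand_generic[OF fderiv_wf_expr[OF X c(1)]])
  finally have "flatten (jmap (expand (relabel (M_unit DS X))) (can c)) = can c"
    using flatten_relabel[OF X X _ u c(1)] by simp
  then have "kappa X ob (M_map DP X (S_obj X) (M_unit DS X) ob (cls DP (G_obj X) (can c))) = cls DT (G_obj X) (can c)"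
    using M_map_cls[OF X S _ u c(1)] kappa_cls(2)[OF X] by simp
  then show ?thesis using to_T_cls[OF X _ _ c(1), of ob] c(4) by simp
qed

text \<open>The element \<open>w\<^sub>1\<close> of \<open>SPSX\<close> obtained from \<open>[J]\<close> by
  \<open>SP\<eta>\<^sup>S\<close> is sent by \<open>\<eta>\<^sup>P\<close> to the class of a generating
  judgement, and \<open>PS\<kappa>\<close> turns it into the generating judgement of \<open>w\<^sub>2 =
  S\<kappa>(w\<^sub>1)\<close>. As \<open>\<kappa>\<close> inverts \<open>P\<eta>\<^sup>S\<close> up to the
  inclusion \<open>\<rho>\<close>, the class \<open>w\<^sub>2\<close> is that of \<open>J\<close> with its
  constants read over \<open>TX\<close> instead of \<open>PX\<close>. The remaining \<open>\<kappa>T\<close>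
  and \<open>\<mu>\<^sup>T\<close> first undo the unit and then expand these constants.\<close>

theorem dist_law_cls:
  assumes X: "is_presheaf X" and J: "fderiv DS (P_obj X) J" and ob: "obj_of J = ob"
  shows "dist_law X ob (cls DS (G_obj (P_obj X)) J)
    = the_inv_into (el (P_obj (S_obj X)) ob) (kappa X ob) (cls DT (G_obj X) (flatten J))"
proof -
  have obo: "ob \<in> objects" using ob obj_of_objects by blast
  have PX: "is_presheaf (P_obj X)" and SX: "is_presheaf (S_obj X)" and TX: "is_presheaf (T_obj X)"
    by (rule M_obj_presheaf[OF X], simp)+
  have PSX: "is_presheaf (P_obj (S_obj X))" by (rule M_obj_presheaf[OF SX]) simp
  have SPSX: "is_presheaf (S_obj (P_obj (S_obj X)))" by (rule M_obj_presheaf[OF PSX]) simp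
  have STX: "is_presheaf (S_obj (T_obj X))" by (rule M_obj_presheaf[OF TX]) simp
  define f1 where "f1 = M_map DP X (S_obj X) (M_unit DS X)"
  have f1: "presheaf_map (P_obj X) (P_obj (S_obj X)) f1"
    unfolding f1_def by (intro M_map_presheaf_map X SX M_unit_presheaf_map) auto
  define f2 where "f2 = M_map DS (P_obj (S_obj X)) (T_obj X) (kappa X)"
  have f2: "presheaf_map (S_obj (P_obj (S_obj X))) (S_obj (T_obj X)) f2"
    unfolding f2_def by (intro M_map_presheaf_map PSX TX kappa_presheaf_map X) auto
  define J1 where "J1 = jmap (expand (relabel f1)) J"
  define w1 where "w1 = cls DS (G_obj (P_obj (S_obj X))) J1"
  have J1: "fderiv DS (P_obj (S_obj X)) J1" "M_map DS (P_obj X) (P_obj (S_obj X)) f1 ob (cls DS (G_obj (P_obj X)) J) = w1"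
    using M_map_cls[OF PX PSX _ f1 J] by (simp_all add: J1_def w1_def)
  have w1: "w1 \<in> el (S_obj (P_obj (S_obj X))) ob"
    using M_obj_cls[OF PSX _ J1(1)] ob by (simp add: w1_def J1_def)
  define J2 where "J2 = jmap (expand (relabel (to_T X))) J"
  have t: "presheaf_map (P_obj X) (T_obj X) (to_T X)" by (rule to_T_presheaf_map[OF X]) auto
  have J2: "fderiv DS (T_obj X) J2" using M_map_cls(1)[OF PX TX _ t J] by (simp add: J2_def)
  have J12: "jmap (expand (relabel (kappa X))) J1 = J2"
  proof -
    have *: "expand (relabel (kappa X)) (relabel f1 c) = relabel (to_T X) c" if c: "sig (P_obj X) c" for c
      using c
    proof (cases rule: sig_cases)
      case (1 n A)
      have "fv (relabel (kappa X) (Inl (n, f1 (Ob n) A))) \<subseteq> {1..<n}" by (auto simp: gen_type_def gen_vars_def)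
      then show ?thesis using 1 kappa_P_unit[OF X] by (simp add: expand_gen_type f1_def)
    next
      case (2 n A)
      have "fv (relabel (kappa X) (Inr (n, f1 (ObT n) A))) \<subseteq> {1..<n}" by (auto simp: gen_vars_def)
      then show ?thesis using 2 kappa_P_unit[OF X] by (simp add: expand_gen_term f1_def del: expand.simps)
    qed
    have "jmap (expand (relabel (kappa X))) J1 = jmap (expand (\<lambda>c. expand (relabel (kappa X)) (relabel f1 c))) J"
      unfolding J1_def by (rule jmap_expand_expand[OF PX J fv_relabel])
    also have "\<dots> = J2" unfolding J2_def by (rule jmap_expand_cong[OF PX J *])
    finally show ?thesis .
  qed
  define w2 where "w2 = cls DS (G_obj (T_obj X)) J2"
  have w12: "f2 ob w1 = w2"
    using M_map_cls(2)[OF PSX TX _ kappa_presheaf_map[OF X] J1(1)] J12 by (simp add: f2_def w1_def w2_def)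
  have w2: "w2 \<in> el (S_obj (T_obj X)) ob"
    using M_obj_cls[OF TX _ J2] ob by (simp add: w2_def J2_def)
  have "M_map DP (S_obj (P_obj (S_obj X))) (S_obj (T_obj X)) f2 ob (M_unit DP (S_obj (P_obj (S_obj X))) ob w1)
      = cls DP (G_obj (S_obj (T_obj X))) (gen_judgement (S_obj (T_obj X)) ob w2)"
    using M_map_unit[OF SPSX STX _ f2 obo w1] w12 by (simp add: M_unit_def)
  moreover have "kappa (T_obj X) ob (cls DP (G_obj (S_obj (T_obj X))) (gen_judgement (S_obj (T_obj X)) ob w2))
      = cls DT (G_obj (T_obj X)) J2"
  proof -
    have "flatten (gen_judgement (S_obj (T_obj X)) ob w2) = can w2"
      using expand_bodies_gen[OF STX TX _ presheaf_map_id[OF STX] obo w2] by simp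
    moreover have "cls DT (G_obj (T_obj X)) (can w2) = to_T (T_obj X) ob w2"
      using to_T_cls[OF TX _ _ el_canE(1)[OF TX _ w2], of ob] el_canE(4)[OF TX _ w2] by simp
    moreover have "\<dots> = cls DT (G_obj (T_obj X)) J2"
      using to_T_cls[OF TX _ _ J2, of ob] by (simp add: w2_def)
    ultimately show ?thesis using kappa_cls(2)[OF TX fderiv.gen[OF obo w2]] by simp
  qed
  moreover have "M_mult DT X ob (cls DT (G_obj (T_obj X)) J2) = cls DT (G_obj X) (flatten J)"
  proof -
    have "fderiv DT (T_obj X) J2" by (rule fderiv_mono[OF J2]) auto
    then show ?thesis using M_mult_cls(2)[OF X] flatten_to_T[OF X _ _ J] by (simp add: J2_def)
  qed
  ultimately show ?thesis
    using J1(2) by (simp add: dist_law_def PS_mult_def f1_def f2_def)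
qed

section \<open>Injectivity of \<open>\<kappa>\<close>\<close>

text \<open>The invariant of types derivable without substitution: a constant of degree \<open>r\<close> is
  applied to variables, and the last of these has in the context the type given by the boundary of the
  constant and the other variables.\<close>

definition P_shape :: "'a presheaf \<Rightarrow> 'a fsym ctx \<Rightarrow> nat \<Rightarrow> 'a \<Rightarrow> nat list \<Rightarrow> bool" where
  "P_shape X \<Gamma> r A vs \<longleftrightarrow> r = Suc (length vs) \<and> A \<in> el X (Ob r) \<and>
     (vs \<noteq> [] \<longrightarrow> (last vs, App (Inl (r - 1, bd X (Ob r) A)) (map V (butlast vs))) \<in> set \<Gamma>)"

fun P_shaped :: "'a presheaf \<Rightarrow> 'a fsym judgement \<Rightarrow> bool" where
  "P_shaped X (Judg \<Gamma> (IsType T)) \<longleftrightarrow> (\<exists>r A vs. T = App (Inl (r, A)) (map V vs) \<and> P_shape X \<Gamma> r A vs)"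
| "P_shaped X (Judg \<Gamma> (HasType t T)) \<longleftrightarrow> (\<exists>x. t = V x \<and> (x, T) \<in> set \<Gamma>) \<or>
     (\<exists>r a vs. t = App (Inr (r, a)) (map V vs) \<and> T = App (Inl (r, bd X (ObT r) a)) (map V vs) \<and>
        r = Suc (length vs) \<and> a \<in> el X (ObT r))"
| "P_shaped X J \<longleftrightarrow> True"

lemma ren_App_vars: "ren \<sigma> (App c (map V vs)) = App c (map V (map \<sigma> vs))"
  by (simp add: ren_def)

lemma P_shape_mono: "P_shape X \<Gamma> r A vs \<Longrightarrow> set \<Gamma> \<subseteq> set \<Delta> \<Longrightarrow> P_shape X \<Delta> r A vs"
  by (auto simp: P_shape_def)

lemma P_shape_last:
  "P_shape X \<Gamma> r A vs \<Longrightarrow> vs \<noteq> [] \<Longrightarrow> (last vs, App (Inl (r - 1, bd X (Ob r) A)) (map V (butlast vs))) \<in> set \<Gamma>"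
  unfolding P_shape_def by blast

lemma fderiv_P_shaped:
  assumes X: "is_presheaf X" and J: "fderiv DP X J"
  shows "P_shaped X J"
  using J
proof (induct rule: fderiv.induct)
  case (gen ob A)
  show ?case
  proof (cases ob)
    case (Ob n)
    then obtain m where n: "n = Suc m" using gen by (cases n) auto
    have "P_shape X (gen_ctx X n A) n A [1..<n]"
    proof (cases "m = 0")
      case True
      then show ?thesis using Ob n gen by (simp add: P_shape_def)
    next
      case False
      then have "m \<ge> 1" by simp
      then show ?thesis using Ob n gen
        by (simp add: P_shape_def gen_ctx_Suc[OF \<open>m \<ge> 1\<close>] gen_type_def gen_vars_def)
    qed
    then show ?thesis using Ob by (auto simp: gen_type_def gen_vars_def)
  next
    case (ObT n)
    have "gen_type n (bd X (ObT n) A) = App (Inl (n, bd X (ObT n) A)) (map V [1..<n])"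
      by (simp add: gen_type_def gen_vars_def)
    moreover have "n = Suc (length [1..<n])" using gen(1) ObT by auto
    moreover have "A \<in> el X (ObT n)" using gen(2) ObT by simp
    ultimately show ?thesis unfolding ObT gen_judgement.simps P_shaped.simps gen_vars_def
      by blast
  qed
next
  case (perm \<sigma> J)
  obtain \<Gamma> R where J: "J = Judg \<Gamma> R" by (cases J)
  let ?\<Delta> = "map (\<lambda>(x, T). (\<sigma> x, ren \<sigma> T)) \<Gamma>"
  have mem: "(\<sigma> x, ren \<sigma> T) \<in> set ?\<Delta>" if "(x, T) \<in> set \<Gamma>" for x T using that by force
  have shape: "P_shape X ?\<Delta> r A (map \<sigma> vs)" if "P_shape X \<Gamma> r A vs" for r A vs
  proof (cases "vs = []")
    case False
    then have "(last vs, App (Inl (r - 1, bd X (Ob r) A)) (map V (butlast vs))) \<in> set \<Gamma>"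
      using that False unfolding P_shape_def by blast
    from mem[OF this] have "(last (map \<sigma> vs), App (Inl (r - 1, bd X (Ob r) A)) (map V (butlast (map \<sigma> vs)))) \<in> set ?\<Delta>"
      unfolding ren_App_vars using False by (simp add: last_map map_butlast del: set_map)
    then show ?thesis using that unfolding P_shape_def length_map by blast
  qed (use that in \<open>auto simp: P_shape_def\<close>)
  from fderiv_no_eq[of DP X \<Gamma> R] perm(2) J consider (ty) T where "R = IsType T" | (tm) t T where "R = HasType t T" by auto
  then show ?case
  proof cases
    case ty
    then obtain r A vs where "T = App (Inl (r, A)) (map V vs)" "P_shape X \<Gamma> r A vs" using perm(3) J by auto
    then show ?thesis using shape[of r A vs] ren_App_vars[of \<sigma> "Inl (r, A)" vs]
      unfolding J ty perm_judgement_simps map_rhs_expr.simps P_shaped.simps by metis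
  next
    case tm
    then consider (v) x where "t = V x" "(x, T) \<in> set \<Gamma>"
      | (a) r a vs where "t = App (Inr (r, a)) (map V vs)" "T = App (Inl (r, bd X (ObT r) a)) (map V vs)"
         "r = Suc (length vs)" "a \<in> el X (ObT r)"
      using perm(3) J by auto
    then show ?thesis
    proof cases
      case v
      then have "ren \<sigma> t = V (\<sigma> x) \<and> (\<sigma> x, ren \<sigma> T) \<in> set ?\<Delta>" using mem by (simp add: ren_def)
      then show ?thesis unfolding J tm perm_judgement_simps map_rhs_expr.simps P_shaped.simps by blast
    next
      case a
      then have "ren \<sigma> t = App (Inr (r, a)) (map V (map \<sigma> vs)) \<and>
          ren \<sigma> T = App (Inl (r, bd X (ObT r) a)) (map V (map \<sigma> vs)) \<and> r = Suc (length (map \<sigma> vs)) \<and> a \<in> el X (ObT r)"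
        by (simp add: ren_App_vars del: map_map)
      then show ?thesis unfolding J tm perm_judgement_simps map_rhs_expr.simps P_shaped.simps by blast
    qed
  qed
next
  case (weaken y \<Gamma> \<Delta> T R)
  have sub: "set (\<Gamma> @ \<Delta>) \<subseteq> set (\<Gamma> @ (y, T) # \<Delta>)" by auto
  from fderiv_no_eq[OF weaken(5)] weaken(6) P_shape_mono[OF _ sub] sub show ?case
    by (elim disjE exE) (simp only: P_shaped.simps, blast)+
next
  case (project y \<Gamma> T)
  then show ?case by auto
qed simp

lemma canonical_prefix:
  assumes "canonical (Judg (\<Gamma> @ (x, T) # \<Delta>) R)"
  shows "x = Suc (length \<Gamma>)" "canonical (Judg \<Gamma> (IsType T))"
proof -
  have eq: "map fst \<Gamma> @ x # map fst \<Delta> = [1..<Suc (Suc (length \<Gamma> + length \<Delta>))]"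
    using assms by (simp add: canonical_def degree_def del: upt_Suc)
  have "(map fst \<Gamma> @ x # map fst \<Delta>) ! length \<Gamma> = [1..<Suc (Suc (length \<Gamma> + length \<Delta>))] ! length \<Gamma>"
    by (simp only: eq)
  then show "x = Suc (length \<Gamma>)" by (simp add: nth_append del: upt_Suc)
  have "take (length \<Gamma>) (map fst \<Gamma> @ x # map fst \<Delta>) = take (length \<Gamma>) [1..<Suc (Suc (length \<Gamma> + length \<Delta>))]"
    by (simp only: eq)
  then show "canonical (Judg \<Gamma> (IsType T))" by (simp add: canonical_def degree_def take_upt del: upt_Suc)
qed

lemma canonical_dom: "canonical (Judg \<Gamma> R) \<Longrightarrow> fst ` set \<Gamma> = {1..<Suc (length \<Gamma>)}"
  unfolding canonical_def degree_def by (metis judgement.sel(1) list.set_map set_upt)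

lemma map_V_eq: "map V vs = map V ws \<longleftrightarrow> vs = ws"
  by (rule inj_map_eq_map) (simp add: inj_def)

lemma P_shapedD:
  assumes "P_shaped X (Judg \<Gamma> (IsType (App (Inl (r, A)) (map V vs))))"
  shows "P_shape X \<Gamma> r A vs"
  using assms by (auto simp: map_V_eq)

text \<open>The last argument is a context variable whose type has the remaining arguments, and these have
  been declared before it.\<close>

lemma P_type_vars_increasing:
  fixes X :: "'a presheaf"
  assumes X: "is_presheaf X"
  shows "\<lbrakk>fderiv DP X (Judg \<Gamma> (IsType (App (Inl (r, A)) (map V vs)))); canonical (Judg \<Gamma> (IsType (App (Inl (r, A)) (map V vs))))\<rbrakk>
    \<Longrightarrow> sorted_wrt (<) vs"
proof (induct vs arbitrary: \<Gamma> r A rule: rev_induct)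
  case (snoc x vs)
  have sh: "P_shape X \<Gamma> r A (vs @ [x])" by (rule P_shapedD[OF fderiv_P_shaped[OF X snoc(2)]])
  define T :: "'a fsym expr" where "T = App (Inl (r - 1, bd X (Ob r) A)) (map V vs)"
  have "(x, T) \<in> set \<Gamma>" using P_shape_last[OF sh] by (simp add: T_def)
  then obtain \<Gamma>1 \<Gamma>2 where G: "\<Gamma> = \<Gamma>1 @ (x, T) # \<Gamma>2" by (meson split_list)
  have d: "fderiv DP X (Judg \<Gamma>1 (IsType T))" using fderiv_prefix[OF X _ snoc(2)[unfolded G]] by simp
  note c = canonical_prefix[OF snoc(3)[unfolded G]]
  have "sorted_wrt (<) vs" using snoc(1) d c(2) unfolding T_def by blast
  moreover have "set vs \<subseteq> {1..<x}"
    using fderiv_fv[OF d, of T] canonical_dom[OF c(2)] c(1) by (simp add: T_def)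
  ultimately show ?case by (auto simp: sorted_wrt_append)
qed simp

text \<open>The invariant of judgements derivable without weakening and projection: the type mentions all
  context variables, and terms are not variables. Substituting \<open>t\<close> for \<open>y\<close> keeps
  this, because \<open>t\<close> only mentions variables to the left of \<open>y\<close>.\<close>

fun S_shaped :: "'c judgement \<Rightarrow> bool" where
  "S_shaped (Judg \<Gamma> (IsType T)) \<longleftrightarrow> fv T = fst ` set \<Gamma>"
| "S_shaped (Judg \<Gamma> (HasType t T)) \<longleftrightarrow> fv T = fst ` set \<Gamma> \<and> (\<exists>c es. t = App c es)"
| "S_shaped J \<longleftrightarrow> True"

lemma dom_map_ctx: "fst ` set (map_ctx f \<Gamma>) = fst ` set \<Gamma>"
  by (metis list.set_map map_fst_map_ctx)

lemma fderiv_S_shaped: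
  assumes J: "fderiv DS X J"
  shows "S_shaped J"
  using J
proof (induct rule: fderiv.induct)
  case (gen ob A)
  have "fst ` set (gen_ctx X n B) = {1..<n}" for n B by (metis list.set_map map_fst_gen_ctx set_upt)
  moreover have "fv (gen_type n B) = {1..<n}" for n and B :: 'a by (auto simp: gen_type_def gen_vars_def)
  ultimately show ?case by (cases ob) auto
next
  case (perm \<sigma> J)
  have dom: "fst ` set (map (\<lambda>(x, T). (\<sigma> x, ren \<sigma> T)) \<Gamma>) = \<sigma> ` fst ` set \<Gamma>" for \<Gamma> by force
  obtain \<Gamma> R where J: "J = Judg \<Gamma> R" by (cases J)
  from fderiv_no_eq[of DS X \<Gamma> R] perm(2) J consider (ty) T where "R = IsType T" | (tm) t T where "R = HasType t T" by auto
  then show ?case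
    by cases (use perm(3) J in \<open>auto simp only: dom perm_judgement_simps map_rhs_expr.simps S_shaped.simps fv_ren\<close>, auto simp: ren_def)
next
  case (subst \<Gamma> t T y \<Delta> R)
  have y: "y \<notin> fst ` set \<Gamma>" "y \<notin> fst ` set \<Delta>" using fderiv_distinct[OF subst(4)] by auto
  have fvt: "fv t \<subseteq> fst ` set \<Gamma>" using fderiv_fv[OF subst(2), of t] by simp
  have ty: "fv (sub1 t y S) = fst ` set (\<Gamma> @ map_ctx (sub1 t y) \<Delta>)" if "fv S = fst ` set (\<Gamma> @ (y, T) # \<Delta>)" for S
  proof -
    have "fv (sub1 t y S) = (fv S - {y}) \<union> fv t" using that by (intro fv_sub1_occurs) simp
    then show ?thesis using that y fvt by (auto simp only: set_append image_Un dom_map_ctx list.set image_insert fst_conv)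
  qed
  from fderiv_no_eq[OF subst(4)] consider (ty) S where "R = IsType S" | (tm) s S where "R = HasType s S" by auto
  then show ?case
  proof cases
    case ty
    then show ?thesis using subst(5) \<open>\<And>S. fv S = _ \<Longrightarrow> _\<close>[of S] by (simp only: S_shaped.simps map_rhs_expr.simps)
  next
    case tm
    then show ?thesis using subst(5) \<open>\<And>S. fv S = _ \<Longrightarrow> _\<close>[of S]
      by (auto simp only: S_shaped.simps map_rhs_expr.simps) (auto simp: sub1_def)
  qed
qed simp_all

lemma expand_App_vars:
  assumes "fv (E c) \<subseteq> {1..<Suc (length vs)}"
  shows "expand E (App c (map V vs)) = ren (\<lambda>i. vs ! (i - 1)) (E c)"
  unfolding ren_def expand.simps
  by (rule esubst_cong) (use assms in \<open>force simp: args_def\<close>)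

lemma increasing_list_unique:
  fixes vs ws :: "nat list"
  assumes "sorted_wrt (<) vs" "sorted_wrt (<) ws" "set vs = set ws"
  shows "vs = ws"
  using assms strict_sorted_equal by blast

lemma inj_nth: "sorted_wrt (<) (vs :: nat list) \<Longrightarrow> inj_on (\<lambda>i. vs ! (i - 1)) {1..<Suc (length vs)}"
proof -
  assume "sorted_wrt (<) vs"
  then have "distinct vs" by (metis strict_sorted_iff)
  then show ?thesis by (auto simp: inj_on_def nth_eq_iff_index_eq)
qed

text \<open>By induction, the contexts coincide. The expansion of a type has as free variables exactly the
  arguments of its constant, because the body of the constant mentions all its variables; as arguments come in
  increasing order, they are determined. Renaming back gives the body of the constant, and the type of the
  last argument gives its boundary.\<close>

lemma flatten_inj_types:
  assumes X: "is_presheaf X"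
  shows "\<lbrakk>fderiv DP (S_obj X) (Judg \<Gamma>1 (IsType T1)); fderiv DP (S_obj X) (Judg \<Gamma>2 (IsType T2));
     canonical (Judg \<Gamma>1 (IsType T1)); canonical (Judg \<Gamma>2 (IsType T2));
     flatten (Judg \<Gamma>1 (IsType T1)) = flatten (Judg \<Gamma>2 (IsType T2))\<rbrakk>
   \<Longrightarrow> \<Gamma>1 = \<Gamma>2 \<and> T1 = T2"
proof (induct \<Gamma>1 arbitrary: T1 \<Gamma>2 T2 rule: rev_induct)
  have SX: "is_presheaf (S_obj X)" by (rule M_obj_presheaf[OF X]) simp
  let ?F = "expand (bodies (\<lambda>ob c. c)) :: 'a fsym judgement set fsym expr \<Rightarrow> 'a fsym expr"
  \<comment> \<open>The comparison of the types over a context already known to be common to both judgements.\<close>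
  have main: "T1 = T2" if d: "fderiv DP (S_obj X) (Judg \<Gamma> (IsType T1))" "fderiv DP (S_obj X) (Judg \<Gamma> (IsType T2))"
    and can: "canonical (Judg \<Gamma> (IsType T1))" "canonical (Judg \<Gamma> (IsType T2))" and eq: "?F T1 = ?F T2" for \<Gamma> T1 T2
  proof -
    obtain r1 c1 vs1 r2 c2 vs2 where T: "T1 = App (Inl (r1, c1)) (map V vs1)" "P_shape (S_obj X) \<Gamma> r1 c1 vs1"
        "T2 = App (Inl (r2, c2)) (map V vs2)" "P_shape (S_obj X) \<Gamma> r2 c2 vs2"
      using fderiv_P_shaped[OF SX d(1)] fderiv_P_shaped[OF SX d(2)] by auto
    have inc: "sorted_wrt (<) vs1" "sorted_wrt (<) vs2"
      using P_type_vars_increasing[OF SX] d can T by blast+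
    have *: "fderiv DS X (can c) \<and> canonical (can c) \<and> is_type_judgement (can c) \<and> obj_of (can c) = Ob r \<and>
        cls DS (G_obj X) (can c) = c \<and> fv (rhs_body (rhs_of (can c))) = {1..<Suc (length vs)} \<and>
        ?F (App (Inl (r, c)) (map V vs)) = ren (\<lambda>i. vs ! (i - 1)) (rhs_body (rhs_of (can c)))"
      if sh: "P_shape (S_obj X) \<Gamma> r c vs" for r c vs
    proof -
      have cel: "c \<in> el (S_obj X) (Ob r)" and r: "r = Suc (length vs)" using sh by (auto simp: P_shape_def)
      note c = el_canE[OF X _ cel, simplified]
      obtain \<Delta> B where J: "can c = Judg \<Delta> (IsType B)" "r = Suc (length \<Delta>)"
        using obj_of_TypeE[OF c(1,3)] .
      have "fv B = {1..<r}" using fderiv_S_shaped[OF c(1)] canonical_dom[OF c(2)[unfolded J(1)]] J by simp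
      then show ?thesis using c J r expand_App_vars[of "bodies (\<lambda>ob c. c)" "Inl (r, c)" vs]
        by (simp add: is_type_judgement_def)
    qed
    note c1 = *[OF T(2)] and c2 = *[OF T(4)]
    have fvF: "fv (ren (\<lambda>i. vs ! (i - 1)) e) = set vs" if "fv e = {1..<Suc (length vs)}" for vs and e :: "'a fsym expr"
    proof -
      have "fv (ren (\<lambda>i. vs ! (i - 1)) e) = (\<lambda>i. vs ! i) ` (\<lambda>i. i - 1) ` {1..<Suc (length vs)}"
        using that by (simp add: fv_ren image_comp comp_def)
      also have "(\<lambda>i. i - 1) ` {1..<Suc (length vs)} = {0..<length vs}"
        by (force simp: image_iff intro: bexI[of _ "Suc _"])
      finally show ?thesis by (metis list.set_map map_nth set_upt)
    qed
    have "fv (?F T1) = set vs1" "fv (?F T2) = set vs2" using c1 c2 fvF T by simp_all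
    then have vs: "vs1 = vs2" using increasing_list_unique[OF inc] eq by simp
    then have r: "r1 = r2" using T by (simp add: P_shape_def)
    have body: "rhs_body (rhs_of (can c1)) = rhs_body (rhs_of (can c2))"
      by (rule ren_inj_on[of "\<lambda>i. vs1 ! (i - 1)"]) (use c1 c2 vs eq T inj_nth[OF inc(1)] in simp_all)
    have "boundary (can c1) = boundary (can c2)"
    proof (cases "vs1 = []")
      case True
      have nil: "boundary (can c) = []" if d: "fderiv DS X (can c)" and o: "obj_of (can c) = Ob (Suc 0)" for c
      proof -
        obtain \<Delta> B where "can c = Judg \<Delta> (IsType B)" "Suc 0 = Suc (length \<Delta>)" using obj_of_TypeE[OF d o] .
        then show ?thesis by simp
      qed
      have "r1 = Suc 0" using True T(2) by (simp add: P_shape_def)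
      then show ?thesis using nil c1 c2 r by metis
    next
      case False
      then have "(last vs1, App (Inl (r1 - 1, bd (S_obj X) (Ob r1) c1)) (map V (butlast vs1))) \<in> set \<Gamma>"
        "(last vs1, App (Inl (r1 - 1, bd (S_obj X) (Ob r1) c2)) (map V (butlast vs1))) \<in> set \<Gamma>"
        using P_shape_last[OF T(2)] P_shape_last[OF T(4)] vs r by simp_all
      then have "bd (S_obj X) (Ob r1) c1 = bd (S_obj X) (Ob r1) c2"
        using fderiv_distinct[OF d(1)] eq_key_imp_eq_value by fastforce
      moreover have "r1 = Suc (length vs1)" "length vs1 \<ge> 1" "c1 \<in> el (S_obj X) (Ob r1)" "c2 \<in> el (S_obj X) (Ob r1)"
        using T r False by (auto simp: P_shape_def Suc_le_eq)
      ultimately show ?thesis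
        using boundary_can(1)[OF X, of DS c1 "length vs1"] boundary_can(1)[OF X, of DS c2 "length vs1"] by simp
    qed
    then have "can c1 = can c2" using type_judgement_eqI[of "can c1" "can c2" r1] c1 c2 r body by blast
    then show ?thesis using c1 c2 T vs r by metis
  qed
  {
    case Nil
    then have "\<Gamma>2 = []" by simp
    then show ?case using main[of "[]" T1 T2] Nil by simp
  next
    case (snoc z \<Gamma>)
    obtain x S where z: "z = (x, S)" by (cases z)
    obtain \<Gamma>' y S' where G2: "\<Gamma>2 = \<Gamma>' @ [(y, S')]" using snoc(6) by (cases \<Gamma>2 rule: rev_cases) auto
    have "\<Gamma> = \<Gamma>' \<and> S = S'"
    proof (rule snoc(1))
      show "fderiv DP (S_obj X) (Judg \<Gamma> (IsType S))" using fderiv_prefix[OF SX, of DP \<Gamma> x S "[]"] snoc(2) z by simp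
      show "fderiv DP (S_obj X) (Judg \<Gamma>' (IsType S'))" using fderiv_prefix[OF SX, of DP \<Gamma>' y S' "[]"] snoc(3) G2 by simp
      show "canonical (Judg \<Gamma> (IsType S))" using canonical_prefix(2)[of \<Gamma> x S "[]"] snoc(4) z by simp
      show "canonical (Judg \<Gamma>' (IsType S'))" using canonical_prefix(2)[of \<Gamma>' y S' "[]"] snoc(5) G2 by simp
      show "flatten (Judg \<Gamma> (IsType S)) = flatten (Judg \<Gamma>' (IsType S'))" using snoc(6) z G2 by simp
    qed
    moreover have "x = y" using snoc(6) z G2 by simp
    ultimately have "\<Gamma> @ [z] = \<Gamma>2" using z G2 by simp
    moreover from this have "T1 = T2" using main[of "\<Gamma> @ [z]" T1 T2] snoc(2-6) by simp
    ultimately show ?case by blast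
  }
qed

text \<open>The type of a term built from a constant determines the degree, the boundary and the arguments of
  that constant. A variable cannot be confused with such a term, as the term part of a judgement over the free
  \<open>{s}\<close>-GAT is not a variable.\<close>

lemma flatten_inj_terms:
  assumes X: "is_presheaf X"
    and d: "fderiv DP (S_obj X) (Judg \<Gamma>1 (HasType t1 T1))" "fderiv DP (S_obj X) (Judg \<Gamma>2 (HasType t2 T2))"
    and can: "canonical (Judg \<Gamma>1 (HasType t1 T1))" "canonical (Judg \<Gamma>2 (HasType t2 T2))"
    and eq: "flatten (Judg \<Gamma>1 (HasType t1 T1)) = flatten (Judg \<Gamma>2 (HasType t2 T2))"
  shows "Judg \<Gamma>1 (HasType t1 T1) = Judg \<Gamma>2 (HasType t2 T2)"
proof -
  have SX: "is_presheaf (S_obj X)" by (rule M_obj_presheaf[OF X]) simp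
  let ?F = "expand (bodies (\<lambda>ob c. c)) :: 'a fsym judgement set fsym expr \<Rightarrow> 'a fsym expr"
  have dT: "fderiv DP (S_obj X) (Judg \<Gamma>1 (IsType T1))" "fderiv DP (S_obj X) (Judg \<Gamma>2 (IsType T2))"
    using fderiv_typeof[OF SX _ d(1)] fderiv_typeof[OF SX _ d(2)] by simp_all
  have canT: "canonical (Judg \<Gamma>1 (IsType T1))" "canonical (Judg \<Gamma>2 (IsType T2))"
    using can by (simp_all add: canonical_def degree_def)
  have GT: "\<Gamma>1 = \<Gamma>2" "T1 = T2" using flatten_inj_types[OF X dT canT] eq by simp_all
  have eqt: "?F t1 = ?F t2" using eq by simp
  have *: "fderiv DS X (can c) \<and> (\<exists>\<Delta> b B. can c = Judg \<Delta> (HasType b B) \<and> boundary (can c) = [can (bd (S_obj X) (ObT r) c)] \<and>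
      cls DS (G_obj X) (can c) = c \<and> fv b \<subseteq> {1..<Suc (length vs)} \<and> (\<exists>s es. b = App s es) \<and>
      ?F (App (Inr (r, c)) (map V vs)) = ren (\<lambda>i. vs ! (i - 1)) b)"
    if cel: "c \<in> el (S_obj X) (ObT r)" and r: "r = Suc (length vs)" for r c vs
  proof -
    note c = el_canE[OF X _ cel, simplified]
    obtain \<Delta> b B where J: "can c = Judg \<Delta> (HasType b B)" "r = Suc (length \<Delta>)"
      using obj_of_TermE[OF c(1,3)] .
    have "fv b \<subseteq> {1..<Suc (length vs)}"
      using fderiv_fv[of DS X \<Delta> "HasType b B" b] canonical_dom[of \<Delta> "HasType b B"] c J r by simp
    moreover have "\<exists>s es. b = App s es" using fderiv_S_shaped[OF c(1)] J by auto
    moreover have "boundary (can c) = [can (bd (S_obj X) (ObT r) c)]" using boundary_can(2)[OF X _ cel] by simp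
    ultimately show ?thesis using c J expand_App_vars[of "bodies (\<lambda>ob c. c)" "Inr (r, c)" vs] by simp
  qed
  have "t1 = t2"
  proof -
    from fderiv_P_shaped[OF SX d(1)] consider (v1) x where "t1 = V x"
      | (a1) r1 c1 vs1 where "t1 = App (Inr (r1, c1)) (map V vs1)" "T1 = App (Inl (r1, bd (S_obj X) (ObT r1) c1)) (map V vs1)"
        "r1 = Suc (length vs1)" "c1 \<in> el (S_obj X) (ObT r1)" by auto
    note 1 = this
    from fderiv_P_shaped[OF SX d(2)] consider (v2) x where "t2 = V x"
      | (a2) r2 c2 vs2 where "t2 = App (Inr (r2, c2)) (map V vs2)" "T2 = App (Inl (r2, bd (S_obj X) (ObT r2) c2)) (map V vs2)"
        "r2 = Suc (length vs2)" "c2 \<in> el (S_obj X) (ObT r2)" by auto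
    note 2 = this
    show ?thesis
    proof (cases rule: 1)
      case (v1 x)
      show ?thesis
      proof (cases rule: 2)
        case (v2 y)
        then show ?thesis using v1 eqt by simp
      next
        case (a2 r2 c2 vs2)
        obtain s es where "?F t2 = ren (\<lambda>i. vs2 ! (i - 1)) (App s es)" using *[OF a2(4,3)] a2(1) by metis
        then show ?thesis using v1 eqt by (simp add: ren_def)
      qed
    next
      case (a1 r1 c1 vs1)
      show ?thesis
      proof (cases rule: 2)
        case (v2 y)
        obtain s es where "?F t1 = ren (\<lambda>i. vs1 ! (i - 1)) (App s es)" using *[OF a1(4,3)] a1(1) by metis
        then show ?thesis using v2 eqt by (simp add: ren_def)
      next
        case (a2 r2 c2 vs2)
        have same: "r1 = r2" "bd (S_obj X) (ObT r1) c1 = bd (S_obj X) (ObT r2) c2" "vs1 = vs2"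
          using a1(2) a2(2) GT by (auto simp: map_V_eq)
        have "sorted_wrt (<) vs1" using P_type_vars_increasing[OF SX] dT(1) canT(1) a1(2) by blast
        note inj = inj_nth[OF this]
        obtain \<Delta>1 b1 B1 where 1: "can c1 = Judg \<Delta>1 (HasType b1 B1)" "boundary (can c1) = [can (bd (S_obj X) (ObT r1) c1)]"
          "cls DS (G_obj X) (can c1) = c1" "fv b1 \<subseteq> {1..<Suc (length vs1)}" "?F t1 = ren (\<lambda>i. vs1 ! (i - 1)) b1"
          using *[OF a1(4,3)] a1(1) by blast
        obtain \<Delta>2 b2 B2 where 2: "can c2 = Judg \<Delta>2 (HasType b2 B2)" "boundary (can c2) = [can (bd (S_obj X) (ObT r2) c2)]"
          "cls DS (G_obj X) (can c2) = c2" "fv b2 \<subseteq> {1..<Suc (length vs2)}" "?F t2 = ren (\<lambda>i. vs2 ! (i - 1)) b2"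
          using *[OF a2(4,3)] a2(1) by blast
        have "b1 = b2"
          by (rule ren_inj_on[of "\<lambda>i. vs1 ! (i - 1)"])
            (use 1 2 same eqt inj in \<open>auto intro: inj_on_subset\<close>)
        moreover have "Judg \<Delta>1 (IsType B1) = Judg \<Delta>2 (IsType B2)"
          using 1(1,2) 2(1,2) same by (metis boundary.simps(2) list.inject)
        ultimately have "c1 = c2" using 1(1,3) 2(1,3) by (metis judgement.inject rhs.inject(1))
        then show ?thesis using a1 a2 same by simp
      qed
    qed
  qed
  then show ?thesis using GT by simp
qed

theorem kappa_inj:
  assumes X: "is_presheaf X"
  shows "inj_on (kappa X ob) (el (P_obj (S_obj X)) ob)"
proof (rule inj_onI)
  have SX: "is_presheaf (S_obj X)" by (rule M_obj_presheaf[OF X]) simp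
  fix c1 c2 assume el: "c1 \<in> el (P_obj (S_obj X)) ob" "c2 \<in> el (P_obj (S_obj X)) ob" and eq: "kappa X ob c1 = kappa X ob c2"
  note c1 = el_canE[OF SX _ el(1), simplified] and c2 = el_canE[OF SX _ el(2), simplified]
  have "cls DT (G_obj X) (flatten (can c1)) = cls DT (G_obj X) (flatten (can c2))"
    using eq kappa_cls(2)[OF X c1(1), of ob] kappa_cls(2)[OF X c2(1), of ob] c1(4) c2(4) by simp
  then have "alpha_eq (flatten (can c1)) (flatten (can c2))"
    using cls_eqD[OF X _ kappa_cls(1)[OF X c1(1)]] by simp
  then have fl: "flatten (can c2) = flatten (can c1)"
    using canonical_unique[OF X _ kappa_cls(1)[OF X c1(1)]] c1(2) c2(2) by simp
  have "can c1 = can c2"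
  proof (cases ob)
    case (Ob n)
    obtain \<Gamma>1 T1 where J1: "can c1 = Judg \<Gamma>1 (IsType T1)" using obj_of_TypeE[OF c1(1), of n] c1(3) Ob by metis
    obtain \<Gamma>2 T2 where J2: "can c2 = Judg \<Gamma>2 (IsType T2)" using obj_of_TypeE[OF c2(1), of n] c2(3) Ob by metis
    show ?thesis using flatten_inj_types[OF X, of \<Gamma>1 T1 \<Gamma>2 T2] c1 c2 fl unfolding J1 J2 by metis
  next
    case (ObT n)
    obtain \<Gamma>1 t1 T1 where J1: "can c1 = Judg \<Gamma>1 (HasType t1 T1)" using obj_of_TermE[OF c1(1), of n] c1(3) ObT by metis
    obtain \<Gamma>2 t2 T2 where J2: "can c2 = Judg \<Gamma>2 (HasType t2 T2)" using obj_of_TermE[OF c2(1), of n] c2(3) ObT by metis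
    show ?thesis using flatten_inj_terms[OF X, of \<Gamma>1 t1 T1 \<Gamma>2 t2 T2] c1 c2 fl unfolding J1 J2 by metis
  qed
  then show "c1 = c2" using c1(4) c2(4) by metis
qed

text \<open>The form in which the distributive law is computed: a judgement over \<open>SX\<close> with the right expansion is,
  by injectivity of \<open>\<kappa>\<close>, the value.\<close>

theorem dist_law_eqI:
  assumes X: "is_presheaf X" and J: "fderiv DS (P_obj X) J" and J': "fderiv DP (S_obj X) J'"
    and eq: "flatten J' = flatten J"
  shows "dist_law X (obj_of J) (cls DS (G_obj (P_obj X)) J) = cls DP (G_obj (S_obj X)) J'"
proof -
  have SX: "is_presheaf (S_obj X)" by (rule M_obj_presheaf[OF X]) simp
  have "obj_of J' = obj_of J" using arg_cong[OF eq, of obj_of] by simp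
  then have "cls DP (G_obj (S_obj X)) J' \<in> el (P_obj (S_obj X)) (obj_of J)"
    using M_obj_cls[OF SX _ J'] by simp
  then show ?thesis
    unfolding dist_law_cls[OF X J refl] eq[symmetric] kappa_cls(2)[OF X J', of "obj_of J", symmetric]
    by (rule the_inv_into_f_f[OF kappa_inj[OF X]])
qed

section \<open>Min-heaps\<close>

lemma Hp_D:
  assumes "\<phi> \<in> Hp n"
  shows "\<phi> 0 = 0" "i \<in> {1..n} \<Longrightarrow> \<phi> i < i" "i \<le> n \<Longrightarrow> \<phi> i \<le> i" "i \<le> n \<Longrightarrow> \<phi> i \<le> n"
proof -
  have 1: "\<phi> 0 = 0" and 2: "\<And>i. i \<in> {1..n} \<Longrightarrow> \<phi> i < i" using assms by (auto simp: Hp_def)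
  then have 3: "\<phi> i \<le> i" if "i \<le> n" for i using that by (cases "i = 0") (auto intro: less_imp_le)
  show "\<phi> 0 = 0" "i \<in> {1..n} \<Longrightarrow> \<phi> i < i" "i \<le> n \<Longrightarrow> \<phi> i \<le> i" "i \<le> n \<Longrightarrow> \<phi> i \<le> n"
    using 1 2 3[of i] by auto
qed

lemma funpow_le: "\<phi> \<in> Hp n \<Longrightarrow> i \<le> n \<Longrightarrow> (\<phi> ^^ k) i \<le> i"
proof (induct k)
  case (Suc k)
  then show ?case using Hp_D(3)[of \<phi> n "(\<phi> ^^ k) i"] by simp
qed simp

lemma strict_ancestors: "{(\<phi> ^^ k) i | k. k \<ge> 1} = insert (\<phi> i) {(\<phi> ^^ k) (\<phi> i) | k. k \<ge> (1::nat)}"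
proof -
  have "(\<exists>k\<ge>1. x = (\<phi> ^^ k) i) \<longleftrightarrow> x = \<phi> i \<or> (\<exists>k\<ge>1. x = (\<phi> ^^ k) (\<phi> i))" for x
  proof
    assume "\<exists>k\<ge>1. x = (\<phi> ^^ k) i"
    then obtain k where k: "k \<ge> 1" "x = (\<phi> ^^ k) i" by blast
    then have "x = (\<phi> ^^ (k - 1)) (\<phi> i)" by (cases k) (auto simp: funpow_swap1)
    then show "x = \<phi> i \<or> (\<exists>k\<ge>1. x = (\<phi> ^^ k) (\<phi> i))" by (cases "k - 1") auto
  next
    assume "x = \<phi> i \<or> (\<exists>k\<ge>1. x = (\<phi> ^^ k) (\<phi> i))"
    then show "\<exists>k\<ge>1. x = (\<phi> ^^ k) i"
    proof
      assume "x = \<phi> i"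
      then show ?thesis by (intro exI[of _ 1]) simp
    next
      assume "\<exists>k\<ge>1. x = (\<phi> ^^ k) (\<phi> i)"
      then obtain k where "x = (\<phi> ^^ k) (\<phi> i)" by blast
      then show ?thesis by (intro exI[of _ "Suc k"]) (simp add: funpow_swap1)
    qed
  qed
  then show ?thesis by auto
qed

lemma dp_0: "\<phi> \<in> Hp n \<Longrightarrow> dp \<phi> 0 = 1"
proof -
  assume "\<phi> \<in> Hp n"
  then have "(\<phi> ^^ k) 0 = 0" for k using funpow_le[of \<phi> n 0 k] by simp
  then have "{(\<phi> ^^ k) 0 | k. k \<ge> 1} = {0}" by auto
  then show ?thesis by (simp add: dp_def)
qed

lemma dp_rec:
  assumes "\<phi> \<in> Hp n" "i \<in> {1..n}"
  shows "dp \<phi> i = (if \<phi> i = 0 then 1 else Suc (dp \<phi> (\<phi> i)))"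
proof -
  let ?S = "\<lambda>i. {(\<phi> ^^ k) i | k. k \<ge> (1::nat)}"
  note \<phi> = Hp_D[OF assms(1)]
  have S0: "?S 0 = {0}"
  proof -
    have "(\<phi> ^^ k) 0 = 0" for k using funpow_le[OF assms(1), of 0 k] by simp
    then show ?thesis by auto
  qed
  show ?thesis
  proof (cases "\<phi> i = 0")
    case True
    then have "?S i = {0}" using strict_ancestors[of \<phi> i] S0 by simp
    then show ?thesis using True by (simp add: dp_def)
  next
    case False
    have le: "\<phi> i \<in> {1..n}" using False \<phi>(4)[of i] assms(2) by simp
    have lt: "x < \<phi> i" if x: "x \<in> ?S (\<phi> i)" for x
    proof -
      from x obtain k where k: "k \<ge> 1" "x = (\<phi> ^^ k) (\<phi> i)" by blast
      then have "x = (\<phi> ^^ (k - 1)) (\<phi> (\<phi> i))" by (cases k) (auto simp: funpow_swap1)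
      also have "\<dots> \<le> \<phi> (\<phi> i)" using funpow_le[OF assms(1)] \<phi>(4) le by simp
      also have "\<dots> < \<phi> i" using \<phi>(2) le by simp
      finally show ?thesis .
    qed
    then have "finite (?S (\<phi> i))" by (meson finite_nat_set_iff_bounded)
    moreover have "\<phi> i \<notin> ?S (\<phi> i)" using lt by blast
    ultimately show ?thesis using False strict_ancestors[of \<phi> i] by (simp add: dp_def)
  qed
qed

lemma dp_pos: "\<phi> \<in> Hp n \<Longrightarrow> i \<le> n \<Longrightarrow> dp \<phi> i \<ge> 1"
  using dp_0[of \<phi> n] dp_rec[of \<phi> n i] by (cases "i = 0") (auto split: if_splits)

lemma funpow_restrict:
  assumes "\<phi> \<in> Hp n" "i \<le> m" "m \<le> n"
  shows "(restrict \<phi> {..m} ^^ k) i = (\<phi> ^^ k) i"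
proof (induct k)
  case (Suc k)
  then show ?case using funpow_le[OF assms(1), of i k] assms(2,3) by simp
qed simp

lemma dp_restrict: "\<phi> \<in> Hp n \<Longrightarrow> i \<le> m \<Longrightarrow> m \<le> n \<Longrightarrow> dp (restrict \<phi> {..m}) i = dp \<phi> i"
  by (simp add: dp_def funpow_restrict)

lemma chain_restrict: "\<phi> \<in> Hp n \<Longrightarrow> i \<le> m \<Longrightarrow> m \<le> n \<Longrightarrow> chain (restrict \<phi> {..m}) i l = chain \<phi> i l"
  by (simp add: chain_def funpow_restrict dp_restrict)

lemma Hp_restrict: "\<phi> \<in> Hp n \<Longrightarrow> m \<le> n \<Longrightarrow> restrict \<phi> {..m} \<in> Hp m"
  unfolding Hp_def[of m]
proof (intro CollectI conjI ballI PiE_I)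
  assume "\<phi> \<in> Hp n" "m \<le> n"
  note \<phi> = Hp_D[OF this(1)]
  show "restrict \<phi> {..m} 0 = 0" using \<phi>(1) by simp
  show "restrict \<phi> {..m} i < i" if "i \<in> {1..m}" for i using that \<phi>(2)[of i] \<open>m \<le> n\<close> by simp
  show "restrict \<phi> {..m} i \<in> {..m}" if "i \<in> {..m}" for i using that \<phi>(3)[of i] \<open>m \<le> n\<close> by simp
qed simp

lemma funpow_dp:
  assumes "\<phi> \<in> Hp n" "i \<in> {1..n}" "r < dp \<phi> i"
  shows "(\<phi> ^^ r) i \<in> {1..n} \<and> dp \<phi> ((\<phi> ^^ r) i) = dp \<phi> i - r"
  using assms(3)
proof (induct r)
  case (Suc r)
  let ?j = "(\<phi> ^^ r) i"
  have j: "?j \<in> {1..n}" "dp \<phi> ?j = dp \<phi> i - r" using Suc by simp_all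
  then have "dp \<phi> ?j > 1" using Suc by simp
  then have "\<phi> ?j \<noteq> 0" "dp \<phi> ?j = Suc (dp \<phi> (\<phi> ?j))" using dp_rec[OF assms(1) j(1)] by (auto split: if_splits)
  then show ?case using Hp_D(4)[OF assms(1), of ?j] j Suc by simp
qed (use assms in simp)

lemma chain_top [simp]: "chain \<phi> j (dp \<phi> j) = j"
  by (simp add: chain_def)

lemma chain_le: "\<phi> \<in> Hp n \<Longrightarrow> i \<le> n \<Longrightarrow> chain \<phi> i l \<le> i"
  unfolding chain_def by (rule funpow_le)

lemma chain_in:
  assumes "\<phi> \<in> Hp n" "j \<in> {1..n}" "l \<in> {1..dp \<phi> j}"
  shows "chain \<phi> j l \<in> {1..j}" "dp \<phi> (chain \<phi> j l) = l"
  using funpow_dp[OF assms(1,2), of "dp \<phi> j - l"] funpow_le[OF assms(1), of j "dp \<phi> j - l"] assms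
  by (auto simp: chain_def)

lemma chain_chain:
  assumes "\<phi> \<in> Hp n" "j \<in> {1..n}" "l \<in> {1..dp \<phi> j}" "l' \<le> l"
  shows "chain \<phi> (chain \<phi> j l) l' = chain \<phi> j l'"
proof -
  have "chain \<phi> (chain \<phi> j l) l' = (\<phi> ^^ (l - l')) ((\<phi> ^^ (dp \<phi> j - l)) j)"
    using chain_in(2)[OF assms(1-3)] by (simp add: chain_def)
  also have "\<dots> = (\<phi> ^^ (dp \<phi> j - l')) j"
    using assms(3,4) by (simp add: funpow_add[symmetric, THEN fun_cong, unfolded comp_def])
  finally show ?thesis by (simp add: chain_def)
qed

lemma chain_Suc: "Suc l \<le> dp \<phi> j \<Longrightarrow> \<phi> (chain \<phi> j (Suc l)) = chain \<phi> j l"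
  unfolding chain_def by (simp add: Suc_diff_Suc flip: funpow.simps(2)[THEN fun_cong, unfolded comp_def])

lemma chain_parent:
  assumes "\<phi> \<in> Hp n" "j \<in> {1..n}" "l < dp \<phi> j" "l \<ge> 1"
  shows "chain \<phi> j l = chain \<phi> (\<phi> j) l" "\<phi> j > 0" "dp \<phi> (\<phi> j) = dp \<phi> j - 1"
proof -
  have *: "\<phi> j > 0 \<and> dp \<phi> (\<phi> j) = dp \<phi> j - 1" using dp_rec[OF assms(1,2)] assms(3,4) by (auto split: if_splits)
  then show "\<phi> j > 0" "dp \<phi> (\<phi> j) = dp \<phi> j - 1" by auto
  have "dp \<phi> j - l = Suc (dp \<phi> (\<phi> j) - l)" using assms(3) * by simp
  then show "chain \<phi> j l = chain \<phi> (\<phi> j) l" by (simp add: chain_def funpow_swap1)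
qed

text \<open>Depth and strict ancestors only depend on the parent. This is how projections enter:
  \<open>\<pi>\<^sub>j\<close> is a term of type \<open>i\<close> only if \<open>i\<close> and
  \<open>j\<close> have the same parent.\<close>

lemma same_parent:
  assumes "\<phi> \<in> Hp n" "i \<in> {1..n}" "j \<in> {1..n}" "\<phi> i = \<phi> j"
  shows "dp \<phi> i = dp \<phi> j" "l \<ge> 1 \<Longrightarrow> l < dp \<phi> j \<Longrightarrow> chain \<phi> i l = chain \<phi> j l"
proof -
  show dp: "dp \<phi> i = dp \<phi> j" using dp_rec[OF assms(1,2)] dp_rec[OF assms(1,3)] assms(4) by simp
  show "chain \<phi> i l = chain \<phi> j l" if "l \<ge> 1" "l < dp \<phi> j"
    using chain_parent(1)[OF assms(1,2), of l] chain_parent(1)[OF assms(1,3), of l] that dp assms(4) by simp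
qed

lemma chain_strict_mono:
  assumes "\<phi> \<in> Hp n" "j \<in> {1..n}" "1 \<le> l" "l < l'" "l' \<le> dp \<phi> j"
  shows "chain \<phi> j l < chain \<phi> j l'"
proof -
  have i: "chain \<phi> j l' \<in> {1..n}" "dp \<phi> (chain \<phi> j l') = l'" using chain_in[OF assms(1,2), of l'] assms by auto
  have "chain \<phi> j l = chain \<phi> (chain \<phi> j l') l" using chain_chain[OF assms(1,2), of l' l] assms by simp
  also have "\<dots> = chain \<phi> (\<phi> (chain \<phi> j l')) l" using chain_parent(1)[OF assms(1) i(1), of l] i assms by simp
  also have "\<dots> \<le> \<phi> (chain \<phi> j l')"
    by (rule chain_le[OF assms(1)]) (use Hp_D(4)[OF assms(1), of "chain \<phi> j l'"] i in simp)
  also have "\<dots> < chain \<phi> j l'" using Hp_D(2)[OF assms(1) i(1)] .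
  finally show ?thesis .
qed

text \<open>The ancestors of \<open>j\<close> are indexed by their depths.\<close>

lemma heap_le_chain:
  assumes "\<phi> \<in> Hp n" "i \<in> {1..n}" "j \<in> {1..n}"
  shows "heap_le \<phi> i j \<longleftrightarrow> dp \<phi> i \<le> dp \<phi> j \<and> i = chain \<phi> j (dp \<phi> i)"
proof
  assume "heap_le \<phi> i j"
  then obtain k where k: "i = (\<phi> ^^ k) j" by (auto simp: heap_le_def)
  have z: "(\<phi> ^^ dp \<phi> j) j = 0"
  proof -
    have p: "dp \<phi> j \<ge> 1" using dp_pos[OF assms(1)] assms(3) by simp
    define r where "r = (\<phi> ^^ (dp \<phi> j - 1)) j"
    have r: "r \<in> {1..n}" "dp \<phi> r = 1" using funpow_dp[OF assms(1,3), of "dp \<phi> j - 1"] p unfolding r_def by auto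
    have "\<phi> r = 0"
    proof (rule ccontr)
      assume "\<phi> r \<noteq> 0"
      then have "dp \<phi> (\<phi> r) = 0" using dp_rec[OF assms(1) r(1)] r(2) by simp
      then show False using dp_pos[OF assms(1), of "\<phi> r"] Hp_D(4)[OF assms(1), of r] r(1) by simp
    qed
    moreover have "(\<phi> ^^ dp \<phi> j) j = \<phi> r" using p unfolding r_def by (cases "dp \<phi> j") simp_all
    ultimately show ?thesis by simp
  qed
  have "k < dp \<phi> j"
  proof (rule ccontr)
    assume "\<not> k < dp \<phi> j"
    then have "i = (\<phi> ^^ (k - dp \<phi> j)) ((\<phi> ^^ dp \<phi> j) j)"
      using k by (simp add: funpow_add[symmetric, THEN fun_cong, unfolded comp_def])
    then have "i = 0" using z funpow_le[OF assms(1), of 0] by simp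
    then show False using assms by simp
  qed
  then show "dp \<phi> i \<le> dp \<phi> j \<and> i = chain \<phi> j (dp \<phi> i)" using funpow_dp[OF assms(1,3)] k by (simp add: chain_def)
next
  assume "dp \<phi> i \<le> dp \<phi> j \<and> i = chain \<phi> j (dp \<phi> i)"
  then show "heap_le \<phi> i j" unfolding heap_le_def chain_def by blast
qed

lemma heap_le_refl: "heap_le \<phi> i i"
  unfolding heap_le_def by (rule exI[of _ 0]) simp

lemma heap_le_trans: "heap_le \<phi> i j \<Longrightarrow> heap_le \<phi> j k \<Longrightarrow> heap_le \<phi> i k"
  unfolding heap_le_def by (metis comp_apply funpow_add)

lemma heap_le_imp_le: "\<phi> \<in> Hp n \<Longrightarrow> j \<le> n \<Longrightarrow> heap_le \<phi> i j \<Longrightarrow> i \<le> j"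
  unfolding heap_le_def using funpow_le by blast

lemma heap_le_chainI: "heap_le \<phi> (chain \<phi> j l) j"
  unfolding heap_le_def chain_def by blast

lemma heap_le_linear:
  assumes "\<phi> \<in> Hp n" "heap_le \<phi> i k" "heap_le \<phi> j k" "i \<le> j" "j \<le> n"
  shows "heap_le \<phi> i j"
proof -
  obtain a b where ab: "i = (\<phi> ^^ a) k" "j = (\<phi> ^^ b) k" using assms(2,3) by (auto simp: heap_le_def)
  show ?thesis
  proof (cases "b \<le> a")
    case True
    then have "i = (\<phi> ^^ (a - b)) j" using ab by (simp add: funpow_add[symmetric, THEN fun_cong, unfolded comp_def])
    then show ?thesis unfolding heap_le_def by blast
  next
    case False
    then have "j = (\<phi> ^^ (b - a)) i" using ab by (simp add: funpow_add[symmetric, THEN fun_cong, unfolded comp_def])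
    then have "j \<le> i" using funpow_le[OF assms(1), of i "b - a"] assms(4,5) by simp
    then show ?thesis using assms(4) heap_le_refl by simp
  qed
qed

lemma heap_le_parent:
  assumes "\<phi> \<in> Hp n" "j \<le> n" "heap_le \<phi> i j" "i \<noteq> j"
  shows "i \<le> \<phi> j" "heap_le \<phi> i (\<phi> j)"
proof -
  obtain k where k: "i = (\<phi> ^^ k) j" using assms(3) by (auto simp: heap_le_def)
  then have "i = (\<phi> ^^ (k - 1)) (\<phi> j)" using assms(4) by (cases k) (auto simp: funpow_swap1)
  then show "heap_le \<phi> i (\<phi> j)" "i \<le> \<phi> j"
    using funpow_le[OF assms(1) Hp_D(4)[OF assms(1,2)]] by (auto simp: heap_le_def)
qed

text \<open>The parent of \<open>j\<close> is the greatest element strictly below \<open>j\<close> in the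
  order of the heap.\<close>

lemma heap_determined:
  assumes "\<phi> \<in> Hp n" "\<psi> \<in> Hp n" "\<And>i j. i \<in> {1..n} \<Longrightarrow> j \<in> {1..n} \<Longrightarrow> heap_le \<phi> i j \<longleftrightarrow> heap_le \<psi> i j"
  shows "\<phi> = \<psi>"
proof -
  have le: "\<phi> j \<le> \<psi> j" if "\<phi> \<in> Hp n" "\<psi> \<in> Hp n" "j \<in> {1..n}"
    "\<And>i j. i \<in> {1..n} \<Longrightarrow> j \<in> {1..n} \<Longrightarrow> heap_le \<phi> i j \<Longrightarrow> heap_le \<psi> i j" for \<phi> \<psi> j
  proof (cases "\<phi> j = 0")
    case False
    have "\<phi> j \<in> {1..n}" "\<phi> j \<noteq> j" using Hp_D(2,4)[OF that(1), of j] that(3) False by auto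
    moreover have "heap_le \<phi> (\<phi> j) j" unfolding heap_le_def by (rule exI[of _ 1]) simp
    ultimately have "heap_le \<psi> (\<phi> j) j" using that(3,4) by blast
    then show ?thesis using heap_le_parent(1)[OF that(2)] that(3) \<open>\<phi> j \<noteq> j\<close> by simp
  qed simp
  show ?thesis
  proof
    fix j
    consider "j = 0" | "j \<in> {1..n}" | "j > n" by fastforce
    then show "\<phi> j = \<psi> j"
    proof cases
      case 1
      then show ?thesis using Hp_D(1) assms by metis
    next
      case 2
      then show ?thesis using le[of \<phi> \<psi> j] le[of \<psi> \<phi> j] assms by (meson antisym)
    next
      case 3
      have "f j = undefined" if "f \<in> Hp n" for f
        using that 3 unfolding Hp_def by (intro PiE_arb[of f "{..n}" "\<lambda>_. {..n}"]) simp_all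
      then show ?thesis using assms(1,2) by metis
    qed
  qed
qed

lemma Inc_D:
  assumes "\<alpha> \<in> Inc n"
  shows "\<alpha> 0 = 0" "i \<le> n \<Longrightarrow> j \<le> n \<Longrightarrow> \<alpha> i < \<alpha> j \<longleftrightarrow> i < j" "i \<le> n \<Longrightarrow> j \<le> n \<Longrightarrow> \<alpha> i \<le> \<alpha> j \<longleftrightarrow> i \<le> j"
    "inj_on \<alpha> {..n}" "i \<in> {1..n} \<Longrightarrow> \<alpha> i \<in> {1..\<alpha> n}"
proof -
  have sm: "strict_mono_on {..n} \<alpha>" and 0: "\<alpha> 0 = 0" using assms by (auto simp: Inc_def)
  show less: "\<alpha> i < \<alpha> j \<longleftrightarrow> i < j" if "i \<le> n" "j \<le> n" for i j
    using strict_mono_on_less[OF sm] that by simp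
  show le: "\<alpha> i \<le> \<alpha> j \<longleftrightarrow> i \<le> j" if "i \<le> n" "j \<le> n" for i j using less[OF that(2,1)] by auto
  show "inj_on \<alpha> {..n}" using sm by (rule strict_mono_on_imp_inj_on)
  show "\<alpha> 0 = 0" by (rule 0)
  show "\<alpha> i \<in> {1..\<alpha> n}" if "i \<in> {1..n}" using less[of 0 i] le[of i n] 0 that by simp
qed

text \<open>Down-sets in the order pulled back along \<open>\<alpha>\<close> are linearly ordered and respect
  the order of the natural numbers, so taking the greatest strict predecessor of each element gives a heap
  with that order.\<close>

lemma pull_heap:
  assumes \<alpha>: "\<alpha> \<in> Inc n" and \<phi>: "\<phi> \<in> Hp (\<alpha> n)"
  shows "pull_heap n \<alpha> \<phi> \<in> Hp n"
    and "i \<in> {1..n} \<Longrightarrow> j \<in> {1..n} \<Longrightarrow> heap_le (pull_heap n \<alpha> \<phi>) i j \<longleftrightarrow> heap_le \<phi> (\<alpha> i) (\<alpha> j)"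
proof -
  note a = Inc_D[OF \<alpha>]
  define R where "R i j \<longleftrightarrow> heap_le \<phi> (\<alpha> i) (\<alpha> j)" for i j
  define below where "below j = {i \<in> {1..<j}. R i j}" for j
  define \<psi> where "\<psi> = (\<lambda>j \<in> {..n}. Max (insert 0 (below j)))"
  have fin: "finite (below j)" for j by (simp add: below_def)
  have \<psi>j: "\<psi> j = Max (insert 0 (below j))" if "j \<le> n" for j using that by (simp add: \<psi>_def)
  have \<psi>_cases: "\<psi> j = 0 \<or> \<psi> j \<in> below j" if "j \<le> n" for j
    using Max_in[of "insert 0 (below j)"] fin \<psi>j[OF that] by simp
  have lt: "\<psi> j < j" if "j \<in> {1..n}" for j using \<psi>_cases[of j] that by (auto simp: below_def)
  have \<psi>: "\<psi> \<in> Hp n" unfolding Hp_def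
  proof (intro CollectI conjI ballI PiE_I)
    show "\<psi> 0 = 0" using \<psi>_cases[of 0] by (auto simp: below_def)
    show "\<psi> j \<in> {..n}" if "j \<in> {..n}" for j using lt[of j] \<open>\<psi> 0 = 0\<close> that by (cases "j = 0") auto
    show "\<psi> j = undefined" if "j \<notin> {..n}" for j using that by (simp add: \<psi>_def)
    show "\<psi> j < j" if "j \<in> {1..n}" for j by (rule lt[OF that])
  qed
  have le: "i \<le> j" if "R i j" "i \<le> n" "j \<le> n" for i j
    using heap_le_imp_le[OF \<phi>, of "\<alpha> j" "\<alpha> i"] that a(3)[of i j] a(3)[of j n] by (simp add: R_def)
  have R1: "heap_le \<psi> i j" if "R i j" "i \<in> {1..n}" "j \<in> {1..n}" for i j
    using that
  proof (induct j rule: less_induct)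
    case (less j)
    show ?case
    proof (cases "i = j")
      case True
      then show ?thesis by (simp add: heap_le_refl)
    next
      case False
      then have i: "i \<in> below j" using le[of i j] less by (simp add: below_def)
      then have "i \<le> \<psi> j" using fin \<psi>j[of j] less by simp
      then have p: "\<psi> j \<in> below j" using \<psi>_cases[of j] less by auto
      then have pj: "\<psi> j \<in> {1..n}" "\<psi> j < j" "R (\<psi> j) j" using less by (auto simp: below_def)
      have "R i (\<psi> j)" unfolding R_def
        by (rule heap_le_linear[OF \<phi>, of _ "\<alpha> j"])
          (use less pj \<open>i \<le> \<psi> j\<close> a(3) in \<open>auto simp: R_def\<close>)
      then have "heap_le \<psi> i (\<psi> j)" using less pj by blast
      moreover have "heap_le \<psi> (\<psi> j) j" unfolding heap_le_def by (rule exI[of _ 1]) simp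
      ultimately show ?thesis by (rule heap_le_trans)
    qed
  qed
  have R2: "R i j" if "heap_le \<psi> i j" "i \<in> {1..n}" "j \<in> {1..n}" for i j
    using that
  proof (induct j rule: less_induct)
    case (less j)
    show ?case
    proof (cases "i = j")
      case True
      then show ?thesis by (simp add: R_def heap_le_refl)
    next
      case False
      then have i: "i \<le> \<psi> j" "heap_le \<psi> i (\<psi> j)" using heap_le_parent[OF \<psi>, of j i] less by auto
      then have "\<psi> j \<in> below j" using \<psi>_cases[of j] less by auto
      then have pj: "\<psi> j \<in> {1..n}" "\<psi> j < j" "R (\<psi> j) j" using less by (auto simp: below_def)
      then have "R i (\<psi> j)" using less i by blast
      then show ?thesis using pj(3) unfolding R_def by (rule heap_le_trans)
    qed
  qed
  \<comment> \<open>A heap is determined by its order, so the description defining \<open>pull_heap\<close> has \<open>\<psi>\<close> as its only solution.\<close>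
  let ?P = "\<lambda>\<psi>. \<psi> \<in> Hp n \<and> (\<forall>i \<in> {1..n}. \<forall>j \<in> {1..n}. heap_le \<psi> i j \<longleftrightarrow> heap_le \<phi> (\<alpha> i) (\<alpha> j))"
  have "?P \<psi>" using \<psi> R1 R2 by (auto simp: R_def)
  moreover have "\<psi>' = \<psi>" if "?P \<psi>'" for \<psi>'
    using that \<open>?P \<psi>\<close> by (intro heap_determined[of _ n]) auto
  ultimately have "?P (pull_heap n \<alpha> \<phi>)" unfolding pull_heap_def by (rule theI[of ?P])
  then show "pull_heap n \<alpha> \<phi> \<in> Hp n"
    and "i \<in> {1..n} \<Longrightarrow> j \<in> {1..n} \<Longrightarrow> heap_le (pull_heap n \<alpha> \<phi>) i j \<longleftrightarrow> heap_le \<phi> (\<alpha> i) (\<alpha> j)"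
    by blast+
qed

section \<open>The order generated by projections\<close>

lemma P_tyD:
  assumes "(\<phi>, h) \<in> P_ty X n"
  shows "\<phi> \<in> Hp n" "i \<in> {1..n} \<Longrightarrow> h i \<in> el X (Ob (dp \<phi> i))"
    "i \<in> {1..n} \<Longrightarrow> \<phi> i > 0 \<Longrightarrow> bd X (Ob (dp \<phi> i)) (h i) = h (\<phi> i)" "h \<in> extensional {1..n}"
  using assms by (auto simp: P_ty_def PiE_def)

lemma P_tm_restrict:
  assumes "(\<phi>, h) \<in> P_ty X n" "i \<in> {1..n}"
  shows "Elem a \<in> P_tm X i (P_restrict i (\<phi>, h)) \<longleftrightarrow> a \<in> Tm X (dp \<phi> i) (h i)"
    "Proj j \<in> P_tm X i (P_restrict i (\<phi>, h)) \<longleftrightarrow> j \<in> {1..i - 1} \<and> \<phi> i = \<phi> j \<and> h i = h j"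
  using assms dp_restrict[OF P_tyD(1)[OF assms(1)], of i i] by (auto simp: P_tm_def P_restrict_def)

text \<open>From here on, \<open>root j\<close> is the least element below \<open>j\<close> in the order
  generated by projections, \<open>\<beta>\<close> is the heap \<open>\<phi>\<close> with a bar, and
  \<open>\<psi>\<close>, \<open>\<alpha>'\<close> and \<open>h'\<close> are its pullback along
  \<open>\<alpha>\<close> and the families of inc-lists and of maps over it.\<close>

locale SP_element =
  fixes X :: "'a presheaf" and n :: nat and \<alpha> \<phi> :: "nat \<Rightarrow> nat" and h :: "nat \<Rightarrow> 'a" and k :: "nat \<Rightarrow> 'a pterm"
  assumes X: "is_presheaf X" and n: "n \<ge> 1" and SP: "(\<alpha>, \<phi>, h, k) \<in> SP_ty X n"
begin

lemma \<alpha>: "\<alpha> \<in> Inc n" and \<phi>h: "(\<phi>, h) \<in> P_ty X (\<alpha> n)"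
  and k: "i \<in> {1..\<alpha> n} - \<alpha> ` {..n} \<Longrightarrow> k i \<in> P_tm X i (P_restrict i (\<phi>, h))"
  using SP by (auto simp: SP_ty_def)

lemmas \<alpha>_simps = Inc_D[OF \<alpha>]
lemmas \<phi> = P_tyD(1)[OF \<phi>h]

lemma k_Elem: "i \<in> {1..\<alpha> n} - \<alpha> ` {..n} \<Longrightarrow> k i = Elem a \<Longrightarrow> a \<in> Tm X (dp \<phi> i) (h i)"
  using k[of i] P_tm_restrict(1)[OF \<phi>h, of i a] by simp

lemma k_Proj: "i \<in> {1..\<alpha> n} - \<alpha> ` {..n} \<Longrightarrow> k i = Proj j \<Longrightarrow> j \<in> {1..<i} \<and> \<phi> i = \<phi> j \<and> h i = h j"
  using k[of i] P_tm_restrict(2)[OF \<phi>h, of i j] by auto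

lemma n_pos: "\<alpha> n \<in> {1..\<alpha> n}"
  using \<alpha>_simps(5)[of n] n by simp

lemma off_image: "j \<in> {..\<alpha> n} - \<alpha> ` {..n} \<longleftrightarrow> j \<in> {1..\<alpha> n} - \<alpha> ` {..n}"
proof -
  have "0 \<in> \<alpha> ` {..n}" using \<alpha>_simps(1) by force
  then show ?thesis by (cases "j = 0") auto
qed

abbreviation "root \<equiv> k_min n \<alpha> k"
abbreviation "\<beta> \<equiv> bar_heap n \<alpha> k \<phi>"

text \<open>Each \<open>j\<close> has at most one immediate predecessor, namely \<open>i\<close> if \<open>k j
  = \<pi>\<^sub>i\<close>, so the minimum is found by following projections down.\<close>

lemma root_step:
  assumes "j \<in> {1..\<alpha> n} - \<alpha> ` {..n}" "k j = Proj i"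
  shows "root j = root i"
proof -
  have le: "x \<le> y" if "k_le n \<alpha> k x y" for x y
    using that unfolding k_le_def
  proof (induct rule: rtranclp_induct)
    case (step y z)
    then show ?case using k_Proj[of z y] off_image by force
  qed simp
  have iff: "k_le n \<alpha> k x j \<longleftrightarrow> x = j \<or> k_le n \<alpha> k x i" for x
    using assms off_image unfolding k_le_def by (subst rtranclp.simps) auto
  have "{x. k_le n \<alpha> k x j} = insert j {x. k_le n \<alpha> k x i}" unfolding iff by blast
  then have "Min {x. k_le n \<alpha> k x j} = Min (insert j {x. k_le n \<alpha> k x i})" by (rule arg_cong)
  also have "\<dots> = Min {x. k_le n \<alpha> k x i}"
  proof -
    have fin: "finite {x. k_le n \<alpha> k x i}" 
    proof (rule finite_subset)
      show "{x. k_le n \<alpha> k x i} \<subseteq> {..i}" using le[of _ i] by blast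
    qed simp
    have mem: "i \<in> {x. k_le n \<alpha> k x i}" by (simp add: k_le_def)
    have "Min {x. k_le n \<alpha> k x i} \<le> i" using fin mem by (rule Min_le)
    also have "i < j" using k_Proj[OF assms] by simp
    finally show ?thesis using fin mem by (subst Min_insert) auto
  qed
  finally show ?thesis by (simp add: k_min_def)
qed

lemma root_stop:
  assumes "j \<in> \<alpha> ` {..n} \<or> j > \<alpha> n \<or> (\<exists>b. k j = Elem b)"
  shows "root j = j"
proof -
  have "k_le n \<alpha> k x j \<longleftrightarrow> x = j" for x
    using assms unfolding k_le_def by (subst rtranclp.simps) auto
  then show ?thesis by (simp add: k_min_def)
qed

text \<open>A projection replaces an element by an earlier one with the same parent and the same type, and the
  process ends at a variable or at a term-element.\<close>

lemma root_props:
  assumes "j \<in> {1..\<alpha> n}"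
  shows "root j \<in> {1..j} \<and> \<phi> (root j) = \<phi> j \<and> h (root j) = h j \<and> (root j \<in> \<alpha> ` {..n} \<or> (\<exists>b. k (root j) = Elem b))"
  using assms
proof (induct j rule: less_induct)
  case (less j)
  show ?case
  proof (cases "j \<in> \<alpha> ` {..n} \<or> (\<exists>b. k j = Elem b)")
    case True
    then show ?thesis using root_stop[of j] less by auto
  next
    case False
    then obtain i where i: "k j = Proj i" by (cases "k j") auto
    have j: "j \<in> {1..\<alpha> n} - \<alpha> ` {..n}" using False less by simp
    note p = k_Proj[OF j i]
    then show ?thesis using less(1)[of i] less(2) root_step[OF j i] by auto
  qed
qed

lemma root_0 [simp]: "root 0 = 0"
  using \<alpha>_simps(1) by (intro root_stop) force

lemma \<phi>_root: "j \<le> \<alpha> n \<Longrightarrow> \<phi> (root j) = \<phi> j"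
  using root_props[of j] by (cases "j = 0") auto

lemma \<beta>_apply: "i \<le> \<alpha> n \<Longrightarrow> \<beta> i = root (\<phi> i)"
  by (simp add: bar_heap_def)

lemma root_le: "j \<le> \<alpha> n \<Longrightarrow> root j \<le> j"
  using root_props[of j] by (cases "j = 0") auto

lemma \<beta>: "\<beta> \<in> Hp (\<alpha> n)"
  unfolding Hp_def
proof (intro CollectI conjI ballI PiE_I)
  show "\<beta> 0 = 0" using Hp_D(1)[OF \<phi>] by (simp add: \<beta>_apply)
  show lt: "\<beta> i < i" if "i \<in> {1..\<alpha> n}" for i
    using that Hp_D(2)[OF \<phi> that] Hp_D(4)[OF \<phi>, of i] root_le[of "\<phi> i"] by (simp add: \<beta>_apply)
  show "\<beta> i \<in> {..\<alpha> n}" if "i \<in> {..\<alpha> n}" for i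
    using that lt[of i] \<open>\<beta> 0 = 0\<close> by (cases "i = 0") auto
  show "\<beta> i = undefined" if "i \<notin> {..\<alpha> n}" for i using that by (simp add: bar_heap_def)
qed

lemma dp_root: "j \<in> {1..\<alpha> n} \<Longrightarrow> dp \<phi> (root j) = dp \<phi> j"
  using root_props[of j] by (intro same_parent(1)[OF \<phi>]) auto

text \<open>Since \<open>root j\<close> has the same parent as \<open>j\<close>, taking roots at every step or
  only once at the end makes no difference.\<close>

lemma funpow_\<beta>: "i \<le> \<alpha> n \<Longrightarrow> (\<beta> ^^ Suc r) i = root ((\<phi> ^^ Suc r) i)"
proof (induct r)
  case 0
  then show ?case by (simp add: \<beta>_apply)
next
  case (Suc r)
  let ?j = "(\<phi> ^^ Suc r) i"
  have j: "?j \<le> \<alpha> n" using funpow_le[OF \<phi> Suc(2), of "Suc r"] Suc(2) by simp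
  have "(\<beta> ^^ Suc (Suc r)) i = \<beta> (root ?j)" using Suc by simp
  also have "\<dots> = root (\<phi> ?j)" using root_le[OF j] j \<phi>_root[OF j] by (simp add: \<beta>_apply)
  finally show ?case by simp
qed

lemma dp_\<beta>: "i \<in> {1..\<alpha> n} \<Longrightarrow> dp \<beta> i = dp \<phi> i"
proof (induct i rule: less_induct)
  case (less i)
  have le: "\<phi> i \<le> \<alpha> n" using Hp_D(4)[OF \<phi>, of i] less by simp
  show ?case
  proof (cases "\<phi> i = 0")
    case True
    then show ?thesis using dp_rec[OF \<phi> less(2)] dp_rec[OF \<beta> less(2)] less by (simp add: \<beta>_apply)
  next
    case False
    then have p: "\<phi> i \<in> {1..\<alpha> n}" using le by simp
    have r: "root (\<phi> i) \<in> {1..\<alpha> n}" using root_props[OF p] p by auto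
    have "root (\<phi> i) < i" using root_le[OF le] Hp_D(2)[OF \<phi> less(2)] by simp
    then have "dp \<beta> (root (\<phi> i)) = dp \<phi> (\<phi> i)" using less(1) r dp_root[OF p] by simp
    then show ?thesis using False dp_rec[OF \<phi> less(2)] dp_rec[OF \<beta> less(2)] less(2) r by (simp add: \<beta>_apply)
  qed
qed

lemma chain_\<beta>:
  assumes "i \<in> {1..\<alpha> n}" "l \<in> {1..<dp \<phi> i}"
  shows "chain \<beta> i l = root (chain \<phi> i l)"
proof -
  have "dp \<phi> i - l = Suc (dp \<phi> i - l - 1)" using assms(2) by auto
  then show ?thesis using funpow_\<beta>[of i "dp \<phi> i - l - 1"] assms by (simp add: chain_def dp_\<beta>)
qed

lemma \<beta>h: "(\<beta>, h) \<in> P_ty X (\<alpha> n)"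
proof -
  have "h i \<in> el X (Ob (dp \<beta> i))" if "i \<in> {1..\<alpha> n}" for i using P_tyD(2)[OF \<phi>h that] dp_\<beta>[OF that] by simp
  moreover have "bd X (Ob (dp \<beta> i)) (h i) = h (\<beta> i)" if i: "i \<in> {1..\<alpha> n}" "\<beta> i > 0" for i
  proof -
    have le: "\<phi> i \<le> \<alpha> n" using Hp_D(4)[OF \<phi>, of i] i by simp
    have b: "\<beta> i = root (\<phi> i)" using i by (simp add: \<beta>_apply)
    then have p: "\<phi> i > 0" using i(2) by (cases "\<phi> i") auto
    then have "h (root (\<phi> i)) = h (\<phi> i)" using root_props[of "\<phi> i"] le by simp
    then show ?thesis using P_tyD(3)[OF \<phi>h i(1) p] dp_\<beta>[OF i(1)] b by simp
  qed
  ultimately show ?thesis using \<beta> P_tyD(4)[OF \<phi>h] by (auto simp: P_ty_def PiE_def)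
qed

text \<open>Strict ancestors in \<open>\<beta>\<close> are roots. So the element of \<open>SPX\<close> with
  \<open>\<beta>\<close> in place of \<open>\<phi>\<close> is nearly projection-free.\<close>

lemma chain_\<beta>_not_Proj:
  assumes "i \<in> {1..\<alpha> n}" "l \<in> {1..<dp \<phi> i}" "chain \<beta> i l \<notin> \<alpha> ` {..n}"
  obtains b where "k (chain \<beta> i l) = Elem b" "b \<in> Tm X l (h (chain \<beta> i l))"
proof -
  have c: "chain \<phi> i l \<in> {1..\<alpha> n}" using chain_in(1)[OF \<phi> assms(1), of l] assms by auto
  obtain b where b: "k (chain \<beta> i l) = Elem b" using root_props[OF c] assms chain_\<beta>[OF assms(1,2)] by auto
  have "chain \<beta> i l \<in> {1..\<alpha> n}" "dp \<phi> (chain \<beta> i l) = l"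
    using chain_in[OF \<beta> assms(1), of l] assms dp_\<beta> by auto
  then show ?thesis using that[OF b] k_Elem[of "chain \<beta> i l" b] b assms(3) by simp
qed

section \<open>Pulling back along the inc-list\<close>

abbreviation "\<psi> \<equiv> pull_heap n \<alpha> \<beta>"
abbreviation "\<alpha>' \<equiv> pull_inc n \<alpha> \<beta>"

lemmas \<psi> = pull_heap(1)[OF \<alpha> \<beta>]
lemmas \<psi>_le = pull_heap(2)[OF \<alpha> \<beta>]

lemma \<alpha>'_simps: "\<alpha>' p 0 = 0" "l \<in> {1..dp \<psi> p} \<Longrightarrow> \<alpha>' p l = dp \<beta> (\<alpha> (chain \<psi> p l))"
  by (auto simp: pull_inc_def)

lemma \<alpha>_in: "p \<in> {1..n} \<Longrightarrow> \<alpha> p \<in> {1..\<alpha> n}"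
  by (rule \<alpha>_simps(5))

text \<open>The inc-list \<open>\<alpha>' p\<close> records at which depths the chain of ancestors of
  \<open>\<alpha> p\<close> meets the image of \<open>\<alpha>\<close>.\<close>

lemma \<alpha>_chain:
  assumes "p \<in> {1..n}" "l \<in> {1..dp \<psi> p}"
  shows "\<alpha> (chain \<psi> p l) = chain \<beta> (\<alpha> p) (\<alpha>' p l)" "\<alpha>' p l \<in> {1..dp \<beta> (\<alpha> p)}"
proof -
  have c: "chain \<psi> p l \<in> {1..n}" using chain_in(1)[OF \<psi> assms] assms by auto
  have "heap_le \<beta> (\<alpha> (chain \<psi> p l)) (\<alpha> p)" using \<psi>_le[OF c assms(1)] heap_le_chainI by blast
  then show "\<alpha> (chain \<psi> p l) = chain \<beta> (\<alpha> p) (\<alpha>' p l)" "\<alpha>' p l \<in> {1..dp \<beta> (\<alpha> p)}"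
    using heap_le_chain[OF \<beta> \<alpha>_in[OF c] \<alpha>_in[OF assms(1)]] \<alpha>'_simps(2)[OF assms(2)]
      dp_pos[OF \<beta>, of "\<alpha> (chain \<psi> p l)"] \<alpha>_in[OF c] by auto
qed

lemma \<alpha>'_top: "p \<in> {1..n} \<Longrightarrow> \<alpha>' p (dp \<psi> p) = dp \<beta> (\<alpha> p)"
  using \<alpha>'_simps(2)[of "dp \<psi> p" p] dp_pos[OF \<psi>, of p] by simp

lemma \<alpha>'_Inc:
  assumes p: "p \<in> {1..n}"
  shows "\<alpha>' p \<in> Inc (dp \<psi> p)"
proof -
  have "\<alpha>' p l < \<alpha>' p l'" if "l < l'" "l' \<le> dp \<psi> p" for l l'
  proof (cases "l = 0")
    case True
    then show ?thesis using \<alpha>_chain(2)[OF p, of l'] that by (simp add: \<alpha>'_simps)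
  next
    case False
    then have l: "l \<in> {1..dp \<psi> p}" "l' \<in> {1..dp \<psi> p}" using that by auto
    then have "chain \<psi> p l < chain \<psi> p l'" using chain_strict_mono[OF \<psi> p, of l l'] that by simp
    then have "\<alpha> (chain \<psi> p l) < \<alpha> (chain \<psi> p l')"
      using \<alpha>_simps(2)[of "chain \<psi> p l" "chain \<psi> p l'"] chain_in(1)[OF \<psi> p l(1)] chain_in(1)[OF \<psi> p l(2)] p by auto
    then have *: "chain \<beta> (\<alpha> p) (\<alpha>' p l) < chain \<beta> (\<alpha> p) (\<alpha>' p l')" using \<alpha>_chain(1)[OF p] l by simp
    show ?thesis
    proof (rule ccontr)
      assume "\<not> \<alpha>' p l < \<alpha>' p l'"
      then consider "\<alpha>' p l' < \<alpha>' p l" | "\<alpha>' p l = \<alpha>' p l'" by linarith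
      then show False
        using * chain_strict_mono[OF \<beta> \<alpha>_in[OF p], of "\<alpha>' p l'" "\<alpha>' p l"] \<alpha>_chain(2)[OF p] l by cases auto
    qed
  qed
  then show ?thesis by (auto simp: Inc_def strict_mono_on_def \<alpha>'_simps pull_inc_def extensional_def)
qed

lemma in_image_\<alpha>':
  assumes p: "p \<in> {1..n}" and j: "j \<in> {1..dp \<beta> (\<alpha> p)}"
  shows "j \<in> \<alpha>' p ` {..dp \<psi> p} \<longleftrightarrow> chain \<beta> (\<alpha> p) j \<in> \<alpha> ` {..n}"
proof
  assume "j \<in> \<alpha>' p ` {..dp \<psi> p}"
  then obtain l where l: "j = \<alpha>' p l" "l \<le> dp \<psi> p" by auto
  then have l1: "l \<in> {1..dp \<psi> p}" using j \<alpha>'_simps(1)[of p] by (cases "l = 0") auto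
  then have "chain \<beta> (\<alpha> p) j = \<alpha> (chain \<psi> p l)" using \<alpha>_chain(1)[OF p l1] l by simp
  moreover have "chain \<psi> p l \<le> n" using chain_in(1)[OF \<psi> p l1] p by simp
  ultimately show "chain \<beta> (\<alpha> p) j \<in> \<alpha> ` {..n}" by simp
next
  assume "chain \<beta> (\<alpha> p) j \<in> \<alpha> ` {..n}"
  then obtain q where q: "chain \<beta> (\<alpha> p) j = \<alpha> q" "q \<le> n" by auto
  note c = chain_in[OF \<beta> \<alpha>_in[OF p] j]
  have q1: "q \<in> {1..n}" using q c(1) \<alpha>_simps(1) by (cases "q = 0") auto
  have "heap_le \<psi> q p" using \<psi>_le[OF q1 p] q(1) heap_le_chainI by metis
  then have "q = chain \<psi> p (dp \<psi> q)" "dp \<psi> q \<le> dp \<psi> p" using heap_le_chain[OF \<psi> q1 p] by auto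
  moreover have "dp \<psi> q \<ge> 1" using dp_pos[OF \<psi>] q(2) by blast
  ultimately have "\<alpha>' p (dp \<psi> q) = dp \<beta> (\<alpha> q)" "dp \<psi> q \<le> dp \<psi> p" using \<alpha>'_simps(2)[of "dp \<psi> q" p] by auto
  moreover have "dp \<beta> (\<alpha> q) = j" using c(2) q(1) by simp
  ultimately show "j \<in> \<alpha>' p ` {..dp \<psi> p}" by (metis atMost_iff image_eqI)
qed

abbreviation "h' \<equiv> pull_map n \<alpha> \<beta> h k"

lemma h'_Ob: "p \<in> {1..n} \<Longrightarrow> i \<in> {1..dp \<beta> (\<alpha> p)} \<Longrightarrow> h' p (Ob i) = h (chain \<beta> (\<alpha> p) i)"
  using \<alpha>'_top[of p] by (auto simp: pull_map_def cells_def)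

lemma h'_ObT: "p \<in> {1..n} \<Longrightarrow> i \<in> {1..dp \<beta> (\<alpha> p)} \<Longrightarrow> i \<notin> \<alpha>' p ` {..dp \<psi> p} \<Longrightarrow>
    h' p (ObT i) = elem_of (k (chain \<beta> (\<alpha> p) i))"
  using \<alpha>'_top[of p] by (auto simp: pull_map_def cells_def)

lemma off_\<alpha>'_Elem:
  assumes p: "p \<in> {1..n}" and i: "i \<in> {1..dp \<beta> (\<alpha> p)}" "i \<notin> \<alpha>' p ` {..dp \<psi> p}"
  shows "k (chain \<beta> (\<alpha> p) i) = Elem (h' p (ObT i))" "h' p (ObT i) \<in> Tm X i (h (chain \<beta> (\<alpha> p) i))" "i < dp \<beta> (\<alpha> p)"
proof -
  have "i \<noteq> dp \<beta> (\<alpha> p)" using \<alpha>'_top[OF p] i(2) by (metis atMost_iff image_eqI order_refl)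
  then show lt: "i < dp \<beta> (\<alpha> p)" using i by simp
  then have "i \<in> {1..<dp \<phi> (\<alpha> p)}" using i dp_\<beta>[OF \<alpha>_in[OF p]] by simp
  moreover have "chain \<beta> (\<alpha> p) i \<notin> \<alpha> ` {..n}" using in_image_\<alpha>'[OF p i(1)] i(2) by simp
  ultimately obtain b where "k (chain \<beta> (\<alpha> p) i) = Elem b" "b \<in> Tm X i (h (chain \<beta> (\<alpha> p) i))"
    using chain_\<beta>_not_Proj[OF \<alpha>_in[OF p]] by blast
  then show "k (chain \<beta> (\<alpha> p) i) = Elem (h' p (ObT i))" "h' p (ObT i) \<in> Tm X i (h (chain \<beta> (\<alpha> p) i))"
    using h'_ObT[OF p i] by simp_all
qed

lemma chain_el: "p \<in> {1..n} \<Longrightarrow> i \<in> {1..dp \<beta> (\<alpha> p)} \<Longrightarrow> h (chain \<beta> (\<alpha> p) i) \<in> el X (Ob i)"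
  using chain_in[OF \<beta> \<alpha>_in, of p i] P_tyD(2)[OF \<beta>h, of "chain \<beta> (\<alpha> p) i"] \<alpha>_in[of p] by auto

lemma pulled_S_ty:
  assumes p: "p \<in> {1..n}"
  shows "(\<alpha>' p, h' p) \<in> S_ty X (dp \<psi> p)"
proof -
  have cells: "cells (dp \<psi> p) (\<alpha>' p) = Ob ` {1..dp \<beta> (\<alpha> p)} \<union> ObT ` ({1..dp \<beta> (\<alpha> p)} - \<alpha>' p ` {..dp \<psi> p})"
    by (simp add: cells_def \<alpha>'_top[OF p])
  have ext: "h' p \<in> extensional (cells (dp \<psi> p) (\<alpha>' p))" by (simp add: pull_map_def)
  have el: "h' p ob \<in> el X ob" if "ob \<in> cells (dp \<psi> p) (\<alpha>' p)" for ob
    using that off_\<alpha>'_Elem(2)[OF p] chain_el[OF p] h'_Ob[OF p] unfolding cells by (auto simp: Tm_def)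
  have bd: "bd X ob (h' p ob) = h' p (below ob)" if ob: "ob \<in> cells (dp \<psi> p) (\<alpha>' p)" "ob \<noteq> Ob 1" for ob
  proof (cases ob)
    case (Ob i)
    then have i: "i \<in> {1..dp \<beta> (\<alpha> p)}" "i - 1 \<in> {1..dp \<beta> (\<alpha> p)}" using ob unfolding cells by auto
    note c = chain_in[OF \<beta> \<alpha>_in[OF p] i(1)]
    have "\<beta> (chain \<beta> (\<alpha> p) i) = chain \<beta> (\<alpha> p) (i - 1)" using chain_Suc[of "i - 1" \<beta> "\<alpha> p"] i by simp
    then have "bd X (Ob i) (h (chain \<beta> (\<alpha> p) i)) = h (chain \<beta> (\<alpha> p) (i - 1))"
      using P_tyD(3)[OF \<beta>h, of "chain \<beta> (\<alpha> p) i"] c chain_in(1)[OF \<beta> \<alpha>_in[OF p] i(2)] \<alpha>_in[OF p] by auto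
    then show ?thesis using Ob h'_Ob[OF p] i by simp
  next
    case (ObT i)
    then have i: "i \<in> {1..dp \<beta> (\<alpha> p)}" "i \<notin> \<alpha>' p ` {..dp \<psi> p}" using ob unfolding cells by auto
    then show ?thesis using ObT off_\<alpha>'_Elem(2)[OF p i] h'_Ob[OF p i(1)] by (simp add: Tm_def)
  qed
  show ?thesis using \<alpha>'_Inc[OF p] ext el bd by (auto simp: S_ty_def PiE_def)
qed

text \<open>The data at \<open>p\<close> up to a given depth depend only on the ancestors of \<open>p\<close>
  up to that depth.\<close>

lemma pulled_congruence:
  assumes p: "p \<in> {1..n}" and q: "q \<in> {1..n}" and m: "m \<le> dp \<psi> p" "m \<le> dp \<psi> q"
    and chain: "\<And>l. l \<in> {1..m} \<Longrightarrow> chain \<psi> p l = chain \<psi> q l"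
  shows "l \<le> m \<Longrightarrow> \<alpha>' p l = \<alpha>' q l"
    and "i \<in> {1..\<alpha>' p m} \<Longrightarrow> chain \<beta> (\<alpha> p) i = chain \<beta> (\<alpha> q) i"
proof -
  show eq: "\<alpha>' p l = \<alpha>' q l" if "l \<le> m" for l
    using that m chain[of l] \<alpha>'_simps[where p = p] \<alpha>'_simps[where p = q] by (cases "l = 0") auto
  show "chain \<beta> (\<alpha> p) i = chain \<beta> (\<alpha> q) i" if i: "i \<in> {1..\<alpha>' p m}"
  proof -
    have m1: "m \<in> {1..dp \<psi> p}" "m \<in> {1..dp \<psi> q}" using i m \<alpha>'_simps(1)[of p] by (cases "m = 0"; simp)+
    have "chain \<beta> (\<alpha> p) i = chain \<beta> (\<alpha> (chain \<psi> p m)) i"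
      using \<alpha>_chain[OF p m1(1)] chain_chain[OF \<beta> \<alpha>_in[OF p], of "\<alpha>' p m" i] i by simp
    also have "\<dots> = chain \<beta> (\<alpha> (chain \<psi> q m)) i" using chain[of m] m1 by simp
    also have "\<dots> = chain \<beta> (\<alpha> q) i"
      using \<alpha>_chain[OF q m1(2)] chain_chain[OF \<beta> \<alpha>_in[OF q], of "\<alpha>' q m" i] i eq[of m] by simp
    finally show ?thesis .
  qed
qed

lemma to_PS_ty: "to_PS n (\<alpha>, \<beta>, h, k) \<in> PS_ty X n"
proof -
  have "S_bd (dp \<psi> p) (\<alpha>' p, h' p) = (\<alpha>' (\<psi> p), h' (\<psi> p))" if p: "p \<in> {1..n}" "\<psi> p > 0" for p
  proof -
    let ?q = "\<psi> p" and ?m = "dp \<psi> p - 1"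
    have q: "?q \<in> {1..n}" using p Hp_D(4)[OF \<psi>, of p] by simp
    have dq: "dp \<psi> ?q = ?m" "dp \<psi> p = Suc ?m" using dp_rec[OF \<psi> p(1)] p(2) by simp_all
    have ch: "chain \<psi> p l = chain \<psi> ?q l" if "l \<in> {1..?m}" for l
      using chain_parent(1)[OF \<psi> p(1), of l] that by (cases "dp \<psi> p") auto
    note c = pulled_congruence[OF p(1) q, of ?m, OF _ _ ch]
    have m: "?m \<le> dp \<psi> p" "?m \<le> dp \<psi> ?q" using dq by simp_all
    have a: "\<alpha>' p l = \<alpha>' ?q l" if "l \<le> ?m" for l using c(1)[OF m _ that] by simp
    have top: "\<alpha>' p ?m = dp \<beta> (\<alpha> ?q)" using a[of ?m] \<alpha>'_top[OF q] dq by simp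
    have "restrict (\<alpha>' p) {..?m} = \<alpha>' ?q"
      using a \<alpha>'_Inc[OF q] dq(1) by (auto simp: Inc_def restrict_def extensional_def fun_eq_iff)
    moreover have "restrict (h' p) (cells ?m (\<alpha>' p)) = h' ?q"
    proof
      fix ob
      have im: "\<alpha>' p ` {..?m} = \<alpha>' ?q ` {..dp \<psi> ?q}" using a dq by (auto simp: image_iff)
      have cells: "cells ?m (\<alpha>' p) = cells (dp \<psi> ?q) (\<alpha>' ?q)"
        unfolding cells_def im using top \<alpha>'_top[OF q] by simp
      show "restrict (h' p) (cells ?m (\<alpha>' p)) ob = h' ?q ob"
      proof (cases "ob \<in> cells ?m (\<alpha>' p)")
        case False
        then show ?thesis unfolding cells by (simp add: pull_map_def)
      next
        case True
        have lt: "\<alpha>' p ?m < \<alpha>' p (dp \<psi> p)" using Inc_D(2)[OF \<alpha>'_Inc[OF p(1)], of ?m "dp \<psi> p"] dq by simp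
        then have le: "\<alpha>' p ?m \<le> dp \<beta> (\<alpha> p)" using \<alpha>'_top[OF p(1)] by simp
        show ?thesis
        proof (cases ob)
          case (Ob i)
          then have i: "i \<in> {1..\<alpha>' p ?m}" using True by (auto simp: cells_def)
          then show ?thesis using True Ob h'_Ob[OF p(1), of i] h'_Ob[OF q, of i] c(2)[OF m _ i] le top by simp
        next
          case (ObT i)
          then have i: "i \<in> {1..\<alpha>' p ?m}" "i \<notin> \<alpha>' p ` {..?m}" using True by (auto simp: cells_def)
          have "i \<notin> \<alpha>' p ` {..dp \<psi> p}"
          proof
            assume "i \<in> \<alpha>' p ` {..dp \<psi> p}"
            then obtain l where l: "i = \<alpha>' p l" "l \<le> dp \<psi> p" by auto
            then have "l = dp \<psi> p" using i(2) dq by (cases "l = dp \<psi> p") auto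
            then show False using l i(1) lt by simp
          qed
          moreover have "i \<notin> \<alpha>' ?q ` {..dp \<psi> ?q}" using i(2) im by simp
          ultimately show ?thesis
            using True ObT h'_ObT[OF p(1), of i] h'_ObT[OF q, of i] c(2)[OF m _ i(1)] i(1) le top by simp
        qed
      qed
    qed
    ultimately show ?thesis by (simp add: S_bd_def)
  qed
  moreover have "\<psi> p \<in> {1..n}" if "p \<in> {1..n}" "\<psi> p > 0" for p using that Hp_D(4)[OF \<psi>, of p] by simp
  ultimately show ?thesis using \<psi> pulled_S_ty by (auto simp: to_PS_def PS_ty_def)
qed

end

section \<open>Derivability of the canonical judgements of \<open>P\<close>\<close>

text \<open>A judgement in a subcontext is weakened to the whole context by inserting the missing variables
  from left to right: once the context agrees with the whole one up to \<open>m\<close>, the next type is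
  derivable in precisely the part already completed.\<close>

lemma weaken_all:
  fixes T :: "nat \<Rightarrow> 'a fsym expr"
  assumes X: "is_presheaf X" and D: "structural_ok D" "Wk \<in> D"
    and ty: "\<And>m. m \<in> {1..<i} \<Longrightarrow> fderiv D X (Judg (map (\<lambda>j. (j, T j)) [1..<m]) (IsType (T m)))"
    and R: "fderiv D X (Judg (map (\<lambda>j. (j, T j)) (filter Q [1..<i])) R)"
  shows "fderiv D X (Judg (map (\<lambda>j. (j, T j)) [1..<i]) R)"
proof -
  let ?c = "map (\<lambda>j. (j, T j))"
  have *: "fderiv D X (Judg (?c [1..<Suc m] @ ?c (filter Q [Suc m..<i])) R)" if "Suc m \<le> i" for m
    using that
  proof (induct m)
    case 0
    then show ?case using R by simp
  next
    case (Suc m)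
    have split: "[Suc m..<i] = Suc m # [Suc (Suc m)..<i]" using Suc(2) by (simp add: upt_conv_Cons)
    show ?case
    proof (cases "Q (Suc m)")
      case True
      then show ?thesis using Suc split by simp
    next
      case False
      then have IH: "fderiv D X (Judg (?c [1..<Suc m] @ ?c (filter Q [Suc (Suc m)..<i])) R)" using Suc split by simp
      have "jvars (Judg (?c [1..<Suc m] @ ?c (filter Q [Suc (Suc m)..<i])) R)
          = set [1..<Suc m] \<union> set (filter Q [Suc (Suc m)..<i])"
        using fderiv_jvars[OF X D(1) IH] by (simp add: image_Un image_image)
      moreover have "ctx_vars \<Gamma> \<union> ctx_vars \<Delta> \<subseteq> jvars (Judg (\<Gamma> @ \<Delta>) R)" for \<Gamma> \<Delta>
        by (simp add: jvars_def)
      moreover have "Suc m \<notin> set [1..<Suc m] \<union> set (filter Q [Suc (Suc m)..<i])" by simp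
      ultimately have "Suc m \<notin> ctx_vars (?c [1..<Suc m]) \<union> ctx_vars (?c (filter Q [Suc (Suc m)..<i]))"
        by (metis (no_types, lifting) subsetD)
      from fderiv.weaken[OF D(2) this _ IH, of "T (Suc m)"] ty[of "Suc m"] Suc(2) show ?thesis by simp
    qed
  qed
  show ?thesis
  proof (cases i)
    case 0
    then show ?thesis using R by simp
  next
    case (Suc m)
    then show ?thesis using *[of m] by simp
  qed
qed

lemma filter_mem_upt:
  fixes xs :: "nat list"
  assumes "sorted_wrt (<) xs" "set xs \<subseteq> {m..<n}"
  shows "filter (\<lambda>j. j \<in> set xs) [m..<n] = xs"
  by (rule increasing_list_unique) (use assms sorted_wrt_filter[OF sorted_wrt_upt] in auto)

text \<open>In a map from a heap to \<open>X\<close>, iterated boundaries are values at ancestors.\<close>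

lemma bd_iter_heap:
  assumes "(\<phi>, h) \<in> P_ty X n"
  shows "i \<in> {1..n} \<Longrightarrow> l \<ge> 1 \<Longrightarrow> dp \<phi> i = l + d \<Longrightarrow> bd_iter X l d (h i) = h (chain \<phi> i l)"
proof (induct d arbitrary: i)
  case 0
  then show ?case using chain_top[of \<phi> i] by simp
next
  case (Suc d)
  note \<phi> = P_tyD[OF assms]
  have p: "chain \<phi> i l = chain \<phi> (\<phi> i) l" "\<phi> i > 0" "dp \<phi> (\<phi> i) = dp \<phi> i - 1"
    using chain_parent[OF \<phi>(1) Suc(2), of l] Suc(3,4) by simp_all
  have "\<phi> i \<in> {1..n}" using p(2) Hp_D(4)[OF \<phi>(1), of i] Suc(2) by simp
  then have "bd_iter X l d (h (\<phi> i)) = h (chain \<phi> (\<phi> i) l)" using Suc p by simp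
  moreover have "bd X (Ob (l + Suc d)) (h i) = h (\<phi> i)" using \<phi>(3)[OF Suc(2) p(2)] Suc(4) by simp
  ultimately show ?case using p(1) by simp
qed

lemma ren_App: "ren \<sigma> (App c es) = App c (map (ren \<sigma>) es)"
  by (simp add: ren_def)

text \<open>A generating judgement, renamed by a permutation that sends \<open>l\<close> to the ancestor of
  \<open>i\<close> of depth \<open>l\<close>: the context consists of the strict ancestors of \<open>i\<close>
  alone.\<close>

lemma P_chain_fderiv:
  fixes X :: "'a presheaf"
  assumes X: "is_presheaf X" and P: "(\<phi>, h) \<in> P_ty X n" and i: "i \<in> {1..n}"
  defines "\<Gamma> \<equiv> map (\<lambda>j. (j, P_type \<phi> h j)) (map (chain \<phi> i) [1..<dp \<phi> i])"
  shows "fderiv D X (Judg \<Gamma> (IsType (P_type \<phi> h i)))"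
    and "a \<in> Tm X (dp \<phi> i) (h i) \<Longrightarrow> fderiv D X (Judg \<Gamma> (HasType (App (Inr (dp \<phi> i, a)) (P_args \<phi> i)) (P_type \<phi> h i)))"
proof -
  let ?r = "dp \<phi> i"
  note \<phi> = P_tyD[OF P]
  have r: "?r \<ge> 1" using dp_pos[OF \<phi>(1)] i by simp
  have "distinct (map (chain \<phi> i) [1..<?r])"
    using chain_strict_mono[OF \<phi>(1) i] by (auto simp: distinct_map inj_on_def) (metis less_imp_le nat_neq_iff less_not_refl One_nat_def)
  then obtain \<sigma> where \<sigma>: "bij \<sigma>" "map \<sigma> [1..<?r] = map (chain \<phi> i) [1..<?r]"
    using permutation_between_lists[of "[1..<?r]" "map (chain \<phi> i) [1..<?r]"] by auto
  have \<sigma>l: "\<sigma> l = chain \<phi> i l" if "l \<in> {1..<?r}" for l using \<sigma>(2) that by simp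
  have args: "map (ren \<sigma>) (gen_vars l) = map (\<lambda>l'. V (chain \<phi> i l')) [1..<l]" if "l \<le> ?r" for l
    using that \<sigma>l by (simp add: gen_vars_def ren_def)
  have ty: "ren \<sigma> (gen_type l (h (chain \<phi> i l))) = P_type \<phi> h (chain \<phi> i l)" if l: "l \<in> {1..?r}" for l
  proof -
    have "(P_args \<phi> (chain \<phi> i l) :: 'a fsym expr list) = map (\<lambda>l'. V (chain \<phi> i l')) [1..<l]"
      using chain_in(2)[OF \<phi>(1) i l] chain_chain[OF \<phi>(1) i l] by (simp add: P_args_def)
    then show ?thesis using args[of l] l chain_in(2)[OF \<phi>(1) i l]
      by (simp add: gen_type_def P_type_def ren_App)
  qed
  have ctx: "map (\<lambda>(x, T). (\<sigma> x, ren \<sigma> T)) (gen_ctx X ?r (h i)) = \<Gamma>"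
    unfolding gen_ctx_def \<Gamma>_def map_map
  proof (rule map_cong[OF refl])
    fix l assume "l \<in> set [1..<?r]"
    then have l: "l \<in> {1..<?r}" by simp
    then have "bd_iter X l (?r - l) (h i) = h (chain \<phi> i l)" using bd_iter_heap[OF P i, of l "?r - l"] by simp
    then show "((\<lambda>(x, T). (\<sigma> x, ren \<sigma> T)) \<circ> (\<lambda>l. (l, gen_type l (bd_iter X l (?r - l) (h i))))) l
        = ((\<lambda>j. (j, P_type \<phi> h j)) \<circ> chain \<phi> i) l"
      using \<sigma>l[OF l] ty[of l] l by simp
  qed
  have tyi: "ren \<sigma> (gen_type ?r (h i)) = P_type \<phi> h i" using ty[of ?r] r by simp
  have "fderiv D X (perm_judgement \<sigma> (gen_judgement X (Ob ?r) (h i)))"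
    by (intro fderiv.perm \<sigma>(1) fderiv.gen) (use \<phi>(2)[OF i] r in simp_all)
  then show "fderiv D X (Judg \<Gamma> (IsType (P_type \<phi> h i)))" using ctx tyi by simp
  assume a: "a \<in> Tm X ?r (h i)"
  have "fderiv D X (perm_judgement \<sigma> (gen_judgement X (ObT ?r) a))"
    by (intro fderiv.perm \<sigma>(1) fderiv.gen) (use a r in \<open>simp_all add: Tm_def\<close>)
  moreover have "ren \<sigma> (App (Inr (?r, a)) (gen_vars ?r) :: 'a fsym expr) = App (Inr (?r, a)) (P_args \<phi> i)"
    using args[of ?r] by (simp add: P_args_def ren_App)
  ultimately show "fderiv D X (Judg \<Gamma> (HasType (App (Inr (?r, a)) (P_args \<phi> i)) (P_type \<phi> h i)))"
    using ctx tyi a by (simp add: Tm_def)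
qed

lemma P_ctx_filter:
  assumes "\<phi> \<in> Hp n" "i \<in> {1..n}"
  shows "map (chain \<phi> i) [1..<dp \<phi> i] = filter (\<lambda>j. j \<in> set (map (chain \<phi> i) [1..<dp \<phi> i])) [1..<i]"
proof (rule filter_mem_upt[symmetric])
  show "sorted_wrt (<) (map (chain \<phi> i) [1..<dp \<phi> i])"
    unfolding sorted_wrt_map by (rule sorted_wrt_mono_rel[OF _ sorted_wrt_upt]) (use chain_strict_mono[OF assms] in auto)
  show "set (map (chain \<phi> i) [1..<dp \<phi> i]) \<subseteq> {1..<i}"
  proof
    fix j assume "j \<in> set (map (chain \<phi> i) [1..<dp \<phi> i])"
    then obtain l where l: "l \<in> {1..<dp \<phi> i}" "j = chain \<phi> i l" by auto
    then show "j \<in> {1..<i}"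
      using chain_strict_mono[OF assms, of l "dp \<phi> i"] chain_in(1)[OF assms, of l] by simp
  qed
qed

lemma P_weaken:
  assumes X: "is_presheaf X" and D: "structural_ok D" "Wk \<in> D" and \<phi>: "\<phi> \<in> Hp n" and i: "i \<in> {1..n}"
    and ty: "\<And>m. m \<in> {1..<i} \<Longrightarrow> fderiv D X (Judg (P_ctx m \<phi> h) (IsType (P_type \<phi> h m)))"
    and R: "fderiv D X (Judg (map (\<lambda>j. (j, P_type \<phi> h j)) (map (chain \<phi> i) [1..<dp \<phi> i])) R)"
  shows "fderiv D X (Judg (P_ctx i \<phi> h) R)"
proof -
  define Q where "Q = (\<lambda>j. j \<in> set (map (chain \<phi> i) [1..<dp \<phi> i]))"
  have eq: "map (chain \<phi> i) [1..<dp \<phi> i] = filter Q [1..<i]" unfolding Q_def by (rule P_ctx_filter[OF \<phi> i])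
  have "fderiv D X (Judg (map (\<lambda>j. (j, P_type \<phi> h j)) (filter Q [1..<i])) R)" using R unfolding eq .
  then show ?thesis using weaken_all[OF X D, of i "P_type \<phi> h"] ty by (simp only: P_ctx_def)
qed

lemma P_type_fderiv:
  assumes X: "is_presheaf X" and P: "(\<phi>, h) \<in> P_ty X n" and D: "structural_ok D" "Wk \<in> D"
  shows "i \<in> {1..n} \<Longrightarrow> fderiv D X (Judg (P_ctx i \<phi> h) (IsType (P_type \<phi> h i)))"
proof (induct i rule: less_induct)
  case (less i)
  show ?case
    by (rule P_weaken[OF X D P_tyD(1)[OF P] less(2) _ P_chain_fderiv(1)[OF X P less(2)]]) (use less in simp)
qed

lemma P_type_cong:
  assumes P: "(\<phi>, h) \<in> P_ty X n" and i: "i \<in> {1..n}" "j \<in> {1..n}" "\<phi> i = \<phi> j" "h i = h j"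
  shows "P_type \<phi> h i = P_type \<phi> h j"
  using same_parent[OF P_tyD(1)[OF P] i(1-3)] i(4) by (simp add: P_type_def P_args_def)

abbreviation P_term :: "(nat \<Rightarrow> nat) \<Rightarrow> nat \<Rightarrow> 'a pterm \<Rightarrow> 'a fsym expr" where
  "P_term \<phi> n a \<equiv> (case a of Elem b \<Rightarrow> App (Inr (dp \<phi> n, b)) (P_args \<phi> n) | Proj i \<Rightarrow> V i)"

lemma P_term_fderiv:
  assumes X: "is_presheaf X" and P: "(\<phi>, h) \<in> P_ty X n" and n: "n \<ge> 1" and a: "a \<in> P_tm X n (\<phi>, h)"
  shows "fderiv DP X (Judg (P_ctx n \<phi> h) (HasType (P_term \<phi> n a) (P_type \<phi> h n)))"
proof -
  have ty: "fderiv DP X (Judg (map (\<lambda>j. (j, P_type \<phi> h j)) [1..<m]) (IsType (P_type \<phi> h m)))" if "m \<in> {1..<n}" for m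
    using P_type_fderiv[OF X P, of DP m] that by (simp add: P_ctx_def)
  have nn: "n \<in> {1..n}" using n by simp
  show ?thesis
  proof (cases a)
    case (Elem b)
    then have b: "b \<in> Tm X (dp \<phi> n) (h n)" using a by (auto simp: P_tm_def)
    show ?thesis unfolding Elem pterm.case
      by (rule P_weaken[OF X _ _ P_tyD(1)[OF P] nn _ P_chain_fderiv(2)[OF X P nn b]])
        (use P_type_fderiv[OF X P, of DP] in simp_all)
  next
    case (Proj i)
    then have i: "i \<in> {1..n - 1}" "\<phi> n = \<phi> i" "h n = h i" using a by (auto simp: P_tm_def)
    then have in': "i \<in> {1..n}" by auto
    have T: "P_type \<phi> h n = P_type \<phi> h i" using P_type_cong[OF P nn in'] i by simp
    \<comment> \<open>The variable \<open>i\<close> is introduced at the end of the context cut off after \<open>i\<close>, and the later variables are added by weakening.\<close>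
    have d: "fderiv DP X (Judg (P_ctx i \<phi> h) (IsType (P_type \<phi> h i)))" using P_type_fderiv[OF X P _ _ in', of DP] by simp
    have "ctx_vars (P_ctx i \<phi> h) \<subseteq> jvars (Judg (P_ctx i \<phi> h) (IsType (P_type \<phi> h i)))" by (simp add: jvars_def)
    also have "\<dots> = {1..<i}" using fderiv_jvars[OF X _ d] by (simp add: P_ctx_def image_image)
    finally have "fderiv DP X (Judg (P_ctx i \<phi> h @ [(i, P_type \<phi> h i)]) (HasType (V i) (P_type \<phi> h i)))"
      by (intro fderiv.project d) auto
    moreover have "P_ctx i \<phi> h @ [(i, P_type \<phi> h i)] = map (\<lambda>j. (j, P_type \<phi> h j)) (filter (\<lambda>j. j \<in> set [1..<Suc i]) [1..<n])"
    proof -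
      have "filter (\<lambda>j. j \<in> set [1..<Suc i]) [1..<n] = [1..<Suc i]"
        by (rule filter_mem_upt[OF sorted_wrt_upt]) (use i in auto)
      then show ?thesis using i by (simp add: P_ctx_def)
    qed
    ultimately have "fderiv DP X (Judg (map (\<lambda>j. (j, P_type \<phi> h j)) (filter (\<lambda>j. j \<in> set [1..<Suc i]) [1..<n])) (HasType (V i) (P_type \<phi> h i)))"
      by simp
    from weaken_all[OF X _ _ ty this] show ?thesis by (simp add: P_ctx_def Proj T)
  qed
qed

section \<open>Derivability of the canonical judgements of \<open>S\<close>\<close>

lemma S_tyD:
  assumes "(\<alpha>, h) \<in> S_ty X n"
  shows "\<alpha> \<in> Inc n" "ob \<in> cells n \<alpha> \<Longrightarrow> h ob \<in> el X ob" "ob \<in> cells n \<alpha> \<Longrightarrow> ob \<noteq> Ob 1 \<Longrightarrow> bd X ob (h ob) = h (below ob)"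
    "h \<in> extensional (cells n \<alpha>)"
  using assms by (auto simp: S_ty_def PiE_def)

context
  fixes X :: "'a presheaf" and n :: nat and \<alpha> :: "nat \<Rightarrow> nat" and h :: "hobj \<Rightarrow> 'a"
  assumes X: "is_presheaf X" and n: "n \<ge> 1" and S: "(\<alpha>, h) \<in> S_ty X n"
begin

lemmas SD = S_tyD[OF S]
lemmas ID = Inc_D[OF SD(1)]

lemma bd_iter_S: "j \<ge> 1 \<Longrightarrow> j + d \<le> \<alpha> n \<Longrightarrow> bd_iter X j d (h (Ob (j + d))) = h (Ob j)"
proof (induct d)
  case (Suc d)
  have "bd X (Ob (j + Suc d)) (h (Ob (j + Suc d))) = h (Ob (j + d))"
    using SD(3)[of "Ob (j + Suc d)"] Suc(2,3) by (simp add: cells_def)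
  then show ?case using Suc by simp
qed simp

lemma term_cell:
  assumes "j \<in> {1..\<alpha> n}" "j \<notin> \<alpha> ` {..n}"
  shows "h (ObT j) \<in> Tm X j (h (Ob j))"
  using SD(2)[of "ObT j"] SD(3)[of "ObT j"] assms by (simp add: cells_def Tm_def)

text \<open>The judgement belonging to an inc-list arises from a generating judgement by substituting, one after the other,
  terms for the variables that are not in the image of \<open>\<alpha>\<close>. During this process it is convenient to keep the
  variable names of the generating judgement, so \<open>e j\<close> is the argument \<open>e\<^sub>j\<close> with each \<open>V m\<close> replaced by
  \<open>V (\<alpha> m)\<close>; a single permutation at the end restores the names \<open>1, \<dots>, n - 1\<close>.\<close>

private definition "e j = ren \<alpha> (S_arg n \<alpha> h j)"

private lemma e_image: "j \<in> \<alpha> ` {..n} \<Longrightarrow> e j = V j"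
  unfolding e_def by (subst S_arg.simps) (simp add: ren_def f_inv_into_f)

private lemma e_cell: "j \<notin> \<alpha> ` {..n} \<Longrightarrow> e j = App (Inr (j, h (ObT j))) (map e [1..<j])"
  unfolding e_def by (subst S_arg.simps) (simp add: ren_def)

private lemma zero_image: "0 \<in> \<alpha> ` {..n}"
  using ID(1) by force

private lemma fv_e: "fv (e j) \<subseteq> \<alpha> ` {..n} \<inter> {..j}"
proof (induct j rule: less_induct)
  case (less j)
  show ?case
  proof (cases "j \<in> \<alpha> ` {..n}")
    case True
    then show ?thesis by (simp add: e_image)
  next
    case False
    have "fv (e i) \<subseteq> \<alpha> ` {..n} \<inter> {..j}" if "i \<in> set [1..<j]" for i using less[of i] that by fastforce
    then have "\<Union> (fv ` e ` set [1..<j]) \<subseteq> \<alpha> ` {..n} \<inter> {..j}" by blast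
    then show ?thesis by (simp add: e_cell[OF False])
  qed
qed

private definition "\<theta> k j = (if j < k then e j else V j)"

text \<open>The context of a generating judgement of degree \<open>N\<close> after the substitutions for the
  variables below \<open>k\<close>; a variable disappears when a term is substituted for it.\<close>

private definition "stage k N = map (\<lambda>j. (j, esubst (\<theta> k) (gen_type j (h (Ob j)))))
    (filter (\<lambda>j. k \<le> j \<or> j \<in> \<alpha> ` {..n}) [1..<N])"

private lemma \<theta>_Suc_image: "k \<in> \<alpha> ` {..n} \<Longrightarrow> \<theta> (Suc k) = \<theta> k"
  by (auto simp: \<theta>_def e_image less_Suc_eq)

private lemma sub1_\<theta>:
  assumes "k \<notin> \<alpha> ` {..n}"
  shows "sub1 (e k) k (esubst (\<theta> k) t) = esubst (\<theta> (Suc k)) t"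
  unfolding sub1_def esubst_esubst
proof (rule esubst_cong)
  fix x
  consider "x < k" | "x = k" | "x > k" by linarith
  then show "esubst (V(k := e k)) (\<theta> k x) = \<theta> (Suc k) x"
  proof cases
    case 1
    then have "esubst (V(k := e k)) (e x) = e x" using fv_e[of x] by (intro esubst_id) auto
    then show ?thesis using 1 by (simp add: \<theta>_def)
  qed (simp_all add: \<theta>_def)
qed

private lemma \<theta>_type_cong: "j \<le> k \<Longrightarrow> j \<le> k' \<Longrightarrow> esubst (\<theta> k) (gen_type j A) = esubst (\<theta> k') (gen_type j A)"
  by (rule esubst_cong) (auto simp: gen_type_def gen_vars_def \<theta>_def)

private lemma stage_image: "k \<in> \<alpha> ` {..n} \<Longrightarrow> stage (Suc k) N = stage k N"
proof -
  assume k: "k \<in> \<alpha> ` {..n}"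
  have "(\<lambda>j. Suc k \<le> j \<or> j \<in> \<alpha> ` {..n}) = (\<lambda>j. k \<le> j \<or> j \<in> \<alpha> ` {..n})"
  proof
    fix j
    have "Suc k \<le> j \<longleftrightarrow> k \<le> j \<and> j \<noteq> k" by auto
    then show "(Suc k \<le> j \<or> j \<in> \<alpha> ` {..n}) = (k \<le> j \<or> j \<in> \<alpha> ` {..n})" using k by blast
  qed
  then show ?thesis unfolding stage_def \<theta>_Suc_image[OF k] by (rule arg_cong)
qed

private lemma stage_split:
  assumes "k \<in> {1..<N}"
  shows "stage k N = stage k k @ (k, esubst (\<theta> k) (gen_type k (h (Ob k))))
      # map (\<lambda>j. (j, esubst (\<theta> k) (gen_type j (h (Ob j))))) [Suc k..<N]"
    and "k \<notin> \<alpha> ` {..n} \<Longrightarrow> stage (Suc k) N = stage k k @ map (\<lambda>j. (j, esubst (\<theta> (Suc k)) (gen_type j (h (Ob j))))) [Suc k..<N]"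
proof -
  have upt: "[1..<N] = [1..<k] @ k # [Suc k..<N]"
    using assms upt_add_eq_append[of 1 k "N - k"] by (simp add: upt_conv_Cons)
  have r: "filter (\<lambda>j. k \<le> j \<or> j \<in> \<alpha> ` {..n}) [Suc k..<N] = [Suc k..<N]"
    "filter (\<lambda>j. Suc k \<le> j \<or> j \<in> \<alpha> ` {..n}) [Suc k..<N] = [Suc k..<N]" by (auto intro: filter_True)
  show "stage k N = stage k k @ (k, esubst (\<theta> k) (gen_type k (h (Ob k))))
      # map (\<lambda>j. (j, esubst (\<theta> k) (gen_type j (h (Ob j))))) [Suc k..<N]"
    unfolding stage_def upt filter_append filter.simps r by simp
  assume k: "k \<notin> \<alpha> ` {..n}"
  have l: "filter (\<lambda>j. Suc k \<le> j \<or> j \<in> \<alpha> ` {..n}) [1..<k] = filter (\<lambda>j. k \<le> j \<or> j \<in> \<alpha> ` {..n}) [1..<k]"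
    by (rule filter_cong) auto
  have "map (\<lambda>j. (j, esubst (\<theta> (Suc k)) (gen_type j (h (Ob j))))) (filter (\<lambda>j. k \<le> j \<or> j \<in> \<alpha> ` {..n}) [1..<k]) = stage k k"
    unfolding stage_def by (rule map_cong) (auto intro: \<theta>_type_cong)
  then show "stage (Suc k) N = stage k k @ map (\<lambda>j. (j, esubst (\<theta> (Suc k)) (gen_type j (h (Ob j))))) [Suc k..<N]"
    unfolding stage_def[of "Suc k" N] upt filter_append filter.simps r l using k by simp
qed

private definition "generic_rhs N = insert (IsType (gen_type N (h (Ob N))))
    ((\<lambda>a. HasType (App (Inr (N, a)) (gen_vars N)) (gen_type N (h (Ob N)))) ` Tm X N (h (Ob N)))"

private lemma stage_0:
  assumes N: "N \<in> {1..\<alpha> n}" and R: "R \<in> generic_rhs N"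
  shows "fderiv DS X (Judg (stage 0 N) (map_rhs_expr (esubst (\<theta> 0)) R))"
proof -
  have [simp]: "\<theta> 0 = V" by (auto simp: \<theta>_def)
  have R0: "map_rhs_expr (esubst (\<theta> 0)) R = R" by (cases R) simp_all
  have "bd_iter X j (N - j) (h (Ob N)) = h (Ob j)" if "j \<in> set [1..<N]" for j
    using bd_iter_S[of j "N - j"] N that by simp
  then have "gen_ctx X N (h (Ob N)) = stage 0 N"
    unfolding stage_def gen_ctx_def by simp
  moreover have "h (Ob N) \<in> el X (Ob N)" using SD(2)[of "Ob N"] N by (simp add: cells_def)
  moreover have "fderiv DS X (Judg (gen_ctx X N (h (Ob N))) (HasType (App (Inr (N, a)) (gen_vars N)) (gen_type N (h (Ob N)))))"
    if "a \<in> Tm X N (h (Ob N))" for a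
    using fderiv.gen[of "ObT N" a X DS] that N by (simp add: Tm_def)
  ultimately show ?thesis unfolding R0
    using R N fderiv.gen[of "Ob N" "h (Ob N)" X DS] by (auto simp: generic_rhs_def)
qed

text \<open>The term substituted for the variable \<open>k\<close> has to be derivable in exactly the context
  to the left of \<open>k\<close> at that stage. This is the judgement for the term-element at
  \<open>k\<close> with all its substitutions carried out, hence the induction on the degree.\<close>

private lemma stages:
  "N \<in> {1..\<alpha> n} \<Longrightarrow> R \<in> generic_rhs N \<Longrightarrow> k \<le> N \<Longrightarrow> fderiv DS X (Judg (stage k N) (map_rhs_expr (esubst (\<theta> k)) R))"
proof (induct N arbitrary: R k rule: less_induct)
  case (less N)
  from less(4) show ?case
  proof (induct k)
    case 0
    show ?case by (rule stage_0[OF less(2,3)])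
  next
    case (Suc k)
    then have IH: "fderiv DS X (Judg (stage k N) (map_rhs_expr (esubst (\<theta> k)) R))" by simp
    show ?case
    proof (cases "k \<in> \<alpha> ` {..n}")
      case True
      then show ?thesis using IH by (simp add: stage_image \<theta>_Suc_image)
    next
      case False
      have k0: "k \<in> {1..<N}" using False zero_image Suc(2) by (cases "k = 0") auto
      then have k: "k \<in> {1..\<alpha> n}" using less(2) by simp
      let ?R = "HasType (App (Inr (k, h (ObT k))) (gen_vars k)) (gen_type k (h (Ob k)))"
      have "?R \<in> generic_rhs k" using term_cell[OF k False] by (simp add: generic_rhs_def)
      then have "fderiv DS X (Judg (stage k k) (map_rhs_expr (esubst (\<theta> k)) ?R))" using less(1)[of k ?R k] k0 k by simp
      moreover have "esubst (\<theta> k) (App (Inr (k, h (ObT k))) (gen_vars k)) = e k"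
        by (simp add: e_cell[OF False] gen_vars_def \<theta>_def)
      ultimately have t: "fderiv DS X (Judg (stage k k) (HasType (e k) (esubst (\<theta> k) (gen_type k (h (Ob k))))))" by simp
      have "map_ctx (sub1 (e k) k) (map (\<lambda>j. (j, esubst (\<theta> k) (gen_type j (h (Ob j))))) [Suc k..<N])
          = map (\<lambda>j. (j, esubst (\<theta> (Suc k)) (gen_type j (h (Ob j))))) [Suc k..<N]"
        by (simp add: map_ctx_def sub1_\<theta>[OF False])
      moreover have "map_rhs_expr (sub1 (e k) k) (map_rhs_expr (esubst (\<theta> k)) R) = map_rhs_expr (esubst (\<theta> (Suc k))) R"
        by (cases R) (simp_all add: sub1_\<theta>[OF False])
      ultimately show ?thesis
        using fderiv.subst[OF _ t IH[unfolded stage_split(1)[OF k0]]] stage_split(2)[OF k0 False] by simp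
    qed
  qed
qed

lemma S_arg_fv:
  assumes "j \<in> {1..<\<alpha> n}"
  shows "fv (S_arg n \<alpha> h j) \<subseteq> {1..<n}"
  using assms
proof (induct j rule: less_induct)
  case (less j)
  show ?case
  proof (cases "j \<in> \<alpha> ` {..n}")
    case True
    then obtain m where m: "j = \<alpha> m" "m \<le> n" by auto
    then have "m \<in> {1..<n}" using less(2) ID(1) ID(2)[of m n] by (cases "m = 0") auto
    moreover have "inv_into {..n} \<alpha> j = m" using m ID(4) by (simp add: inv_into_f_f)
    ultimately show ?thesis using True by (subst S_arg.simps) simp
  next
    case False
    then show ?thesis using less by (subst S_arg.simps) fastforce
  qed
qed

lemma S_fderiv:
  shows "fderiv DS X (Judg (S_ctx n \<alpha> h) (IsType (S_type n \<alpha> h n)))"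
    and "a \<in> S_tm X n (\<alpha>, h) \<Longrightarrow> fderiv DS X (Judg (S_ctx n \<alpha> h) (HasType (App (Inr (\<alpha> n, a)) (S_args n \<alpha> h n)) (S_type n \<alpha> h n)))"
proof -
  let ?N = "\<alpha> n"
  have N: "?N \<in> {1..?N}" using ID(5)[of n] n by simp
  have inj: "inj_on \<alpha> {1..<n}" using ID(4) by (rule inj_on_subset) auto
  have "distinct (map \<alpha> [1..<n])" using inj by (simp add: distinct_map)
  \<comment> \<open>The permutation that restores the variable names.\<close>
  then obtain \<sigma> where \<sigma>: "bij \<sigma>" "map \<sigma> (map \<alpha> [1..<n]) = [1..<n]"
    using permutation_between_lists[of "map \<alpha> [1..<n]" "[1..<n]"] by auto
  have \<sigma>\<alpha>: "\<sigma> (\<alpha> i) = i" if "i \<in> {1..<n}" for i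
  proof -
    have "map (\<lambda>i. \<sigma> (\<alpha> i)) [1..<n] = map (\<lambda>i. i) [1..<n]" using \<sigma>(2) by (simp add: comp_def)
    then show ?thesis using that by (simp only: map_eq_conv) simp
  qed
  have arg: "ren \<sigma> (esubst (\<theta> ?N) (V j)) = S_arg n \<alpha> h j" if "j \<in> {1..<?N}" for j
  proof -
    have "ren \<sigma> (esubst (\<theta> ?N) (V j)) = ren (\<sigma> \<circ> \<alpha>) (S_arg n \<alpha> h j)" using that by (simp add: \<theta>_def e_def ren_ren)
    also have "\<dots> = S_arg n \<alpha> h j" by (rule ren_id) (use S_arg_fv[OF that] \<sigma>\<alpha> in auto)
    finally show ?thesis .
  qed
  have args: "map (\<lambda>t. ren \<sigma> (esubst (\<theta> ?N) t)) (gen_vars j) = map (S_arg n \<alpha> h) [1..<j]" if "j \<le> ?N" for j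
    using arg that by (simp add: gen_vars_def)
  have app: "ren \<sigma> (esubst (\<theta> ?N) (App c (gen_vars j))) = App c (map (S_arg n \<alpha> h) [1..<j])" if "j \<le> ?N" for j c
    using args[OF that] by (simp add: ren_App comp_def)
  \<comment> \<open>After the last stage, the variables left are those in the image of \<open>\<alpha>\<close>.\<close>
  have fil: "filter (\<lambda>j. ?N \<le> j \<or> j \<in> \<alpha> ` {..n}) [1..<?N] = map \<alpha> [1..<n]"
  proof (rule increasing_list_unique)
    show "sorted_wrt (<) (filter (\<lambda>j. ?N \<le> j \<or> j \<in> \<alpha> ` {..n}) [1..<?N])" by (rule sorted_wrt_filter[OF sorted_wrt_upt])
    show "sorted_wrt (<) (map \<alpha> [1..<n])" unfolding sorted_wrt_map
      by (rule sorted_wrt_mono_rel[OF _ sorted_wrt_upt]) (use ID(2) in auto)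
    show "set (filter (\<lambda>j. ?N \<le> j \<or> j \<in> \<alpha> ` {..n}) [1..<?N]) = set (map \<alpha> [1..<n])"
    proof (rule set_eqI)
      fix j
      have "(\<exists>m \<le> n. j = \<alpha> m \<and> 1 \<le> j \<and> j < ?N) \<longleftrightarrow> (\<exists>m \<in> {1..<n}. j = \<alpha> m)"
      proof
        assume "\<exists>m \<le> n. j = \<alpha> m \<and> 1 \<le> j \<and> j < ?N"
        then obtain m where m: "m \<le> n" "j = \<alpha> m" "1 \<le> j" "j < ?N" by blast
        then have "m \<in> {1..<n}" using ID(1) ID(2)[of m n] by (cases "m = 0") auto
        then show "\<exists>m \<in> {1..<n}. j = \<alpha> m" using m by blast
      next
        assume "\<exists>m \<in> {1..<n}. j = \<alpha> m"
        then obtain m where m: "m \<in> {1..<n}" "j = \<alpha> m" by blast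
        then show "\<exists>m \<le> n. j = \<alpha> m \<and> 1 \<le> j \<and> j < ?N"
            using ID(5)[of m] ID(2)[of m n] by (intro exI[of _ m]) auto
      qed
      then show "j \<in> set (filter (\<lambda>j. ?N \<le> j \<or> j \<in> \<alpha> ` {..n}) [1..<?N]) \<longleftrightarrow> j \<in> set (map \<alpha> [1..<n])" by auto
    qed
  qed
  have ctx: "map (\<lambda>(x, T). (\<sigma> x, ren \<sigma> T)) (stage ?N ?N) = S_ctx n \<alpha> h"
  proof -
    have "\<alpha> i \<le> ?N" if "i \<in> {1..<n}" for i using ID(3)[of i n] that by simp
    then show ?thesis unfolding stage_def fil S_ctx_def map_map
      by (intro map_cong refl) (auto simp: \<sigma>\<alpha> gen_type_def app S_type_def S_args_def simp del: esubst.simps)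
  qed
  have R: "fderiv DS X (perm_judgement \<sigma> (Judg (stage ?N ?N) (map_rhs_expr (esubst (\<theta> ?N)) R)))" if "R \<in> generic_rhs ?N" for R
    by (intro fderiv.perm \<sigma>(1) stages N that) simp
  show "fderiv DS X (Judg (S_ctx n \<alpha> h) (IsType (S_type n \<alpha> h n)))"
    using R[of "IsType (gen_type ?N (h (Ob ?N)))"] ctx
    by (simp add: generic_rhs_def gen_type_def app S_type_def S_args_def del: esubst.simps)
  assume "a \<in> S_tm X n (\<alpha>, h)"
  then show "fderiv DS X (Judg (S_ctx n \<alpha> h) (HasType (App (Inr (\<alpha> n, a)) (S_args n \<alpha> h n)) (S_type n \<alpha> h n)))"
    using R[of "HasType (App (Inr (?N, a)) (gen_vars ?N)) (gen_type ?N (h (Ob ?N)))"] ctx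
    by (simp add: generic_rhs_def gen_type_def app S_type_def S_args_def S_tm_def del: esubst.simps)
qed

end

section \<open>Classes of canonical judgements\<close>

lemma canonical_P_ctx: "n \<ge> 1 \<Longrightarrow> canonical (Judg (P_ctx n \<phi> h) R)"
  by (simp add: canonical_def degree_def P_ctx_def comp_def del: upt_Suc)

lemma canonical_S_ctx: "n \<ge> 1 \<Longrightarrow> canonical (Judg (S_ctx n \<alpha> h) R)"
  by (simp add: canonical_def degree_def S_ctx_def comp_def del: upt_Suc)

lemma P_type_restrict:
  assumes "\<phi> \<in> Hp n" "m \<le> n" "i \<in> {1..m}"
  shows "P_type (restrict \<phi> {..m}) (restrict h {1..m}) i = P_type \<phi> h i"
    and "P_args (restrict \<phi> {..m}) i = P_args \<phi> i"
  using assms by (simp_all add: P_type_def P_args_def dp_restrict chain_restrict)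

lemma P_ctx_restrict:
  assumes "\<phi> \<in> Hp n" "m \<le> n"
  shows "P_ctx m (restrict \<phi> {..m}) (restrict h {1..m}) = P_ctx m \<phi> h"
  using P_type_restrict(1)[OF assms, of _ h] by (auto simp: P_ctx_def)

lemma P_restrict_ty:
  assumes "(\<phi>, h) \<in> P_ty X n" "m \<le> n"
  shows "P_restrict m (\<phi>, h) \<in> P_ty X m"
proof -
  note \<phi> = P_tyD[OF assms(1)]
  have "\<phi> i \<in> {1..m}" if "i \<in> {1..m}" "\<phi> i > 0" for i using that Hp_D(3)[OF \<phi>(1), of i] assms(2) by simp
  then show ?thesis using \<phi>(2,3) Hp_restrict[OF \<phi>(1) assms(2)] assms(2)
    by (auto simp: P_restrict_def P_ty_def dp_restrict[OF \<phi>(1)])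
qed

lemma P_ty_class_simps:
  assumes X: "is_presheaf X" and P: "(\<phi>, h) \<in> P_ty X n" and m: "m \<in> {1..n}"
  defines "c \<equiv> P_ty_class X m (P_restrict m (\<phi>, h))"
  shows "c \<in> el (P_obj X) (Ob m)"
    and "can c = Judg (P_ctx m \<phi> h) (IsType (P_type \<phi> h m))"
    and "m > 1 \<Longrightarrow> bd (P_obj X) (Ob m) c = P_ty_class X (m - 1) (P_restrict (m - 1) (\<phi>, h))"
proof -
  note \<phi> = P_tyD(1)[OF P]
  let ?J = "\<lambda>m. Judg (P_ctx m \<phi> h) (IsType (P_type \<phi> h m))"
  have c: "P_ty_class X m (P_restrict m (\<phi>, h)) = cls DP (G_obj X) (?J m)" if "m \<in> {1..n}" for m
    using that P_type_restrict(1)[OF \<phi>, of m m h] P_ctx_restrict[OF \<phi>, of m h] by (simp add: P_ty_class_def P_restrict_def)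
  have d: "fderiv DP X (?J m)" using P_type_fderiv[OF X P _ _ m, of DP] by simp
  show "c \<in> el (P_obj X) (Ob m)" using M_obj_cls[OF X _ d] c[OF m] m by (simp add: c_def P_ctx_def)
  show "can c = ?J m" using can_cls[OF X _ d canonical_P_ctx] c[OF m] m by (simp add: c_def)
  show "bd (P_obj X) (Ob m) c = P_ty_class X (m - 1) (P_restrict (m - 1) (\<phi>, h))" if "m > 1"
  proof -
    have "P_ctx m \<phi> h = P_ctx (m - 1) \<phi> h @ [(m - 1, P_type \<phi> h (m - 1))]"
      using that by (cases m) (auto simp: P_ctx_def)
    then have "boundary (?J m) = [?J (m - 1)]" by simp
    moreover have "m - 1 \<in> {1..n}" using m that by auto
    ultimately show ?thesis using bd_M_obj[OF X _ d] c[OF m] c[of "m - 1"] by (simp add: c_def)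
  qed
qed

lemma P_restrict_all:
  assumes "(\<phi>, h) \<in> P_ty X n"
  shows "P_restrict n (\<phi>, h) = (\<phi>, h)"
proof -
  have "\<phi> \<in> extensional {..n}" using P_tyD(1)[OF assms] by (auto simp: Hp_def PiE_def)
  then show ?thesis using P_tyD(4)[OF assms] by (simp add: P_restrict_def extensional_restrict)
qed

lemma P_tm_class_simps:
  assumes X: "is_presheaf X" and P: "(\<phi>, h) \<in> P_ty X n" and m: "m \<in> {1..n}" and a: "a \<in> P_tm X m (P_restrict m (\<phi>, h))"
  defines "c \<equiv> P_tm_class X m (P_restrict m (\<phi>, h)) a"
  shows "c \<in> Tm (P_obj X) m (P_ty_class X m (P_restrict m (\<phi>, h)))"
    and "can c = Judg (P_ctx m \<phi> h) (HasType (P_term \<phi> m a) (P_type \<phi> h m))"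
    and "fderiv DP X (Judg (P_ctx m \<phi> h) (HasType (P_term \<phi> m a) (P_type \<phi> h m)))"
proof -
  note \<phi> = P_tyD(1)[OF P]
  let ?J = "Judg (P_ctx m \<phi> h) (HasType (P_term \<phi> m a) (P_type \<phi> h m))"
  have r: "P_type (restrict \<phi> {..m}) (restrict h {1..m}) m = P_type \<phi> h m"
    "P_term (restrict \<phi> {..m}) m a = P_term \<phi> m a" "P_ctx m (restrict \<phi> {..m}) (restrict h {1..m}) = P_ctx m \<phi> h"
    using P_type_restrict(1)[OF \<phi>, of m m h] P_ctx_restrict[OF \<phi>, of m h] m dp_restrict[OF \<phi>, of m m]
    by (auto split: pterm.split simp: P_type_restrict(2)[OF \<phi>])
  have c: "c = cls DP (G_obj X) ?J" using r by (simp add: c_def P_tm_class_def P_restrict_def)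
  have P': "(restrict \<phi> {..m}, restrict h {1..m}) \<in> P_ty X m"
    using P_restrict_ty[OF P, of m] m by (simp add: P_restrict_def)
  show d: "fderiv DP X ?J" using P_term_fderiv[OF X P', of a] a m r by (simp add: P_restrict_def)
  show "can c = ?J" using can_cls[OF X _ d canonical_P_ctx] c m by simp
  have "P_ty_class X m (P_restrict m (\<phi>, h)) = cls DP (G_obj X) (Judg (P_ctx m \<phi> h) (IsType (P_type \<phi> h m)))"
    using r by (simp add: P_ty_class_def P_restrict_def)
  then show "c \<in> Tm (P_obj X) m (P_ty_class X m (P_restrict m (\<phi>, h)))"
    using M_obj_cls[OF X _ d] bd_M_obj[OF X _ d] c m by (simp add: Tm_def P_ctx_def)
qed

text \<open>The argument in position \<open>j\<close> only depends on the data in positions up to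
  \<open>j\<close>.\<close>

lemma S_arg_S_bd:
  assumes S: "(\<alpha>, h) \<in> S_ty X (Suc m)" and z: "S_bd (Suc m) (\<alpha>, h) = (\<alpha>', h')"
  shows "j \<in> {1..<\<alpha> m} \<Longrightarrow> S_arg (Suc m) \<alpha> h j = S_arg m \<alpha>' h' j"
proof (induct j rule: less_induct)
  case (less j)
  note I = Inc_D[OF S_tyD(1)[OF S]]
  have a': "\<alpha>' i = \<alpha> i" if "i \<le> m" for i using z that by (auto simp: S_bd_def)
  have lt: "\<alpha> m < \<alpha> (Suc m)" using I(2)[of m "Suc m"] by simp
  have im: "j \<in> \<alpha> ` {..Suc m} \<longleftrightarrow> j \<in> \<alpha>' ` {..m}"
    using less(2) lt a' by (force simp: atMost_Suc)
  show ?case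
  proof (cases "j \<in> \<alpha>' ` {..m}")
    case True
    then obtain i where i: "i \<le> m" "j = \<alpha> i" using a' by auto
    have "inv_into {..Suc m} \<alpha> j = i" using i I(4) by (simp add: inv_into_f_f)
    moreover have "inj_on \<alpha>' {..m}" using I(4) a' by (auto simp: inj_on_def)
    then have "inv_into {..m} \<alpha>' j = i" using i a' by (metis atMost_iff inv_into_f_f)
    ultimately show ?thesis using True im by (simp add: S_arg.simps)
  next
    case False
    have "ObT j \<in> cells m \<alpha>" using less(2) False a' by (auto simp: cells_def)
    then have "h' (ObT j) = h (ObT j)" using z by (auto simp: S_bd_def)
    moreover have "map (S_arg (Suc m) \<alpha> h) [1..<j] = map (S_arg m \<alpha>' h') [1..<j]" using less by auto
    ultimately show ?thesis using False im by (simp add: S_arg.simps[of _ _ _ j] del: map_eq_conv)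
  qed
qed

lemma S_ty_class_simps:
  assumes X: "is_presheaf X" and S: "(\<alpha>, h) \<in> S_ty X m" and m: "m \<ge> 1"
  defines "c \<equiv> S_ty_class X m (\<alpha>, h)"
  shows "c \<in> el (S_obj X) (Ob m)"
    and "can c = Judg (S_ctx m \<alpha> h) (IsType (S_type m \<alpha> h m))"
    and "m > 1 \<Longrightarrow> bd (S_obj X) (Ob m) c = S_ty_class X (m - 1) (S_bd m (\<alpha>, h))"
proof -
  let ?J = "Judg (S_ctx m \<alpha> h) (IsType (S_type m \<alpha> h m))"
  have c: "c = cls DS (G_obj X) ?J" by (simp add: c_def S_ty_class_def)
  have d: "fderiv DS X ?J" by (rule S_fderiv(1)[OF X m S])
  show "c \<in> el (S_obj X) (Ob m)" using M_obj_cls[OF X _ d] m c by (simp add: S_ctx_def)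
  show "can c = ?J" using can_cls[OF X _ d canonical_S_ctx[OF m]] c by simp
  show "bd (S_obj X) (Ob m) c = S_ty_class X (m - 1) (S_bd m (\<alpha>, h))" if "m > 1"
  proof -
    define l where "l = m - 1"
    have l: "m = Suc l" "l \<ge> 1" using that by (auto simp: l_def)
    obtain \<alpha>' h' where z: "S_bd (Suc l) (\<alpha>, h) = (\<alpha>', h')" by (cases "S_bd (Suc l) (\<alpha>, h)")
    note I = Inc_D[OF S_tyD(1)[OF S[unfolded l]]]
    have ty: "S_type (Suc l) \<alpha> h i = S_type l \<alpha>' h' i" if i: "i \<in> {1..l}" for i
    proof -
      have a: "\<alpha>' i = \<alpha> i" using z i by (auto simp: S_bd_def)
      have le: "\<alpha> i \<le> \<alpha> l" "\<alpha> i \<ge> 1" using I(3)[of i l] I(5)[of i] i by auto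
      then have "Ob (\<alpha> i) \<in> cells l \<alpha>" by (simp add: cells_def)
      then have h: "h' (Ob (\<alpha> i)) = h (Ob (\<alpha> i))" using z by (auto simp: S_bd_def)
      have args: "map (S_arg (Suc l) \<alpha> h) [1..<\<alpha> i] = map (S_arg l \<alpha>' h') [1..<\<alpha> i]"
        using S_arg_S_bd[OF S[unfolded l] z] le by auto
      show ?thesis unfolding S_type_def S_args_def a h args ..
    qed
    have "S_ctx (Suc l) \<alpha> h = S_ctx l \<alpha>' h' @ [(l, S_type l \<alpha>' h' l)]"
      using l(2) ty by (auto simp: S_ctx_def)
    then have "boundary ?J = [Judg (S_ctx l \<alpha>' h') (IsType (S_type l \<alpha>' h' l))]" using l by simp
    then show ?thesis using bd_M_obj[OF X _ d, of "Ob m"] c z l by (simp add: S_ty_class_def)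
  qed
qed

lemma S_tm_class_simps:
  assumes X: "is_presheaf X" and S: "(\<alpha>, h) \<in> S_ty X m" and m: "m \<ge> 1" and a: "a \<in> S_tm X m (\<alpha>, h)"
  defines "c \<equiv> S_tm_class X m (\<alpha>, h) a"
  shows "c \<in> Tm (S_obj X) m (S_ty_class X m (\<alpha>, h))"
    and "can c = Judg (S_ctx m \<alpha> h) (HasType (App (Inr (\<alpha> m, a)) (S_args m \<alpha> h m)) (S_type m \<alpha> h m))"
proof -
  let ?J = "Judg (S_ctx m \<alpha> h) (HasType (App (Inr (\<alpha> m, a)) (S_args m \<alpha> h m)) (S_type m \<alpha> h m))"
  have c: "c = cls DS (G_obj X) ?J" by (simp add: c_def S_tm_class_def)
  have d: "fderiv DS X ?J" by (rule S_fderiv(2)[OF X m S a])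
  show "can c = ?J" using can_cls[OF X _ d canonical_S_ctx[OF m]] c by simp
  show "c \<in> Tm (S_obj X) m (S_ty_class X m (\<alpha>, h))"
    using M_obj_cls[OF X _ d] bd_M_obj[OF X _ d] c m by (simp add: Tm_def S_ty_class_def S_ctx_def)
qed

lemma PS_classes_P_ty:
  assumes X: "is_presheaf X" and z: "(\<psi>, s) \<in> PS_ty X n"
  shows "PS_classes X n (\<psi>, s) \<in> P_ty (S_obj X) n"
proof -
  have \<psi>: "\<psi> \<in> Hp n" and s: "\<And>i. i \<in> {1..n} \<Longrightarrow> s i \<in> S_ty X (dp \<psi> i)"
    and sb: "\<And>i. i \<in> {1..n} \<Longrightarrow> \<psi> i > 0 \<Longrightarrow> S_bd (dp \<psi> i) (s i) = s (\<psi> i)"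
    using z by (auto simp: PS_ty_def)
  have el: "S_ty_class X (dp \<psi> i) (s i) \<in> el (S_obj X) (Ob (dp \<psi> i))" if i: "i \<in> {1..n}" for i
    using S_ty_class_simps(1)[OF X, of "fst (s i)" "snd (s i)" "dp \<psi> i"] s[OF i] dp_pos[OF \<psi>, of i] i by simp
  have bd: "bd (S_obj X) (Ob (dp \<psi> i)) (S_ty_class X (dp \<psi> i) (s i)) = S_ty_class X (dp \<psi> (\<psi> i)) (s (\<psi> i))"
    if i: "i \<in> {1..n}" "\<psi> i > 0" for i
  proof -
    have d: "dp \<psi> i = Suc (dp \<psi> (\<psi> i))" using dp_rec[OF \<psi> i(1)] i(2) by simp
    have "dp \<psi> (\<psi> i) \<ge> 1" using dp_pos[OF \<psi>, of "\<psi> i"] Hp_D(4)[OF \<psi>, of i] i by simp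
    then show ?thesis
      using S_ty_class_simps(3)[OF X, of "fst (s i)" "snd (s i)" "dp \<psi> i"] s[OF i(1)] sb[OF i] d by simp
  qed
  have "\<psi> i \<in> {1..n}" if "i \<in> {1..n}" "\<psi> i > 0" for i using that Hp_D(4)[OF \<psi>, of i] by simp
  then show ?thesis using \<psi> el bd by (auto simp: PS_classes_def P_ty_def)
qed

abbreviation PS_tm_code :: "'a presheaf \<Rightarrow> nat \<Rightarrow> (nat \<Rightarrow> nat) \<times> (nat \<Rightarrow> (nat \<Rightarrow> nat) \<times> (hobj \<Rightarrow> 'a)) \<Rightarrow> 'a pterm \<Rightarrow> 'a M pterm" where
  "PS_tm_code X n z a \<equiv> (case a of Elem b \<Rightarrow> Elem (S_tm_class X (dp (fst z) n) (snd z n) b) | Proj i \<Rightarrow> Proj i)"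

lemma PS_tm_code:
  assumes X: "is_presheaf X" and n: "n \<ge> 1" and z: "(\<psi>, s) \<in> PS_ty X n" and a: "a \<in> PS_tm X n (\<psi>, s)"
  shows "PS_tm_code X n (\<psi>, s) a \<in> P_tm (S_obj X) n (PS_classes X n (\<psi>, s))"
proof (cases a)
  case (Elem b)
  have \<psi>: "\<psi> \<in> Hp n" and s: "s n \<in> S_ty X (dp \<psi> n)" using z n by (auto simp: PS_ty_def)
  have b: "b \<in> S_tm X (dp \<psi> n) (s n)" using a Elem by (auto simp: PS_tm_def)
  have "S_tm_class X (dp \<psi> n) (s n) b \<in> Tm (S_obj X) (dp \<psi> n) (S_ty_class X (dp \<psi> n) (s n))"
    using S_tm_class_simps(1)[OF X, of "fst (s n)" "snd (s n)" "dp \<psi> n" b] s b dp_pos[OF \<psi>, of n] by simp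
  then show ?thesis using Elem n by (simp add: P_tm_def PS_classes_def)
next
  case (Proj i)
  have \<psi>: "\<psi> \<in> Hp n" using z by (auto simp: PS_ty_def)
  have i: "i \<in> {1..n - 1}" "\<psi> n = \<psi> i" "s n = s i" using a Proj by (auto simp: PS_tm_def)
  then have "dp \<psi> n = dp \<psi> i" using same_parent(1)[OF \<psi>, of n i] n by auto
  then show ?thesis using Proj i n by (auto simp: P_tm_def PS_classes_def)
qed

section \<open>The value of the distributive law\<close>

context SP_element
begin

text \<open>The map from the presheaf of the inc-list \<open>\<alpha>\<close> to \<open>PX\<close> that
  belongs to the given element of \<open>SPX\<close>.\<close>

definition H :: "hobj \<Rightarrow> 'a M" where "H = snd (SP_classes X n (\<alpha>, \<phi>, h, k))"

lemma SP_classes: "SP_classes X n (\<alpha>, \<phi>, h, k) = (\<alpha>, H)"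
  by (simp add: H_def SP_classes_def)

lemma PX: "is_presheaf (P_obj X)" and SX: "is_presheaf (S_obj X)"
  by (rule M_obj_presheaf[OF X], simp)+

lemma H_simps:
  "i \<in> {1..\<alpha> n} \<Longrightarrow> H (Ob i) = P_ty_class X i (P_restrict i (\<phi>, h))"
  "i \<in> {1..\<alpha> n} - \<alpha> ` {..n} \<Longrightarrow> H (ObT i) = P_tm_class X i (P_restrict i (\<phi>, h)) (k i)"
  by (auto simp: H_def SP_classes_def cells_def)

lemma SP_classes_S_ty: "(\<alpha>, H) \<in> S_ty (P_obj X) n"
proof -
  note ty = P_ty_class_simps[OF X \<phi>h]
  have tm: "H (ObT i) \<in> Tm (P_obj X) i (H (Ob i))" if "i \<in> {1..\<alpha> n} - \<alpha> ` {..n}" for i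
    using P_tm_class_simps(1)[OF X \<phi>h _ k[OF that]] that H_simps by simp
  have "H ob \<in> el (P_obj X) ob \<and> (ob \<noteq> Ob 1 \<longrightarrow> bd (P_obj X) ob (H ob) = H (below ob))" if ob: "ob \<in> cells n \<alpha>" for ob
  proof (cases ob)
    case (Ob i)
    then have i: "i \<in> {1..\<alpha> n}" using ob by (auto simp: cells_def)
    have "bd (P_obj X) (Ob i) (H (Ob i)) = H (Ob (i - 1))" if "i \<noteq> 1"
    proof -
      have "i > 1" "i - 1 \<in> {1..\<alpha> n}" using that i by auto
      then show ?thesis using ty(3)[OF i] H_simps(1)[OF i] H_simps(1)[of "i - 1"] by simp
    qed
    then show ?thesis using Ob ty(1)[OF i] H_simps(1)[OF i] by auto
  next
    case (ObT i)
    then show ?thesis using tm[of i] ob by (auto simp: cells_def Tm_def)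
  qed
  moreover have "H \<in> extensional (cells n \<alpha>)" by (simp add: H_def SP_classes_def)
  ultimately show ?thesis using \<alpha> by (auto simp: S_ty_def PiE_def)
qed

abbreviation F :: "'a M fsym expr \<Rightarrow> 'a fsym expr" where
  "F \<equiv> expand (bodies (\<lambda>ob c. c))"

text \<open>The argument \<open>e\<^sub>j\<close> of the judgement for the given element of \<open>SPX\<close>, after its constants, which are
  classes of judgements over \<open>X\<close>, have been expanded. It is a variable if \<open>j\<close> is in the image of \<open>\<alpha>\<close>, a
  term-constant of \<open>X\<close> applied to the arguments at the strict ancestors of \<open>j\<close> if \<open>k j\<close> is a term-element, and
  the argument at \<open>i\<close> if \<open>k j\<close> is the projection \<open>\<pi>\<^sub>i\<close>.\<close>

definition E :: "nat \<Rightarrow> 'a fsym expr" where "E j = F (S_arg n \<alpha> H j)"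

lemma E_image: "m \<le> n \<Longrightarrow> E (\<alpha> m) = V m"
  using \<alpha>_simps(4) unfolding E_def by (subst S_arg.simps) (simp add: inv_into_f_f)

lemma F_P_args:
  assumes j: "j \<in> {1..\<alpha> n}" and c: "bodies (\<lambda>ob c. c) c = App d (P_args \<phi> j)"
  shows "F (App c (map (S_arg n \<alpha> H) [1..<j])) = App d (map (\<lambda>l. E (chain \<phi> j l)) [1..<dp \<phi> j])"
proof -
  have "args (map E [1..<j]) (chain \<phi> j l) = E (chain \<phi> j l)" if "l \<in> {1..<dp \<phi> j}" for l
  proof -
    have "chain \<phi> j l \<in> {1..<j}"
      using chain_in(1)[OF \<phi> j, of l] chain_strict_mono[OF \<phi> j, of l "dp \<phi> j"] that by simp
    then show ?thesis by (auto simp: args_def)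
  qed
  moreover have "F (App c (map (S_arg n \<alpha> H) [1..<j])) = esubst (args (map E [1..<j])) (App d (P_args \<phi> j))"
  proof -
    have eq: "map F (map (S_arg n \<alpha> H) [1..<j]) = map E [1..<j]" by (simp add: E_def)
    show ?thesis unfolding expand.simps(2) eq c ..
  qed
  ultimately show ?thesis by (simp add: P_args_def)
qed

lemma E_Elem:
  assumes j: "j \<in> {1..\<alpha> n} - \<alpha> ` {..n}" and b: "k j = Elem b"
  shows "E j = App (Inr (dp \<phi> j, b)) (map (\<lambda>l. E (chain \<phi> j l)) [1..<dp \<phi> j])"
proof -
  have "bodies (\<lambda>ob c. c) (Inr (j, H (ObT j))) = App (Inr (dp \<phi> j, b)) (P_args \<phi> j)"
    using P_tm_class_simps(2)[OF X \<phi>h _ k[OF j]] j b H_simps(2)[OF j] by simp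
  from F_P_args[OF _ this] j show ?thesis unfolding E_def by (subst S_arg.simps) simp
qed

lemma E_Proj:
  assumes j: "j \<in> {1..\<alpha> n} - \<alpha> ` {..n}" and i: "k j = Proj i"
  shows "E j = E i"
proof -
  have "bodies (\<lambda>ob c. c) (Inr (j, H (ObT j))) = V i"
    using P_tm_class_simps(2)[OF X \<phi>h _ k[OF j]] j i H_simps(2)[OF j] by simp
  moreover have "i \<in> {1..<j}" using k_Proj[OF j i] by simp
  ultimately show ?thesis using j unfolding E_def by (subst S_arg.simps) (auto simp: args_def)
qed

lemma E_root: "j \<in> {1..\<alpha> n} \<Longrightarrow> E (root j) = E j"
proof (induct j rule: less_induct)
  case (less j)
  show ?case
  proof (cases "j \<in> \<alpha> ` {..n} \<or> (\<exists>b. k j = Elem b)")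
    case True
    then show ?thesis using root_stop[of j] by auto
  next
    case False
    then obtain i where i: "k j = Proj i" by (cases "k j") auto
    have j: "j \<in> {1..\<alpha> n} - \<alpha> ` {..n}" using False less by simp
    then show ?thesis using less(1)[of i] k_Proj[OF j i] root_step[OF j i] E_Proj[OF j i] by auto
  qed
qed

text \<open>Here the heap \<open>\<phi>\<close> is exchanged for \<open>\<beta>\<close>: an ancestor and its
  root have the same expansion.\<close>

lemma E_chain: "j \<in> {1..\<alpha> n} \<Longrightarrow> l \<in> {1..<dp \<phi> j} \<Longrightarrow> E (chain \<phi> j l) = E (chain \<beta> j l)"
  using E_root[of "chain \<phi> j l"] chain_in(1)[OF \<phi>, of j l] by (simp add: chain_\<beta>)

abbreviation E_args :: "nat \<Rightarrow> 'a fsym expr list" where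
  "E_args j \<equiv> map (\<lambda>l. E (chain \<beta> j l)) [1..<dp \<beta> j]"

lemma E_args_\<phi>: "j \<in> {1..\<alpha> n} \<Longrightarrow> map (\<lambda>l. E (chain \<phi> j l)) [1..<dp \<phi> j] = E_args j"
  using E_chain by (auto simp: dp_\<beta>)

lemma F_SP_type:
  assumes i: "i \<in> {1..n}"
  shows "F (S_type n \<alpha> H i) = App (Inl (dp \<beta> (\<alpha> i), h (\<alpha> i))) (E_args (\<alpha> i))"
proof -
  note a = \<alpha>_in[OF i]
  have "bodies (\<lambda>ob c. c) (Inl (\<alpha> i, H (Ob (\<alpha> i)))) = App (Inl (dp \<phi> (\<alpha> i), h (\<alpha> i))) (P_args \<phi> (\<alpha> i))"
    using P_ty_class_simps(2)[OF X \<phi>h a] H_simps(1)[OF a] by (simp add: P_type_def)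
  from F_P_args[OF a this] show ?thesis unfolding S_type_def S_args_def E_args_\<phi>[OF a] dp_\<beta>[OF a] .
qed

text \<open>The map from the heap \<open>\<psi>\<close> to \<open>SX\<close> that belongs to the element of
  \<open>PSX\<close>.\<close>

definition C :: "nat \<Rightarrow> 'a M" where "C = snd (PS_classes X n (to_PS n (\<alpha>, \<beta>, h, k)))"

lemma to_PS: "to_PS n (\<alpha>, \<beta>, h, k) = (\<psi>, \<lambda>p \<in> {1..n}. (\<alpha>' p, h' p))"
  by (simp add: to_PS_def)

lemma PS_classes: "PS_classes X n (to_PS n (\<alpha>, \<beta>, h, k)) = (\<psi>, C)"
  unfolding C_def to_PS by (simp add: PS_classes_def)

lemma C_P_ty: "(\<psi>, C) \<in> P_ty (S_obj X) n"
proof -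
  have "PS_classes X n (to_PS n (\<alpha>, \<beta>, h, k)) \<in> P_ty (S_obj X) n"
    using PS_classes_P_ty[OF X] to_PS_ty unfolding to_PS by blast
  then show ?thesis unfolding PS_classes .
qed

lemma C_apply: "p \<in> {1..n} \<Longrightarrow> C p = S_ty_class X (dp \<psi> p) (\<alpha>' p, h' p)"
  unfolding C_def to_PS by (simp add: PS_classes_def)

text \<open>The arguments in the constant of \<open>PSX\<close> at \<open>p\<close>, with its variables
  instantiated by the ancestors of \<open>p\<close>, are the expanded arguments on the side of
  \<open>SPX\<close>. A depth in the image of \<open>\<alpha>' p\<close> gives a variable on both sides; at
  any other depth the ancestor of \<open>\<alpha> p\<close> carries a term-element, which both sides apply to
  the arguments at smaller depths.\<close>

lemma pulled_S_arg:
  assumes p: "p \<in> {1..n}"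
  shows "j \<in> {1..<dp \<beta> (\<alpha> p)} \<Longrightarrow> ren (chain \<psi> p) (S_arg (dp \<psi> p) (\<alpha>' p) (h' p) j) = E (chain \<beta> (\<alpha> p) j)"
proof (induct j rule: less_induct)
  case (less j)
  have j: "j \<in> {1..dp \<beta> (\<alpha> p)}" using less(2) by simp
  note ap = \<alpha>_in[OF p]
  note I = Inc_D[OF \<alpha>'_Inc[OF p]]
  show ?case
  proof (cases "j \<in> \<alpha>' p ` {..dp \<psi> p}")
    case True
    then obtain l where l: "j = \<alpha>' p l" "l \<le> dp \<psi> p" by auto
    then have l1: "l \<in> {1..dp \<psi> p}" using j \<alpha>'_simps(1)[of p] by (cases "l = 0") auto
    have "chain \<psi> p l \<le> n" using chain_in(1)[OF \<psi> p l1] p by simp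
    then have "E (chain \<beta> (\<alpha> p) j) = V (chain \<psi> p l)" using E_image \<alpha>_chain(1)[OF p l1] l(1) by metis
    moreover have "inv_into {..dp \<psi> p} (\<alpha>' p) j = l" using l I(4) by (simp add: inv_into_f_f)
    ultimately show ?thesis using True by (subst S_arg.simps) (simp add: ren_def)
  next
    case False
    let ?c = "chain \<beta> (\<alpha> p) j"
    note c = chain_in[OF \<beta> ap j]
    have c1: "?c \<in> {1..\<alpha> n}" using c(1) ap by auto
    have off: "?c \<in> {1..\<alpha> n} - \<alpha> ` {..n}" using in_image_\<alpha>'[OF p j] False c1 by simp
    have "E ?c = App (Inr (j, h' p (ObT j))) (E_args ?c)"
      using E_Elem[OF off off_\<alpha>'_Elem(1)[OF p j False]] E_args_\<phi>[OF c1] c(2) dp_\<beta>[OF c1] by simp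
    moreover have "E_args ?c = map (\<lambda>l. ren (chain \<psi> p) (S_arg (dp \<psi> p) (\<alpha>' p) (h' p) l)) [1..<j]"
    proof -
      have "E (chain \<beta> ?c l) = ren (chain \<psi> p) (S_arg (dp \<psi> p) (\<alpha>' p) (h' p) l)" if "l \<in> {1..<j}" for l
        using less(1)[of l] less(2) that chain_chain[OF \<beta> ap j, of l] by simp
      then show ?thesis using c(2) by simp
    qed
    ultimately show ?thesis using False by (subst S_arg.simps) (simp add: ren_App comp_def)
  qed
qed

lemma ren_pulled_args:
  assumes p: "p \<in> {1..n}"
  shows "ren (\<lambda>i. map (chain \<psi> p) [1..<dp \<psi> p] ! (i - 1)) (App d (S_args (dp \<psi> p) (\<alpha>' p) (h' p) (dp \<psi> p)))
    = App d (E_args (\<alpha> p))"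
proof -
  let ?\<rho> = "\<lambda>i. map (chain \<psi> p) [1..<dp \<psi> p] ! (i - 1)"
  have m: "dp \<psi> p \<ge> 1" using dp_pos[OF \<psi>, of p] p by simp
  have "ren ?\<rho> (S_arg (dp \<psi> p) (\<alpha>' p) (h' p) j) = E (chain \<beta> (\<alpha> p) j)" if j: "j \<in> {1..<dp \<beta> (\<alpha> p)}" for j
  proof -
    have "fv (S_arg (dp \<psi> p) (\<alpha>' p) (h' p) j) \<subseteq> {1..<dp \<psi> p}"
      using S_arg_fv[OF X m pulled_S_ty[OF p]] j \<alpha>'_top[OF p] by simp
    then have "ren ?\<rho> (S_arg (dp \<psi> p) (\<alpha>' p) (h' p) j) = ren (chain \<psi> p) (S_arg (dp \<psi> p) (\<alpha>' p) (h' p) j)"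
      by (intro ren_cong) (force simp del: upt_Suc)
    then show ?thesis using pulled_S_arg[OF p j] by simp
  qed
  then show ?thesis by (simp add: ren_App S_args_def \<alpha>'_top[OF p] comp_def)
qed

lemma F_App_chain:
  assumes p: "p \<in> {1..n}" and c: "bodies (\<lambda>ob c. c) c = App d (S_args (dp \<psi> p) (\<alpha>' p) (h' p) (dp \<psi> p))"
  shows "F (App c (P_args \<psi> p)) = App d (E_args (\<alpha> p))"
proof -
  have m: "dp \<psi> p \<ge> 1" using dp_pos[OF \<psi>, of p] p by simp
  let ?vs = "map (chain \<psi> p) [1..<dp \<psi> p]"
  have fv: "fv (App d (S_args (dp \<psi> p) (\<alpha>' p) (h' p) (dp \<psi> p))) \<subseteq> {1..<Suc (length ?vs)}"
    using S_arg_fv[OF X m pulled_S_ty[OF p]] m by (fastforce simp: S_args_def)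
  have "F (App c (map V ?vs)) = ren (\<lambda>i. ?vs ! (i - 1)) (App d (S_args (dp \<psi> p) (\<alpha>' p) (h' p) (dp \<psi> p)))"
    using expand_App_vars[of "bodies (\<lambda>ob c. c)" c ?vs] fv c by simp
  moreover have "(map V ?vs :: 'a M fsym expr list) = P_args \<psi> p" by (simp add: P_args_def)
  ultimately show ?thesis by (simp only: ren_pulled_args[OF p])
qed

lemma h'_top: "p \<in> {1..n} \<Longrightarrow> h' p (Ob (dp \<beta> (\<alpha> p))) = h (\<alpha> p)"
  using h'_Ob[of p "dp \<beta> (\<alpha> p)"] dp_pos[OF \<beta>, of "\<alpha> p"] \<alpha>_in[of p] by simp

lemma F_PS_type:
  assumes p: "p \<in> {1..n}"
  shows "F (P_type \<psi> C p) = App (Inl (dp \<beta> (\<alpha> p), h (\<alpha> p))) (E_args (\<alpha> p))"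
proof -
  have m: "dp \<psi> p \<ge> 1" using dp_pos[OF \<psi>, of p] p by simp
  have "bodies (\<lambda>ob c. c) (Inl (dp \<psi> p, C p)) = App (Inl (dp \<beta> (\<alpha> p), h (\<alpha> p))) (S_args (dp \<psi> p) (\<alpha>' p) (h' p) (dp \<psi> p))"
    using S_ty_class_simps(2)[OF X pulled_S_ty[OF p] m] C_apply[OF p]
    by (simp add: S_type_def \<alpha>'_top[OF p] h'_top[OF p])
  from F_App_chain[OF p this] show ?thesis by (simp only: P_type_def)
qed

lemma flatten_contexts:
  "map (\<lambda>(x, T). (x, F T)) (S_ctx n \<alpha> H) = map (\<lambda>(x, T). (x, F T)) (P_ctx n \<psi> C)"
  using F_SP_type F_PS_type by (auto simp: S_ctx_def P_ctx_def)

lemma dist_law_types: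
  "dist_law X (Ob n) (SP_ty_class X n (\<alpha>, \<phi>, h, k)) = PS_ty_class X n (to_PS n (\<alpha>, \<beta>, h, k))"
proof -
  let ?J = "Judg (S_ctx n \<alpha> H) (IsType (S_type n \<alpha> H n))" and ?J' = "Judg (P_ctx n \<psi> C) (IsType (P_type \<psi> C n))"
  have J: "fderiv DS (P_obj X) ?J" by (rule S_fderiv(1)[OF PX n SP_classes_S_ty])
  have J': "fderiv DP (S_obj X) ?J'" using P_type_fderiv[OF SX C_P_ty, of DP n] n by simp
  have "flatten ?J' = flatten ?J" using flatten_contexts F_SP_type[of n] F_PS_type[of n] n by simp
  from dist_law_eqI[OF X J J' this] show ?thesis
    using n by (simp add: SP_ty_class_def PS_ty_class_def SP_classes PS_classes S_ty_class_def P_ty_class_def S_ctx_def)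
qed

text \<open>If \<open>\<alpha> p\<close> and \<open>\<alpha> q\<close> have the same parent, then
  \<open>p\<close> and \<open>q\<close> have the same strict ancestors, apart from the possibility that one of
  them is an ancestor of the other, which the parents exclude.\<close>

lemma same_parent_\<psi>:
  assumes p: "p \<in> {1..n}" and q: "q \<in> {1..n}" and eq: "\<beta> (\<alpha> p) = \<beta> (\<alpha> q)" and lt: "p < q"
  shows "\<psi> q = \<psi> p"
proof -
  have anc: "heap_le \<psi> i q' \<Longrightarrow> heap_le \<psi> i p'" if i: "i \<in> {1..n}" "i \<noteq> q'" and p': "p' \<in> {1..n}" and q': "q' \<in> {1..n}"
    and e: "\<beta> (\<alpha> p') = \<beta> (\<alpha> q')" for i p' q'
  proof -
    assume "heap_le \<psi> i q'"
    then have le: "heap_le \<beta> (\<alpha> i) (\<alpha> q')" using \<psi>_le i q' by blast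
    have ne: "\<alpha> i \<noteq> \<alpha> q'" using \<alpha>_simps(4) i q' by (auto dest: inj_onD)
    have "heap_le \<beta> (\<alpha> i) (\<beta> (\<alpha> p'))" using heap_le_parent(2)[OF \<beta> _ le ne] \<alpha>_in[OF q'] e by simp
    moreover have "heap_le \<beta> (\<beta> (\<alpha> p')) (\<alpha> p')" unfolding heap_le_def by (rule exI[of _ 1]) simp
    ultimately show "heap_le \<psi> i p'" using heap_le_trans \<psi>_le i p' by blast
  qed
  have par: "\<psi> q' \<le> \<psi> p'" if "p' \<in> {1..n}" "q' \<in> {1..n}" "\<beta> (\<alpha> p') = \<beta> (\<alpha> q')" "\<psi> q' \<noteq> p'" for p' q'
  proof (cases "\<psi> q' = 0")
    case False
    have i: "\<psi> q' \<in> {1..n}" "\<psi> q' \<noteq> q'" using False Hp_D(2,4)[OF \<psi>, of q'] that(2) by auto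
    have "heap_le \<psi> (\<psi> q') q'" unfolding heap_le_def by (rule exI[of _ 1]) simp
    then have "heap_le \<psi> (\<psi> q') p'" using anc i that by blast
    then show ?thesis using heap_le_parent(1)[OF \<psi>] that by simp
  qed simp
  have "\<psi> q \<noteq> p"
  proof
    assume "\<psi> q = p"
    then have "heap_le \<psi> p q" unfolding heap_le_def by (intro exI[of _ 1]) simp
    then have le: "heap_le \<beta> (\<alpha> p) (\<alpha> q)" using \<psi>_le p q by blast
    have "\<alpha> p < \<alpha> q" using \<alpha>_simps(2)[of p q] p q lt by simp
    then have "\<alpha> p \<le> \<beta> (\<alpha> p)" using heap_le_parent(1)[OF \<beta> _ le] \<alpha>_in[OF q] eq by simp
    then show False using Hp_D(2)[OF \<beta> \<alpha>_in[OF p]] by simp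
  qed
  moreover have "\<psi> p \<noteq> q" using Hp_D(2)[OF \<psi> p] lt by simp
  ultimately show ?thesis using par[of p q] par[of q p] p q eq by simp
qed

text \<open>All data of the element of \<open>PSX\<close> at \<open>p\<close> and at \<open>n\<close> agree,
  because they depend on the common parent of \<open>\<alpha> p\<close> and \<open>\<alpha> n\<close> and on
  the common value of \<open>h\<close>.\<close>

lemma projection_transported:
  assumes p: "p \<in> {1..<n}" and eq: "\<beta> (\<alpha> p) = \<beta> (\<alpha> n)" "h (\<alpha> p) = h (\<alpha> n)"
  shows "Proj p \<in> PS_tm X n (to_PS n (\<alpha>, \<beta>, h, k))"
proof -
  have p1: "p \<in> {1..n}" and nn: "n \<in> {1..n}" using p by auto
  have par: "\<psi> n = \<psi> p" using same_parent_\<psi>[OF p1 nn eq(1)] p by simp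
  have d: "dp \<psi> n = dp \<psi> p" using same_parent(1)[OF \<psi> nn p1 par] .
  have db: "dp \<beta> (\<alpha> n) = dp \<beta> (\<alpha> p)" using same_parent(1)[OF \<beta> \<alpha>_in[OF nn] \<alpha>_in[OF p1]] eq(1) by simp
  have a: "\<alpha>' n l = \<alpha>' p l" for l
  proof -
    consider "l = 0" | "l \<in> {1..<dp \<psi> p}" | "l = dp \<psi> p" | "l > dp \<psi> p" by fastforce
    then show ?thesis
    proof cases
      case 2
      then have "chain \<psi> n l = chain \<psi> p l" using same_parent(2)[OF \<psi> nn p1 par, of l] by simp
      then show ?thesis using 2 d by (simp add: \<alpha>'_simps)
    next
      case 3
      then show ?thesis using \<alpha>'_top[OF nn] \<alpha>'_top[OF p1] d db by simp
    qed (use d in \<open>simp_all add: pull_inc_def\<close>)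
  qed
  then have a': "\<alpha>' n = \<alpha>' p" by (rule ext)
  have "h' n ob = h' p ob" for ob
  proof (cases "ob \<in> cells (dp \<psi> p) (\<alpha>' p)")
    case False
    then show ?thesis using a' d by (simp add: pull_map_def)
  next
    case True
    have ch: "chain \<beta> (\<alpha> n) i = chain \<beta> (\<alpha> p) i" if "i \<in> {1..<dp \<beta> (\<alpha> p)}" for i
      using same_parent(2)[OF \<beta> \<alpha>_in[OF nn] \<alpha>_in[OF p1], of i] eq(1) that by simp
    show ?thesis
    proof (cases ob)
      case (Ob i)
      then have i: "i \<in> {1..dp \<beta> (\<alpha> p)}" using True \<alpha>'_top[OF p1] by (auto simp: cells_def)
      show ?thesis
      proof (cases "i = dp \<beta> (\<alpha> p)")
        case True
        then show ?thesis using Ob h'_top[OF nn] h'_top[OF p1] db eq(2) by simp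
      next
        case False
        then show ?thesis using Ob i ch[of i] h'_Ob[OF nn, of i] h'_Ob[OF p1, of i] db by simp
      qed
    next
      case (ObT i)
      then have i: "i \<in> {1..dp \<beta> (\<alpha> p)}" "i \<notin> \<alpha>' p ` {..dp \<psi> p}" using True \<alpha>'_top[OF p1] by (auto simp: cells_def)
      then show ?thesis using ObT ch[of i] off_\<alpha>'_Elem(3)[OF p1 i] h'_ObT[OF nn, of i] h'_ObT[OF p1 i] db d a' by simp
    qed
  qed
  then have "h' n = h' p" by (rule ext)
  then show ?thesis using par a' p by (auto simp: PS_tm_def to_PS)
qed

lemma SP_tm_Elem: "Elem b \<in> SP_tm X n (\<alpha>, \<phi>, h, k) \<longleftrightarrow> b \<in> Tm X (dp \<phi> (\<alpha> n)) (h (\<alpha> n))"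
  by (auto simp: SP_tm_def P_tm_def)

lemma SP_tm_Proj: "Proj j \<in> SP_tm X n (\<alpha>, \<phi>, h, k) \<longleftrightarrow> j \<in> {1..<\<alpha> n} \<and> \<phi> (\<alpha> n) = \<phi> j \<and> h (\<alpha> n) = h j"
  by (auto simp: SP_tm_def P_tm_def)

lemma Elem_PS_tm: "Elem b \<in> PS_tm X n (to_PS n (\<alpha>, \<beta>, h, k)) \<longleftrightarrow> b \<in> Tm X (dp \<phi> (\<alpha> n)) (h (\<alpha> n))"
proof -
  have nn: "n \<in> {1..n}" using n by simp
  have "h' n (Ob (dp \<phi> (\<alpha> n))) = h (\<alpha> n)" using h'_top[OF nn] dp_\<beta>[OF n_pos] by simp
  then show ?thesis using n by (auto simp: PS_tm_def to_PS S_tm_def \<alpha>'_top[OF nn] dp_\<beta>[OF n_pos])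
qed

abbreviation image_term :: "'a pterm \<Rightarrow> 'a pterm" where
  "image_term a \<equiv> (case a of Elem b \<Rightarrow> Elem b
     | Proj j \<Rightarrow> (let m = root j in if m \<in> \<alpha> ` {..n} then Proj (inv_into {..n} \<alpha> m) else k m))"

text \<open>A projection \<open>\<pi>\<^sub>j\<close> expands to \<open>E j\<close>, which equals \<open>E
  m\<close> for the root \<open>m\<close> of \<open>j\<close>; the two cases are those of a variable and of a
  term-element at \<open>m\<close>.\<close>

lemma F_Proj:
  assumes j: "j \<in> {1..<\<alpha> n}" "\<phi> (\<alpha> n) = \<phi> j" "h (\<alpha> n) = h j"
  shows "(\<exists>p \<in> {1..<n}. image_term (Proj j) = Proj p \<and> Proj p \<in> PS_tm X n (to_PS n (\<alpha>, \<beta>, h, k)) \<and> E j = V p) \<or>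
    (\<exists>b. image_term (Proj j) = Elem b \<and> b \<in> Tm X (dp \<phi> (\<alpha> n)) (h (\<alpha> n)) \<and>
      E j = App (Inr (dp \<beta> (\<alpha> n), b)) (E_args (\<alpha> n)))"
proof -
  let ?m = "root j"
  have j': "j \<in> {1..\<alpha> n}" using j(1) by simp
  note r = root_props[OF j']
  have m: "?m \<in> {1..<\<alpha> n}" "\<phi> ?m = \<phi> (\<alpha> n)" "h ?m = h (\<alpha> n)" using r j by auto
  have Em: "E j = E ?m" using E_root[OF j'] by simp
  show ?thesis
  proof (cases "?m \<in> \<alpha> ` {..n}")
    case True
    then obtain p where p: "?m = \<alpha> p" "p \<le> n" by auto
    then have p1: "p \<in> {1..<n}" using m(1) \<alpha>_simps(1) by (cases "p = 0"; cases "p = n") auto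
    have "inv_into {..n} \<alpha> ?m = p" using p \<alpha>_simps(4) by (simp add: inv_into_f_f)
    then have "image_term (Proj j) = Proj p" using True by simp
    moreover have "Proj p \<in> PS_tm X n (to_PS n (\<alpha>, \<beta>, h, k))"
      by (rule projection_transported[OF p1]) (use m p \<alpha>_in[of p] p1 in \<open>auto simp: \<beta>_apply\<close>)
    moreover have "E j = V p" using Em p E_image by simp
    ultimately show ?thesis using p1 by blast
  next
    case False
    then obtain b where b: "k ?m = Elem b" using r by auto
    have m1: "?m \<in> {1..\<alpha> n}" and off: "?m \<in> {1..\<alpha> n} - \<alpha> ` {..n}" using m(1) False by auto
    have d: "dp \<phi> ?m = dp \<phi> (\<alpha> n)" using same_parent(1)[OF \<phi> m1 n_pos m(2)] .
    have "map (\<lambda>l. E (chain \<phi> ?m l)) [1..<dp \<phi> ?m] = map (\<lambda>l. E (chain \<phi> (\<alpha> n) l)) [1..<dp \<phi> (\<alpha> n)]"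
      using same_parent(2)[OF \<phi> m1 n_pos m(2)] d by simp
    then have "E ?m = App (Inr (dp \<beta> (\<alpha> n), b)) (E_args (\<alpha> n))"
      using E_Elem[OF off b] d dp_\<beta>[OF n_pos] E_args_\<phi>[OF n_pos] by simp
    moreover have "image_term (Proj j) = Elem b" using False b by simp
    moreover have "b \<in> Tm X (dp \<phi> (\<alpha> n)) (h (\<alpha> n))" using k_Elem[OF off b] d m(3) by simp
    ultimately show ?thesis using Em by auto
  qed
qed

lemma image_term_props:
  assumes a: "a \<in> SP_tm X n (\<alpha>, \<phi>, h, k)"
  shows "image_term a \<in> PS_tm X n (to_PS n (\<alpha>, \<beta>, h, k))"
    and "F (App (Inr (\<alpha> n, P_tm_class X (\<alpha> n) (\<phi>, h) a)) (S_args n \<alpha> H n))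
      = F (P_term \<psi> n (PS_tm_code X n (to_PS n (\<alpha>, \<beta>, h, k)) (image_term a)))"
proof -
  have nn: "n \<in> {1..n}" using n by simp
  have m: "dp \<psi> n \<ge> 1" using dp_pos[OF \<psi>, of n] by simp
  have PS_Elem: "F (P_term \<psi> n (PS_tm_code X n (to_PS n (\<alpha>, \<beta>, h, k)) (Elem b))) = App (Inr (dp \<beta> (\<alpha> n), b)) (E_args (\<alpha> n))"
    if b: "b \<in> Tm X (dp \<phi> (\<alpha> n)) (h (\<alpha> n))" for b
  proof -
    have b': "b \<in> S_tm X (dp \<psi> n) (\<alpha>' n, h' n)"
      using b h'_top[OF nn] by (simp add: S_tm_def \<alpha>'_top[OF nn] dp_\<beta>[OF n_pos])
    have "bodies (\<lambda>ob c. c) (Inr (dp \<psi> n, S_tm_class X (dp \<psi> n) (\<alpha>' n, h' n) b))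
        = App (Inr (dp \<beta> (\<alpha> n), b)) (S_args (dp \<psi> n) (\<alpha>' n) (h' n) (dp \<psi> n))"
      using S_tm_class_simps(2)[OF X pulled_S_ty[OF nn] m b'] by (simp add: \<alpha>'_top[OF nn])
    from F_App_chain[OF nn this] show ?thesis using nn by (simp add: to_PS del: expand.simps)
  qed
  have P: "P_restrict (\<alpha> n) (\<phi>, h) = (\<phi>, h)" by (rule P_restrict_all[OF \<phi>h])
  have aP: "a \<in> P_tm X (\<alpha> n) (P_restrict (\<alpha> n) (\<phi>, h))" using a P by (simp add: SP_tm_def)
  have can: "can (P_tm_class X (\<alpha> n) (\<phi>, h) a) = Judg (P_ctx (\<alpha> n) \<phi> h) (HasType (P_term \<phi> (\<alpha> n) a) (P_type \<phi> h (\<alpha> n)))"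
    using P_tm_class_simps(2)[OF X \<phi>h n_pos aP] P by simp
  have "image_term a \<in> PS_tm X n (to_PS n (\<alpha>, \<beta>, h, k)) \<and>
    F (App (Inr (\<alpha> n, P_tm_class X (\<alpha> n) (\<phi>, h) a)) (S_args n \<alpha> H n))
      = F (P_term \<psi> n (PS_tm_code X n (to_PS n (\<alpha>, \<beta>, h, k)) (image_term a)))"
  proof (cases a)
    case (Elem b)
    have b: "b \<in> Tm X (dp \<phi> (\<alpha> n)) (h (\<alpha> n))" using a Elem SP_tm_Elem by blast
    have "bodies (\<lambda>ob c. c) (Inr (\<alpha> n, P_tm_class X (\<alpha> n) (\<phi>, h) a)) = App (Inr (dp \<phi> (\<alpha> n), b)) (P_args \<phi> (\<alpha> n))"
      using can Elem by simp
    from F_P_args[OF n_pos this] PS_Elem[OF b] Elem_PS_tm b Elem show ?thesis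
      unfolding S_args_def E_args_\<phi>[OF n_pos] dp_\<beta>[OF n_pos] by simp
  next
    case (Proj j)
    have j: "j \<in> {1..<\<alpha> n}" "\<phi> (\<alpha> n) = \<phi> j" "h (\<alpha> n) = h j" using a Proj SP_tm_Proj by auto
    have "bodies (\<lambda>ob c. c) (Inr (\<alpha> n, P_tm_class X (\<alpha> n) (\<phi>, h) a)) = V j" using can Proj by simp
    then have l: "F (App (Inr (\<alpha> n, P_tm_class X (\<alpha> n) (\<phi>, h) a)) (S_args n \<alpha> H n)) = E j"
      using j(1) by (auto simp: S_args_def args_def E_def)
    from F_Proj[OF j] show ?thesis
    proof (elim disjE bexE exE conjE)
      fix p assume "image_term (Proj j) = Proj p" "Proj p \<in> PS_tm X n (to_PS n (\<alpha>, \<beta>, h, k))" "E j = V p"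
      then show ?thesis using l Proj by simp
    next
      fix b assume b: "image_term (Proj j) = Elem b" "b \<in> Tm X (dp \<phi> (\<alpha> n)) (h (\<alpha> n))"
        "E j = App (Inr (dp \<beta> (\<alpha> n), b)) (E_args (\<alpha> n))"
      have ia: "image_term a = Elem b" using b(1) Proj by simp
      show ?thesis unfolding ia l b(3) PS_Elem[OF b(2)] using Elem_PS_tm b(2) by simp
    qed
  qed
  then show "image_term a \<in> PS_tm X n (to_PS n (\<alpha>, \<beta>, h, k))"
    and "F (App (Inr (\<alpha> n, P_tm_class X (\<alpha> n) (\<phi>, h) a)) (S_args n \<alpha> H n))
      = F (P_term \<psi> n (PS_tm_code X n (to_PS n (\<alpha>, \<beta>, h, k)) (image_term a)))" by blast+
qed

lemma dist_law_terms:
  assumes a: "a \<in> SP_tm X n (\<alpha>, \<phi>, h, k)"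
  shows "dist_law X (ObT n) (SP_tm_class X n (\<alpha>, \<phi>, h, k) a) = PS_tm_class X n (to_PS n (\<alpha>, \<beta>, h, k)) (image_term a)"
proof -
  let ?c = "P_tm_class X (\<alpha> n) (\<phi>, h) a" and ?a = "PS_tm_code X n (to_PS n (\<alpha>, \<beta>, h, k)) (image_term a)"
  let ?J = "Judg (S_ctx n \<alpha> H) (HasType (App (Inr (\<alpha> n, ?c)) (S_args n \<alpha> H n)) (S_type n \<alpha> H n))"
    and ?J' = "Judg (P_ctx n \<psi> C) (HasType (P_term \<psi> n ?a) (P_type \<psi> C n))"
  note im = image_term_props[OF a]
  have P: "P_restrict (\<alpha> n) (\<phi>, h) = (\<phi>, h)" by (rule P_restrict_all[OF \<phi>h])
  have aP: "a \<in> P_tm X (\<alpha> n) (P_restrict (\<alpha> n) (\<phi>, h))" using a P by (simp add: SP_tm_def)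
  have "?c \<in> S_tm (P_obj X) n (\<alpha>, H)"
    using P_tm_class_simps(1)[OF X \<phi>h n_pos aP] H_simps(1)[OF n_pos] P by (simp add: S_tm_def)
  then have J: "fderiv DS (P_obj X) ?J" by (rule S_fderiv(2)[OF PX n SP_classes_S_ty])
  have "?a \<in> P_tm (S_obj X) n (\<psi>, C)"
    using PS_tm_code[OF X n _ im(1)[unfolded to_PS]] to_PS_ty PS_classes unfolding to_PS by simp
  then have J': "fderiv DP (S_obj X) ?J'" by (rule P_term_fderiv[OF SX C_P_ty n])
  have "flatten ?J' = flatten ?J" using flatten_contexts F_SP_type[of n] F_PS_type[of n] n im(2) by (simp del: expand.simps)
  from dist_law_eqI[OF X J J' this] show ?thesis
    using n by (simp add: SP_tm_class_def PS_tm_class_def SP_classes PS_classes S_tm_class_def P_tm_class_def S_ctx_def)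
qed

end

theorem proposition41:
  fixes X :: "'a presheaf" and n :: nat
    and \<alpha> \<phi> :: "nat \<Rightarrow> nat" and h :: "nat \<Rightarrow> 'a" and k :: "nat \<Rightarrow> 'a pterm"
  assumes "is_presheaf X" and "n \<ge> 1" and "(\<alpha>, \<phi>, h, k) \<in> SP_ty X n"
  shows "let z = to_PS n (\<alpha>, bar_heap n \<alpha> k \<phi>, h, k) in
      z \<in> PS_ty X n \<and>
      dist_law X (Ob n) (SP_ty_class X n (\<alpha>, \<phi>, h, k)) = PS_ty_class X n z \<and>
      (\<forall>a \<in> SP_tm X n (\<alpha>, \<phi>, h, k).
         let a' = (case a of
             Elem b \<Rightarrow> Elem b
           | Proj j \<Rightarrow> (let m = k_min n \<alpha> k j in
               if m \<in> \<alpha> ` {..n} then Proj (inv_into {..n} \<alpha> m) else k m))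
         in a' \<in> PS_tm X n z \<and>
            dist_law X (ObT n) (SP_tm_class X n (\<alpha>, \<phi>, h, k) a) = PS_tm_class X n z a')"
proof -
  interpret SP_element X n \<alpha> \<phi> h k by standard (use assms in auto)
  show ?thesis unfolding Let_def
    using to_PS_ty dist_law_types image_term_props(1) dist_law_terms unfolding Let_def by blast
qed

end
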